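(* Let $X\subset\mathbb R^n$ be open. Assume that $F\subset\operatorname{Sym}^2(\mathbb R^n)$ is a Dirichlet set that is a convex cone over $0$. Suppose that $K\subset X\times\mathbb R^m$ is closed (in $X\times\mathbb R^m$) and bounded and such that (1) $(\operatorname{Int}K)_x=\operatorname{Int}(K_x)$ and this set is non-empty for all $x\in X$; (2) there is an $F\star\mathcal P$-subharmonic function $\rho$ on a neighbourhood of $K$ such that $K=\{\rho\le0\}$. Then the map $x\mapsto-\log\operatorname{vol}(K_x)$ is $F$-subharmonic on $X$.
   Context: $\operatorname{Sym}^2(\mathbb R^n)$ is the space of real symmetric $n\times n$ matrices and $\mathcal P=\mathcal P_n$ its subset of positive semidefinite matrices. A Dirichlet set is a non-empty, proper, closed subset $F\subset\operatorname{Sym}^2(\mathbb R^n)$ with $F+\mathcal P_n\subset F$. It is a cone over $0$ if $A\in F$, $t\ge0$ imply $tA\in F$. For $Y\subset\mathbb R^N$ open, $G\subset\operatorname{Sym}^2(\mathbb R^N)$ a Dirichlet set and $f:Y\to\mathbb R\cup\{-\infty\}$ upper-semicontinuous, a test function for $f$ at $x_0\in Y$ is a smooth function $g$ on a neighbourhood of $x_0$ with $g\ge f$ there and $g(x_0)=f(x_0)$. The function $f$ is $G$-subharmonic if $\operatorname{Hess}_{x_0}(g)\in G$ for every $x_0\in Y$ and every test function $g$ for $f$ at $x_0$. Write $A\in\operatorname{Sym}^2(\mathbb R^{n+m})$ in blocks as $A=\begin{pmatrix}B&C\\C^T&D\end{pmatrix}$ with $B\in\operatorname{Sym}^2(\mathbb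 R^n)$, $D\in\operatorname{Sym}^2(\mathbb R^m)$. For a real $m\times n$ matrix $\Gamma$ put $i_\Gamma^*A=\begin{pmatrix}I\\ \Gamma\end{pmatrix}^TA\begin{pmatrix}I\\ \Gamma\end{pmatrix}=B+C\Gamma+\Gamma^TC^T+\Gamma^TD\Gamma$. Then $F\star\mathcal P\subset\operatorname{Sym}^2(\mathbb R^{n+m})$ is the Dirichlet set of all $A$ with $D\in\mathcal P_m$ and $i_\Gamma^*A\in F$ for all $m\times n$ matrices $\Gamma$. For a set $S\subset X\times\mathbb R^m$, $S_x=\{y\in\mathbb R^m:(x,y)\in S\}$. $\operatorname{vol}$ is Lebesgue measure on $\mathbb R^m$.
   Formalization: It is additionally assumed that every fibre K_x, x in X, is connected; without this the claim fails, e.g. for two disjoint families of discs in R^2 of radii 1+x and 1-x with ρ defined separately near each. *)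

theory Defs
  imports "HOL-Analysis.Analysis"
begin

definition sym_mats :: "(real^'n^'n) set" where
  "sym_mats = {A. transpose A = A}"

definition psd_mats :: "(real^'n^'n) set" where
  "psd_mats = {A \<in> sym_mats. \<forall>v. 0 \<le> v \<bullet> (A *v v)}"

definition dirichlet_set :: "(real^'n^'n) set \<Rightarrow> bool" where
  "dirichlet_set F \<longleftrightarrow>
     F \<noteq> {} \<and> F \<subset> sym_mats \<and> closed F \<and> (\<forall>A\<in>F. \<forall>P\<in>psd_mats. A + P \<in> F)"

definition partial_deriv :: "'n \<Rightarrow> (real^'n \<Rightarrow> real) \<Rightarrow> real^'n \<Rightarrow> real" where
  "partial_deriv i g x = frechet_derivative g (at x) (axis i 1)"

primrec Ck_on :: "nat \<Rightarrow> (real^'n) set \<Rightarrow> (real^'n \<Rightarrow> real) \<Rightarrow> bool" where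
  "Ck_on 0 V g \<longleftrightarrow> continuous_on V g"
| "Ck_on (Suc k) V g \<longleftrightarrow>
     (\<forall>x\<in>V. g differentiable (at x)) \<and> (\<forall>i. Ck_on k V (partial_deriv i g))"

text \<open>The derivatives are unrestricted (at x rather than at x within V), so this is the usual
  notion of smoothness only for open V.\<close>

definition smooth_on :: "(real^'n) set \<Rightarrow> (real^'n \<Rightarrow> real) \<Rightarrow> bool" where
  "smooth_on V g \<longleftrightarrow> (\<forall>k. Ck_on k V g)"

definition hess :: "(real^'n \<Rightarrow> real) \<Rightarrow> real^'n \<Rightarrow> real^'n^'n" where
  "hess g x = (\<chi> i j. partial_deriv i (partial_deriv j g) x)"

definition usc_on :: "'a::topological_space set \<Rightarrow> ('a \<Rightarrow> ereal) \<Rightarrow> bool" where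
  "usc_on Y f \<longleftrightarrow> (\<forall>a. openin (top_of_set Y) {x \<in> Y. f x < a})"

definition test_function ::
    "(real^'n) set \<Rightarrow> (real^'n \<Rightarrow> ereal) \<Rightarrow> real^'n \<Rightarrow> (real^'n) set \<Rightarrow> (real^'n \<Rightarrow> real) \<Rightarrow> bool" where
  "test_function Y f x0 V g \<longleftrightarrow>
     open V \<and> x0 \<in> V \<and> V \<subseteq> Y \<and> smooth_on V g \<and>
     (\<forall>x\<in>V. f x \<le> ereal (g x)) \<and> ereal (g x0) = f x0"

text \<open>The set Y is meant to be open. Only the values of f on Y matter; the first two conditions
  say that f is an upper-semicontinuous function from Y to the reals extended by minus infinity.\<close>

definition subharmonic ::
    "(real^'n^'n) set \<Rightarrow> (real^'n) set \<Rightarrow> (real^'n \<Rightarrow> ereal) \<Rightarrow> bool" where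
  "subharmonic G Y f \<longleftrightarrow>
     (\<forall>x\<in>Y. f x \<noteq> \<infinity>) \<and> usc_on Y f \<and>
     (\<forall>x0\<in>Y. \<forall>V g. test_function Y f x0 V g \<longrightarrow> hess g x0 \<in> G)"

text \<open>The space of dimension n + m is indexed by the sum type: the Inl coordinates are the
  first n, the Inr coordinates the last m.\<close>

definition join :: "real^'n \<Rightarrow> real^'m \<Rightarrow> real^('n::finite + 'm::finite)" where
  "join x y = (\<chi> i. case i of Inl k \<Rightarrow> x $ k | Inr l \<Rightarrow> y $ l)"

definition cylinder :: "(real^'n) set \<Rightarrow> (real^('n::finite + 'm::finite)) set" where
  "cylinder X = {join x y |x y. x \<in> X}"

definition slice :: "(real^('n::finite + 'm::finite)) set \<Rightarrow> real^'n \<Rightarrow> (real^'m) set" where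
  "slice S x = {y. join x y \<in> S}"

text \<open>The matrix with the identity stacked on top of \<Gamma>.\<close>

definition graph_mat :: "real^'n^'m \<Rightarrow> real^'n^('n::finite + 'm::finite)" where
  "graph_mat \<Gamma> = (\<chi> i j. case i of Inl k \<Rightarrow> mat 1 $ k $ j | Inr l \<Rightarrow> \<Gamma> $ l $ j)"

definition pullback :: "real^'n^'m \<Rightarrow> real^('n::finite + 'm::finite)^('n + 'm) \<Rightarrow> real^'n^'n" where
  "pullback \<Gamma> A = transpose (graph_mat \<Gamma>) ** A ** graph_mat \<Gamma>"

definition lower_block :: "real^('n::finite + 'm::finite)^('n + 'm) \<Rightarrow> real^'m^'m" where
  "lower_block A = (\<chi> i j. A $ Inr i $ Inr j)"

definition star_psd :: "(real^'n^'n) set \<Rightarrow> (real^('n::finite + 'm::finite)^('n + 'm)) set" where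
  "star_psd F = {A \<in> sym_mats. lower_block A \<in> psd_mats \<and> (\<forall>\<Gamma>. pullback \<Gamma> A \<in> F)}"

end

theory Submission
  imports Defs "HOL-Library.Function_Algebras"
begin

text \<open>If the Hessian of a test function \<open>g\<close> at \<open>x\<^sub>0\<close> is not in \<open>F\<close>, separate it from the convex
  cone \<open>F\<close> by a matrix \<open>E\<close>; this gives a degenerate elliptic operator \<open>L f = E \<bullet> hess f\<close> that is
  non-negative on \<open>F\<close>, with \<open>L g < 0\<close> near \<open>x\<^sub>0\<close>. Convexity of \<open>\<rho>\<close> along the fibres and connectedness
  make the fibres of \<open>K\<close> convex. Along the graph of an \<open>L\<close>-harmonic polynomial map \<open>\<gamma>\<close> the function
  \<open>\<rho>\<close> obeys the maximum principle, so a harmonic \<open>\<gamma>\<close> whose graph lies in \<open>K\<close> over a sphere about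
  \<open>x\<^sub>0\<close> satisfies \<open>\<gamma> x\<^sub>0 \<in> K\<^bsub>x\<^sub>0\<^esub>\<close>. Hence the support function of the fibre at \<open>x\<^sub>0\<close> dominates
  the harmonic extension of the support functions over the sphere. Since \<open>L g < 0\<close>, there are points
  \<open>x\<^sub>1, \<dots>, x\<^sub>N\<close> of the sphere at which \<open>g\<close> has mean smaller than \<open>g x\<^sub>0\<close> while the Minkowski mean of the
  fibres lies in a small neighbourhood of the fibre at \<open>x\<^sub>0\<close>. The multiplicative Brunn--Minkowski
  inequality bounds the volume of that mean from below by the geometric mean of the volumes, which
  exceeds \<open>exp (- g x\<^sub>0)\<close>, the volume of the fibre at \<open>x\<^sub>0\<close>, by a fixed factor: a contradiction.\<close>

section \<open>Second derivatives\<close>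

text \<open>Two obstacles shape the argument. The function \<open>\<rho>\<close> is only upper
  semicontinuous, so it is never differentiated: every estimate for it is taken at a maximum of
  \<open>\<rho>\<close> plus a polynomial. It also lives only near \<open>K\<close>, so a segment or
  a graph can be tested only once it is known to lie in \<open>U\<close>; hence convexity of the
  fibres and the inclusion of harmonic graphs in \<open>K\<close> are both reached by
  open-and-closed arguments. The operator given by \<open>E\<close> may be degenerate, so its
  Dirichlet problem is solved only for polynomial data, where it is linear algebra in finite
  dimension; selections from the interiors of the fibres leave room to approximate by such data. No
  harmonic measure is constructed. The fibre at \<open>x0\<close> is described up to a small
  neighbourhood by finitely many half-spaces, so only finitely many averages over the sphere matter,
  and a greedy choice of equally weighted points controls them all at once. This is the form in
  which Brunn-Minkowski for finite means can be applied.\<close>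

definition twice_diff :: "(real^'n \<Rightarrow> real) \<Rightarrow> real^'n \<Rightarrow> bool" where
  "twice_diff f x \<longleftrightarrow>
     (\<forall>\<^sub>F y in nhds x. f differentiable (at y)) \<and> (\<forall>i. partial_deriv i f differentiable (at x))"

lemmas has_derivative_frechet = frechet_derivative_works[THEN iffD1]

lemma has_derivative_partial_deriv:
  assumes "f differentiable (at x)"
  shows "(f has_derivative (\<lambda>h. \<Sum>i\<in>UNIV. h $ i * partial_deriv i f x)) (at x)"
proof -
  let ?D = "frechet_derivative f (at x)"
  have D: "(f has_derivative ?D) (at x)"
    using assms frechet_derivative_works by blast
  then interpret linear ?D
    by (rule has_derivative_linear)
  have "?D h = (\<Sum>i\<in>UNIV. h $ i * partial_deriv i f x)" for h
  proof -
    have "?D h = ?D (\<Sum>i\<in>UNIV. h $ i *s axis i 1)"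
      by (simp add: basis_expansion)
    then show ?thesis
      by (simp add: sum scale partial_deriv_def scalar_mult_eq_scaleR)
  qed
  then have "?D = (\<lambda>h. \<Sum>i\<in>UNIV. h $ i * partial_deriv i f x)" by blast
  with D show ?thesis by simp
qed

lemma partial_deriv_eqI:
  assumes "(f has_derivative D) (at x)"
  shows "partial_deriv i f x = D (axis i 1)"
  using frechet_derivative_at[OF assms] by (simp add: partial_deriv_def)

lemma partial_deriv_const: "partial_deriv i (\<lambda>x. c) = (\<lambda>x. 0)"
  by (intro ext) (rule partial_deriv_eqI, rule has_derivative_const)

lemma hess_const: "hess (\<lambda>x. c) x = 0"
  by (simp add: hess_def partial_deriv_const vec_eq_iff)

lemma has_derivative_along_line:
  assumes "f differentiable (at (x + s *\<^sub>R v))"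
  shows "((\<lambda>s. f (x + s *\<^sub>R v)) has_real_derivative
          (\<Sum>i\<in>UNIV. v $ i * partial_deriv i f (x + s *\<^sub>R v))) (at s)"
proof -
  have *: "((\<lambda>s. x + s *\<^sub>R v) has_derivative (\<lambda>s. s *\<^sub>R v)) (at s)"
    by (auto intro!: derivative_eq_intros)
  show ?thesis
    using has_derivative_compose[OF * has_derivative_partial_deriv[OF assms]]
    by (simp add: has_field_derivative_def sum_distrib_right mult.assoc
        mult_commute_abs[of "\<Sum>i\<in>UNIV. v $ i * partial_deriv i f (x + s *\<^sub>R v)"]
        flip: sum_distrib_left)
qed

lemma partial_deriv_add:
  assumes "f differentiable (at x)" "g differentiable (at x)"
  shows "partial_deriv i (\<lambda>x. f x + g x) x = partial_deriv i f x + partial_deriv i g x"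
  using partial_deriv_eqI[OF has_derivative_add[OF
        has_derivative_frechet[OF assms(1)] has_derivative_frechet[OF assms(2)]]]
  by (simp add: partial_deriv_def)

lemma partial_deriv_cmult:
  assumes "f differentiable (at x)"
  shows "partial_deriv i (\<lambda>x. c * f x) x = c * partial_deriv i f x"
  using partial_deriv_eqI[OF has_derivative_mult_right[OF has_derivative_frechet[OF assms]]]
  by (simp add: partial_deriv_def)

lemma eventually_line:
  fixes x v :: "'a::real_normed_vector"
  assumes "\<forall>\<^sub>F y in nhds x. P y"
  shows "\<forall>\<^sub>F s in nhds (0::real). P (x + s *\<^sub>R v)"
proof -
  have "((\<lambda>s. x + s *\<^sub>R v) \<longlongrightarrow> x + 0 *\<^sub>R v) (nhds (0::real))"
    by (intro tendsto_intros filterlim_ident)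
  then show ?thesis using assms
    by (simp add: filterlim_iff)
qed

lemma has_derivative_partial_line:
  assumes "partial_deriv j f differentiable (at x)"
  shows "((\<lambda>s. partial_deriv j f (x + s *\<^sub>R v)) has_real_derivative
          (\<Sum>i\<in>UNIV. v $ i * hess f x $ i $ j)) (at 0)"
  using has_derivative_along_line[of "partial_deriv j f" x 0 v] assms by (simp add: hess_def)

lemma inner_hess: "v \<bullet> (hess f x *v w) = (\<Sum>j\<in>UNIV. w $ j * (\<Sum>i\<in>UNIV. v $ i * hess f x $ i $ j))"
  unfolding inner_vec_def matrix_vector_mult_def
  by (simp add: sum_distrib_left) (subst sum.swap, simp add: ac_simps)

lemma second_derivative_along_line:
  assumes "twice_diff f x"
  shows "((\<lambda>s. \<Sum>i\<in>UNIV. v $ i * partial_deriv i f (x + s *\<^sub>R v)) has_real_derivative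
          v \<bullet> (hess f x *v v)) (at 0)"
  unfolding inner_hess
  using assms
  by (auto simp: twice_diff_def intro!: DERIV_sum DERIV_cmult has_derivative_partial_line)

text \<open>Reads off the quadratic form of the Hessian from an explicit formula for the restriction
  to a line, so that mixed partials need not be computed; a symmetric matrix is determined by that
  form.\<close>

lemma second_derivative_unique:
  assumes "twice_diff f x"
    and D: "\<And>s. ((\<lambda>s. f (x + s *\<^sub>R v)) has_real_derivative D s) (at s)"
    and D': "(D has_real_derivative c) (at 0)"
  shows "v \<bullet> (hess f x *v v) = c"
proof -
  have "\<forall>\<^sub>F s in nhds (0::real). (\<Sum>i\<in>UNIV. v $ i * partial_deriv i f (x + s *\<^sub>R v)) = D s"
    using eventually_line[where x = x and P = "\<lambda>y. f differentiable (at y)" and v = v] assms(1)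
    unfolding twice_diff_def
    by (auto elim!: eventually_mono intro: DERIV_unique[OF has_derivative_along_line D])
  then have "(D has_real_derivative v \<bullet> (hess f x *v v)) (at 0)"
    using DERIV_cong_ev[OF refl _ refl, THEN iffD1, OF _ second_derivative_along_line[OF assms(1)]]
    by blast
  then show ?thesis using D' DERIV_unique by blast
qed

text \<open>A positive second derivative along \<open>v\<close> makes the first derivative, which
  vanishes at the maximum, positive just to the right; the mean value theorem then produces a value
  above \<open>f x\<close>.\<close>

lemma hess_local_max:
  assumes "twice_diff f x" and max: "\<forall>\<^sub>F y in nhds x. f y \<le> f x"
  shows "v \<bullet> (hess f x *v v) \<le> 0"
proof (rule ccontr)
  assume "\<not> ?thesis"
  then have pos: "0 < v \<bullet> (hess f x *v v)" by simp
  define D where "D s = (\<Sum>i\<in>UNIV. v $ i * partial_deriv i f (x + s *\<^sub>R v))" for s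
  have "\<forall>\<^sub>F s in nhds (0::real). f (x + s *\<^sub>R v) \<le> f x \<and> f differentiable (at (x + s *\<^sub>R v))"
    using assms(1) max by (intro eventually_line) (auto simp: twice_diff_def eventually_conj)
  then obtain d where d: "d > 0" "\<And>s. \<bar>s\<bar> < d \<Longrightarrow> f (x + s *\<^sub>R v) \<le> f x"
    "\<And>s. \<bar>s\<bar> < d \<Longrightarrow> f differentiable (at (x + s *\<^sub>R v))"
    by (auto simp: eventually_nhds_metric dist_real_def)
  have deriv: "((\<lambda>s. f (x + s *\<^sub>R v)) has_real_derivative D s) (at s)" if "\<bar>s\<bar> < d" for s
    unfolding D_def by (rule has_derivative_along_line[OF d(3)[OF that]])
  have D0: "D 0 = 0"
    by (rule DERIV_local_max[OF deriv d(1)]) (use d in auto)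
  have "(D has_real_derivative v \<bullet> (hess f x *v v)) (at 0)"
    unfolding D_def by (rule second_derivative_along_line[OF assms(1)])
  from DERIV_pos_inc_right[OF this pos] obtain e where e: "e > 0" "\<And>h. 0 < h \<Longrightarrow> h < e \<Longrightarrow> D h > 0"
    using D0 by auto
  define s where "s = min d e / 2"
  have s: "0 < s" "s < d" "s < e" using d(1) e(1) by (auto simp: s_def)
  obtain z where "0 < z" "z < s" "f (x + s *\<^sub>R v) - f (x + 0 *\<^sub>R v) = (s - 0) * D z"
    using MVT2[OF s(1), of "\<lambda>s. f (x + s *\<^sub>R v)" D] deriv s by force
  moreover have "D z > 0" using e calculation s by auto
  ultimately show False using d(2)[of s] s by (smt (verit) mult_pos_pos scaleR_zero_left add.right_neutral)
qed

lemma twice_diff_add: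
  assumes "twice_diff f x" "twice_diff g x"
  shows "twice_diff (\<lambda>x. f x + g x) x" "hess (\<lambda>x. f x + g x) x = hess f x + hess g x"
proof -
  have ev: "\<forall>\<^sub>F y in nhds x. f differentiable (at y) \<and> g differentiable (at y)"
    using assms by (auto simp: twice_diff_def eventually_conj)
  then have ev1: "\<forall>\<^sub>F y in nhds x. partial_deriv i f y + partial_deriv i g y = partial_deriv i (\<lambda>x. f x + g x) y" for i
    by (rule eventually_mono) (simp add: partial_deriv_add)
  then obtain T where T: "\<And>i. open (T i)" "\<And>i. x \<in> T i" 
     "\<And>i y. y \<in> T i \<Longrightarrow> partial_deriv i f y + partial_deriv i g y = partial_deriv i (\<lambda>x. f x + g x) y"
    unfolding eventually_nhds by metis
  have D: "(partial_deriv j (\<lambda>x. f x + g x) has_derivative 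
         (\<lambda>h. frechet_derivative (partial_deriv j f) (at x) h + frechet_derivative (partial_deriv j g) (at x) h)) (at x)" for j
    by (rule has_derivative_transform_within_open[OF _ T])
      (use assms in \<open>auto simp: twice_diff_def intro!: has_derivative_frechet has_derivative_add\<close>)
  then show "twice_diff (\<lambda>x. f x + g x) x"
    unfolding twice_diff_def differentiable_def[of "partial_deriv _ _"]
    using eventually_mono[OF ev] by (auto intro: differentiable_add)
  show "hess (\<lambda>x. f x + g x) x = hess f x + hess g x"
    by (simp add: hess_def vec_eq_iff partial_deriv_eqI[OF D], simp add: partial_deriv_def)
qed

lemma twice_diff_cmult:
  assumes "twice_diff f x"
  shows "twice_diff (\<lambda>x. c * f x) x" "hess (\<lambda>x. c * f x) x = c *\<^sub>R hess f x"
proof -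
  have ev: "\<forall>\<^sub>F y in nhds x. f differentiable (at y)"
    using assms by (auto simp: twice_diff_def)
  then have ev1: "\<forall>\<^sub>F y in nhds x. c * partial_deriv i f y = partial_deriv i (\<lambda>x. c * f x) y" for i
    by (rule eventually_mono) (simp add: partial_deriv_cmult)
  then obtain T where T: "\<And>i. open (T i)" "\<And>i. x \<in> T i" 
     "\<And>i y. y \<in> T i \<Longrightarrow> c * partial_deriv i f y = partial_deriv i (\<lambda>x. c * f x) y"
    unfolding eventually_nhds by metis
  have D: "(partial_deriv j (\<lambda>x. c * f x) has_derivative 
         (\<lambda>h. c * frechet_derivative (partial_deriv j f) (at x) h)) (at x)" for j
    by (rule has_derivative_transform_within_open[OF _ T])
      (use assms in \<open>auto simp: twice_diff_def intro!: has_derivative_frechet has_derivative_mult_right\<close>)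
  then show "twice_diff (\<lambda>x. c * f x) x"
    unfolding twice_diff_def differentiable_def[of "partial_deriv _ _"]
    using eventually_mono[OF ev] by (auto intro: differentiable_mult)
  show "hess (\<lambda>x. c * f x) x = c *\<^sub>R hess f x"
    by (simp add: hess_def vec_eq_iff partial_deriv_eqI[OF D], simp add: partial_deriv_def)
qed

lemma twice_diff_sum:
  assumes "finite S" "\<And>j. j \<in> S \<Longrightarrow> twice_diff (f j) x"
  shows "twice_diff (\<lambda>x. \<Sum>j\<in>S. f j x) x" "hess (\<lambda>x. \<Sum>j\<in>S. f j x) x = (\<Sum>j\<in>S. hess (f j) x)"
proof -
  have "twice_diff (\<lambda>x. \<Sum>j\<in>S. f j x) x \<and> hess (\<lambda>x. \<Sum>j\<in>S. f j x) x = (\<Sum>j\<in>S. hess (f j) x)"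
    using assms
  proof induction
    case empty
    then show ?case by (simp add: twice_diff_def hess_const partial_deriv_const)
  next
    case (insert j S)
    then show ?case using twice_diff_add[of "f j" x "\<lambda>x. \<Sum>j\<in>S. f j x"] by simp
  qed
  then show "twice_diff (\<lambda>x. \<Sum>j\<in>S. f j x) x" "hess (\<lambda>x. \<Sum>j\<in>S. f j x) x = (\<Sum>j\<in>S. hess (f j) x)"
    by blast+
qed

text \<open>Mean value theorem in direction \<open>i\<close> for the increment of \<open>f\<close>
  in direction \<open>j\<close>, then differentiability of the first partial at the single point
  \<open>x\<close>; \<open>twice_diff\<close> does not ask for continuous second partials. The
  second difference is symmetric in \<open>i\<close> and \<open>j\<close>, which yields
  \<open>hess_symmetric\<close>.\<close>

lemma second_difference:
  assumes "twice_diff f x" "e > 0"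
  shows "\<exists>d>0. \<forall>s. 0 < s \<longrightarrow> s < d \<longrightarrow>
    \<bar>f (x + s *\<^sub>R axis i 1 + s *\<^sub>R axis j 1) - f (x + s *\<^sub>R axis i 1) - f (x + s *\<^sub>R axis j 1) + f x
      - s\<^sup>2 * hess f x $ j $ i\<bar> \<le> e * s\<^sup>2"
proof -
  define g where "g = partial_deriv i f"
  define G where "G = frechet_derivative g (at x)"
  define u v :: "real^'a" where "u = axis i 1" and "v = axis j 1"
  have nu: "norm u = 1" "norm v = 1" by (simp_all add: u_def v_def)
  have G: "(g has_derivative G) (at x)"
    unfolding G_def using assms(1) by (intro has_derivative_frechet) (simp add: twice_diff_def g_def)
  then interpret G: linear G by (rule has_derivative_linear)
  have Gv: "G v = hess f x $ j $ i"
    by (simp add: hess_def G_def g_def v_def partial_deriv_def[of j])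
  \<comment> \<open>The two points to be compared lie within \<open>2 * s\<close> and
    \<open>s\<close> of \<open>x\<close>, so errors of \<open>e / 3\<close> per unit length add up
    to \<open>e * s\<close>.\<close>
  obtain d1 where d1: "d1 > 0" "\<And>y. norm (y - x) < d1 \<Longrightarrow> norm (g y - g x - G (y - x)) \<le> e / 3 * norm (y - x)"
    using G assms(2) unfolding has_derivative_at_alt by (metis divide_pos_pos zero_less_numeral)
  obtain d2 where d2: "d2 > 0" "\<And>y. dist y x < d2 \<Longrightarrow> f differentiable (at y)"
    using assms(1) by (auto simp: twice_diff_def eventually_nhds_metric)
  define d where "d = min d1 d2 / 2"
  have "\<bar>f (x + s *\<^sub>R u + s *\<^sub>R v) - f (x + s *\<^sub>R u) - f (x + s *\<^sub>R v) + f x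
      - s\<^sup>2 * hess f x $ j $ i\<bar> \<le> e * s\<^sup>2" if s: "0 < s" "s < d" for s
  proof -
    define \<phi> where "\<phi> t = f ((x + s *\<^sub>R v) + t *\<^sub>R u) - f (x + t *\<^sub>R u)" for t
    have nrm: "norm (t *\<^sub>R u) \<le> s" "norm (s *\<^sub>R v + t *\<^sub>R u) \<le> 2 * s" if "0 \<le> t" "t \<le> s" for t
      using that s nu norm_triangle_ineq[of "s *\<^sub>R v" "t *\<^sub>R u"] by auto
    have D: "(\<phi> has_real_derivative (g (x + s *\<^sub>R v + t *\<^sub>R u) - g (x + t *\<^sub>R u))) (at t)" if t: "0 \<le> t" "t \<le> s" for t
    proof -
      have "((\<lambda>t. f (y + t *\<^sub>R u)) has_real_derivative g (y + t *\<^sub>R u)) (at t)" if "dist (y + t *\<^sub>R u) x < d2" for y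
        using has_derivative_along_line[OF d2(2)[OF that]]
        by (simp add: u_def axis_def g_def if_distrib if_distribR cong: if_cong)
      moreover have "dist (x + s *\<^sub>R v + t *\<^sub>R u) x < d2" "dist (x + t *\<^sub>R u) x < d2"
        using nrm[OF t] s(2) t s(1) by (auto simp: d_def dist_norm algebra_simps)
      ultimately show ?thesis unfolding \<phi>_def
        by (intro DERIV_diff) auto
    qed
    obtain t where t: "0 < t" "t < s" "\<phi> s - \<phi> 0 = (s - 0) * (g (x + s *\<^sub>R v + t *\<^sub>R u) - g (x + t *\<^sub>R u))"
      using MVT2[OF s(1) D] by metis
    define y1 y2 where "y1 = x + s *\<^sub>R v + t *\<^sub>R u" and "y2 = x + t *\<^sub>R u"
    have y: "norm (y1 - x) \<le> 2 * s" "norm (y2 - x) \<le> s"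
      using nrm[of t] t by (auto simp: y1_def y2_def algebra_simps)
    have "G (y1 - x) - G (y2 - x) = s * G v"
      by (simp add: y1_def y2_def G.add G.scale)
    moreover have "\<bar>g y1 - g x - G (y1 - x)\<bar> \<le> e / 3 * (2 * s)"
      using order_trans[OF d1(2)[of y1] mult_left_mono[OF y(1), of "e/3"]] y s assms(2) by (simp add: d_def)
    moreover have "\<bar>g y2 - g x - G (y2 - x)\<bar> \<le> e / 3 * s"
      using order_trans[OF d1(2)[of y2] mult_left_mono[OF y(2), of "e/3"]] y s assms(2) by (simp add: d_def)
    ultimately have "\<bar>g y1 - g y2 - s * G v\<bar> \<le> e * s"
      by linarith
    then have "s * \<bar>g y1 - g y2 - s * G v\<bar> \<le> s * (e * s)"
      using s by (intro mult_left_mono) auto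
    moreover have "s * \<bar>g y1 - g y2 - s * G v\<bar> = \<bar>s * (g y1 - g y2 - s * G v)\<bar>"
      using s by (simp add: abs_mult)
    ultimately have "\<bar>s * (g y1 - g y2 - s * G v)\<bar> \<le> e * s\<^sup>2"
      by (simp add: power2_eq_square ac_simps)
    moreover have "s * (g y1 - g y2 - s * G v) = \<phi> s - \<phi> 0 - s\<^sup>2 * G v"
      using t(3) by (simp add: y1_def y2_def power2_eq_square algebra_simps)
    ultimately show ?thesis
      by (simp add: Gv \<phi>_def algebra_simps)
  qed
  moreover have "d > 0" using d1 d2 by (simp add: d_def)
  ultimately show ?thesis unfolding u_def v_def by blast
qed

lemma hess_symmetric:
  assumes "twice_diff f x"
  shows "hess f x \<in> sym_mats"
proof -
  have "hess f x $ i $ j = hess f x $ j $ i" for i j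
  proof (rule ccontr)
    assume ne: "\<not> ?thesis"
    define e where "e = \<bar>hess f x $ i $ j - hess f x $ j $ i\<bar> / 4"
    have e: "e > 0" using ne by (simp add: e_def)
    obtain d1 d2 where d: "d1 > 0" "d2 > 0"
       "\<And>s. 0 < s \<Longrightarrow> s < d1 \<Longrightarrow> \<bar>f (x + s *\<^sub>R axis i 1 + s *\<^sub>R axis j 1) - f (x + s *\<^sub>R axis i 1) - f (x + s *\<^sub>R axis j 1) + f x
      - s\<^sup>2 * hess f x $ j $ i\<bar> \<le> e * s\<^sup>2"
       "\<And>s. 0 < s \<Longrightarrow> s < d2 \<Longrightarrow> \<bar>f (x + s *\<^sub>R axis j 1 + s *\<^sub>R axis i 1) - f (x + s *\<^sub>R axis j 1) - f (x + s *\<^sub>R axis i 1) + f x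
      - s\<^sup>2 * hess f x $ i $ j\<bar> \<le> e * s\<^sup>2"
      using second_difference[OF assms e, of i j] second_difference[OF assms e, of j i] by blast
    define s where "s = min d1 d2 / 2"
    have s: "0 < s" "s < d1" "s < d2" using d(1,2) by (auto simp: s_def)
    have "\<bar>s\<^sup>2 * hess f x $ i $ j - s\<^sup>2 * hess f x $ j $ i\<bar> \<le> 2 * e * s\<^sup>2"
      using d(3)[OF s(1,2)] d(4)[OF s(1,3)] by (simp add: add.assoc add.commute[of "s *\<^sub>R axis i 1"])
    then have "s\<^sup>2 * \<bar>hess f x $ i $ j - hess f x $ j $ i\<bar> \<le> s\<^sup>2 * (2 * e)"
      by (simp add: abs_mult flip: right_diff_distrib) (simp add: algebra_simps)
    then have "4 * e \<le> 2 * e" using s by (simp add: e_def)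
    then show False using e by simp
  qed
  then show ?thesis by (simp add: sym_mats_def transpose_def vec_eq_iff)
qed

section \<open>Polynomials and smooth functions\<close>

lemma real_polynomial_function_partial_deriv:
  fixes p :: "real^'n \<Rightarrow> real"
  assumes "real_polynomial_function p"
  shows "real_polynomial_function (partial_deriv i p)"
  using assms
proof induction
  case (linear f)
  then have "partial_deriv i f = (\<lambda>x. f (axis i 1))"
    by (intro ext partial_deriv_eqI bounded_linear_imp_has_derivative)
  then show ?case by auto
next
  case (const c)
  then show ?case by (auto simp: partial_deriv_const)
next
  case (add f g)
  have "partial_deriv i (\<lambda>x. f x + g x) = (\<lambda>x. partial_deriv i f x + partial_deriv i g x)"
    using add by (auto simp: partial_deriv_add differentiable_at_real_polynomial_function)
  then show ?case using add by auto
next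
  case (mult f g)
  have "partial_deriv i (\<lambda>x. f x * g x) x = f x * partial_deriv i g x + partial_deriv i f x * g x" for x
    using partial_deriv_eqI[OF has_derivative_mult[OF
        has_derivative_frechet[OF differentiable_at_real_polynomial_function[OF mult(1)]]
        has_derivative_frechet[OF differentiable_at_real_polynomial_function[OF mult(2)]]]]
    by (simp add: partial_deriv_def)
  then have "partial_deriv i (\<lambda>x. f x * g x) = (\<lambda>x. f x * partial_deriv i g x + partial_deriv i f x * g x)"
    by blast
  then show ?case using mult by auto
qed

lemma smooth_on_real_polynomial_function:
  assumes "real_polynomial_function p"
  shows "smooth_on V p"
proof -
  have "Ck_on k V p" for k
    using assms
  proof (induction k arbitrary: p)
    case 0
    then show ?case
      by (simp add: continuous_at_imp_continuous_on continuous_real_polymonial_function)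
  next
    case (Suc k)
    then show ?case
      by (auto intro: differentiable_at_real_polynomial_function real_polynomial_function_partial_deriv)
  qed
  then show ?thesis by (simp add: smooth_on_def)
qed

lemma twice_diff_real_polynomial_function:
  assumes "real_polynomial_function p"
  shows "twice_diff p x"
  using assms unfolding twice_diff_def
  by (auto intro!: differentiable_at_real_polynomial_function real_polynomial_function_partial_deriv always_eventually)

lemma smooth_on_imp_twice_diff:
  assumes "smooth_on V g" "open V" "x \<in> V"
  shows "twice_diff g x"
proof -
  have "Ck_on (Suc (Suc 0)) V g" using assms by (simp only: smooth_on_def)
  then have "\<forall>x\<in>V. g differentiable (at x)" "\<forall>i. \<forall>x\<in>V. partial_deriv i g differentiable (at x)" by auto
  then show ?thesis using assms by (auto simp: twice_diff_def eventually_nhds)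
qed

lemma smooth_on_imp_continuous_on_hess:
  assumes "smooth_on V g"
  shows "continuous_on V (hess g)"
proof -
  have "Ck_on (Suc (Suc 0)) V g" using assms by (simp only: smooth_on_def)
  then have "\<And>i j. continuous_on V (partial_deriv j (partial_deriv i g))" by auto
  then show ?thesis unfolding hess_def[abs_def] by (intro continuous_on_vec_lambda) auto
qed

section \<open>The maximum principle\<close>

text \<open>Polarization: the vectors \<open>axis i 1 + axis j 1\<close> isolate the off-diagonal
  entries.\<close>

lemma sym_mats_eqI:
  fixes A B :: "real^'n^'n"
  assumes "A \<in> sym_mats" "B \<in> sym_mats" and eq: "\<And>v. v \<bullet> (A *v v) = v \<bullet> (B *v v)"
  shows "A = B"
proof -
  define M where "M = A - B"
  have sym: "M $ i $ j = M $ j $ i" for i j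
    using assms(1,2) by (simp add: M_def sym_mats_def transpose_def vec_eq_iff)
  have q: "v \<bullet> (M *v v) = 0" for v
    using eq[of v] by (simp add: M_def matrix_vector_mult_diff_rdistrib inner_diff_right)
  have e: "axis i 1 \<bullet> (M *v axis j 1) = M $ i $ j" for i j
    by (simp add: inner_axis' matrix_vector_mult_basis column_def)
  have "M $ i $ j = 0" for i j
    using q[of "axis i 1 + axis j 1"] q[of "axis i 1"] q[of "axis j 1"] e sym[of i j]
    by (simp add: matrix_vector_right_distrib inner_add_left inner_add_right)
  then show ?thesis by (simp add: M_def vec_eq_iff)
qed

lemma real_polynomial_function_norm_sq:
  fixes a :: "real^'n"
  shows "real_polynomial_function (\<lambda>x. (norm (x - a))\<^sup>2)"
proof -
  have "(\<lambda>x. (norm (x - a))\<^sup>2) = (\<lambda>x. \<Sum>i\<in>UNIV. (x $ i - a $ i)\<^sup>2)"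
    by (simp add: power2_norm_eq_inner inner_vec_def power2_eq_square[of "_ - _"])
  moreover have "real_polynomial_function (\<lambda>x::real^'n. x $ i)" for i
    by (intro real_polynomial_function.intros(1) bounded_linear_vec_nth)
  ultimately show ?thesis
    by (auto intro!: real_polynomial_function_sum real_polynomial_function_power real_polynomial_function_diff)
qed

lemma hess_norm_sq:
  fixes a :: "real^'n"
  shows "hess (\<lambda>x. (norm (x - a))\<^sup>2) x = 2 *\<^sub>R mat 1"
proof (rule sym_mats_eqI)
  have td: "twice_diff (\<lambda>x. (norm (x - a))\<^sup>2) x"
    by (intro twice_diff_real_polynomial_function real_polynomial_function_norm_sq)
  then show "hess (\<lambda>x. (norm (x - a))\<^sup>2) x \<in> sym_mats" by (rule hess_symmetric)
  show "2 *\<^sub>R mat 1 \<in> sym_mats" by (simp add: sym_mats_def transpose_def vec_eq_iff mat_def)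
  fix v :: "real^'n"
  have "v \<bullet> (hess (\<lambda>x. (norm (x - a))\<^sup>2) x *v v) = 2 * (v \<bullet> v)"
  proof (rule second_derivative_unique[OF td])
    fix s
    have eq: "(norm (x + s *\<^sub>R v - a))\<^sup>2 = (x - a) \<bullet> (x - a) + s * (2 * ((x - a) \<bullet> v)) + s\<^sup>2 * (v \<bullet> v)" for s
      unfolding power2_norm_eq_inner
      by (simp add: inner_simps inner_commute power2_eq_square algebra_simps)
    show "((\<lambda>s. (norm (x + s *\<^sub>R v - a))\<^sup>2) has_real_derivative 2 * ((x - a) \<bullet> v) + s * (2 * (v \<bullet> v))) (at s)"
      unfolding eq by (auto intro!: derivative_eq_intros)
    show "((\<lambda>s. 2 * ((x - a) \<bullet> v) + s * (2 * (v \<bullet> v))) has_real_derivative 2 * (v \<bullet> v)) (at 0)"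
      by (auto intro!: derivative_eq_intros)
  qed
  then show "v \<bullet> (hess (\<lambda>x. (norm (x - a))\<^sup>2) x *v v) = v \<bullet> ((2 *\<^sub>R mat 1) *v v)"
    by (simp add: scaleR_matrix_vector_assoc[symmetric])
qed

lemma inner_hess_local_max:
  fixes E :: "real^'n^'n"
  assumes E: "\<And>P. P \<in> psd_mats \<Longrightarrow> 0 \<le> E \<bullet> P"
    and f: "twice_diff f x" and max: "\<forall>\<^sub>F y in nhds x. f y \<le> f x"
  shows "E \<bullet> hess f x \<le> 0"
proof -
  have "- hess f x \<in> psd_mats"
  proof -
    have "- hess f x = hess (\<lambda>x. (-1) * f x) x" "twice_diff (\<lambda>x. (-1) * f x) x"
      using twice_diff_cmult[OF f, of "-1"] by simp_all
    then have "- hess f x \<in> sym_mats" using hess_symmetric by metis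
    moreover have "0 \<le> v \<bullet> (- hess f x *v v)" for v
    proof -
      have "- hess f x *v v = - (hess f x *v v)"
        by (simp add: vec_eq_iff matrix_vector_mult_def sum_negf)
      then show ?thesis using hess_local_max[OF f max, of v] by simp
    qed
    ultimately show ?thesis by (simp add: psd_mats_def)
  qed
  from E[OF this] show ?thesis by simp
qed

text \<open>The non-strict inequality is compatible with an interior maximum. Adding
  \<open>e * (norm (y - a))\<^sup>2\<close> contributes \<open>2 * e * (E \<bullet> mat 1)\<close>,
  which is positive even for degenerate \<open>E\<close>, and makes it strict.\<close>

lemma weak_max_principle:
  fixes E :: "real^'n^'n"
  assumes E: "\<And>P. P \<in> psd_mats \<Longrightarrow> 0 \<le> E \<bullet> P" and EI: "0 < E \<bullet> mat 1"
    and cont: "continuous_on (cball a r) f" and td: "\<And>x. x \<in> ball a r \<Longrightarrow> twice_diff f x"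
    and L: "\<And>x. x \<in> ball a r \<Longrightarrow> 0 \<le> E \<bullet> hess f x"
    and x: "x \<in> cball a r"
  shows "\<exists>y\<in>sphere a r. f x \<le> f y"
proof (rule ccontr)
  assume "\<not> ?thesis"
  then have less: "\<And>y. y \<in> sphere a r \<Longrightarrow> f y < f x" by (meson not_le)
  have r: "0 \<le> r" using x by (metis mem_cball order_trans zero_le_dist)
  have "compact (sphere a r)" "sphere a r \<noteq> {}" "continuous_on (sphere a r) f"
    using r continuous_on_subset[OF cont] by auto
  from continuous_attains_sup[OF this]
  obtain m where m: "m \<in> sphere a r" "\<And>y. y \<in> sphere a r \<Longrightarrow> f y \<le> f m" by blast
  \<comment> \<open>Half the gap over \<open>r\<^sup>2 + 1\<close>: the perturbation on the sphere
    stays below the gap, and the added 1 keeps the divisor positive for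
    \<open>r = 0\<close>.\<close>
  define e where "e = (f x - f m) / (2 * (r\<^sup>2 + 1))"
  have r2: "0 < 2 * (r\<^sup>2 + 1)" by (simp add: add_nonneg_pos)
  have e: "0 < e" using less[OF m(1)] r2 by (simp add: e_def)
  have er: "e * r\<^sup>2 < f x - f m"
  proof -
    have "e * (2 * (r\<^sup>2 + 1)) = f x - f m" using r2 by (simp add: e_def)
    moreover have "e * (2 * (r\<^sup>2 + 1)) = 2 * (e * r\<^sup>2) + 2 * e" by (simp add: algebra_simps)
    moreover have "0 \<le> e * r\<^sup>2" using e by simp
    ultimately show ?thesis using e by linarith
  qed
  define h where "h y = f y + e * (norm (y - a))\<^sup>2" for y
  have "continuous_on (cball a r) h" unfolding h_def
    by (intro continuous_intros cont)
  then obtain z where z: "z \<in> cball a r" "\<And>y. y \<in> cball a r \<Longrightarrow> h y \<le> h z"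
    using continuous_attains_sup[OF compact_cball, of a r h] x by (metis empty_iff)
  have "z \<notin> sphere a r"
  proof
    assume zs: "z \<in> sphere a r"
    then have "h z = f z + e * r\<^sup>2" by (simp add: h_def dist_norm norm_minus_commute)
    moreover have "f x \<le> h x" using e by (simp add: h_def)
    ultimately show False using z(2)[OF x] m(2)[OF zs] er by simp
  qed
  then have zb: "z \<in> ball a r" using z(1) by (auto simp: less_le)
  have tp: "twice_diff (\<lambda>y. (norm (y - a))\<^sup>2) z"
    by (intro twice_diff_real_polynomial_function real_polynomial_function_norm_sq)
  have tdh: "twice_diff h z" and hh: "hess h z = hess f z + e *\<^sub>R (2 *\<^sub>R mat 1)"
    unfolding h_def using twice_diff_add[OF td[OF zb] twice_diff_cmult(1)[OF tp, of e]] twice_diff_cmult(2)[OF tp, of e]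
    by (simp_all add: hess_norm_sq)
  have "\<forall>\<^sub>F y in nhds z. h y \<le> h z"
    unfolding eventually_nhds using zb z(2) by (intro exI[of _ "ball a r"]) auto
  from inner_hess_local_max[OF E tdh this] have "E \<bullet> hess f z + e * (2 * (E \<bullet> mat 1)) \<le> 0"
    by (simp add: hh inner_add_right)
  moreover have "0 < e * (2 * (E \<bullet> mat 1))" using e EI by simp
  ultimately show False using L[OF zb] by linarith
qed

text \<open>The image of a basis is independent and of the same size, so a vector outside the image
  would extend it beyond the dimension. Linearity is required on the span only, because a
  differential operator is additive only on sufficiently differentiable functions.\<close>

lemma (in vector_space) injective_endo_span_surj:
  assumes G: "finite G" and T: "T ` span G \<subseteq> span G"
    and add: "\<And>x y. x \<in> span G \<Longrightarrow> y \<in> span G \<Longrightarrow> T (x + y) = T x + T y"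
    and sc: "\<And>c x. x \<in> span G \<Longrightarrow> T (scale c x) = scale c (T x)"
    and inj: "\<And>x. x \<in> span G \<Longrightarrow> T x = 0 \<Longrightarrow> x = 0"
    and w: "w \<in> span G"
  shows "w \<in> T ` span G"
proof (rule ccontr)
  assume nw: "w \<notin> T ` span G"
  obtain B where B: "B \<subseteq> span G" "independent B" "span G \<subseteq> span B"
    using maximal_independent_subset[of "span G"] by blast
  have fB: "finite B" using independent_span_bound[OF G B(2,1)] by blast
  have T0: "T 0 = 0" using sc[of 0 0] by (simp add: span_zero)
  have Tsum: "T (\<Sum>b\<in>C. scale (u b) b) = (\<Sum>b\<in>C. scale (u b) (T b))" if "finite C" "C \<subseteq> span G" for u C
    using that by (induction C) (simp_all add: T0 add sc span_sum span_scale subset_iff)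
  have injB: "inj_on T B"
  proof
    fix x y assume xy: "x \<in> B" "y \<in> B" "T x = T y"
    then have xs: "x \<in> span G" "y \<in> span G" using B by auto
    have "T (x + scale (-1) y) = T x + scale (-1) (T y)"
      by (simp only: add[OF xs(1) span_scale[OF xs(2)]] sc[OF xs(2)])
    then have "T (x + scale (-1) y) = 0" using xy by simp
    then have "x + scale (-1) y = 0" by (rule inj[OF span_add[OF xs(1) span_scale[OF xs(2)]]])
    then show "x = y" by simp
  qed
  have "independent (T ` B)"
    unfolding independent_explicit_finite_subsets
  proof (intro allI impI ballI)
    fix S u v assume S: "S \<subseteq> T ` B" "finite S" "(\<Sum>v\<in>S. scale (u v) v) = 0" "v \<in> S"
    obtain C where C: "C \<subseteq> B" "S = T ` C" using S(1) by (meson subset_imageE)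
    have fC: "finite C" using C(1) fB finite_subset by blast
    have "inj_on T C" using injB C(1) inj_on_subset by blast
    then have "(\<Sum>b\<in>C. scale (u (T b)) (T b)) = 0"
      using S(3) by (simp add: C(2) sum.reindex)
    then have "T (\<Sum>b\<in>C. scale (u (T b)) b) = 0"
      using Tsum[OF fC, of "\<lambda>b. u (T b)"] C(1) B(1) by auto
    moreover have "(\<Sum>b\<in>C. scale (u (T b)) b) \<in> span G"
      using C(1) B(1) by (intro span_sum span_scale) auto
    ultimately have "(\<Sum>b\<in>C. scale (u (T b)) b) = 0" using inj by blast
    then have "\<forall>b\<in>C. u (T b) = 0"
      using independentD[OF B(2) fC C(1), of "\<lambda>b. u (T b)"] by blast
    then show "u v = 0" using S(4) C(2) by auto
  qed
  moreover have "w \<notin> span (T ` B)"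
  proof
    assume "w \<in> span (T ` B)"
    then obtain u where "w = (\<Sum>v\<in>T ` B. scale (u v) v)"
      using fB by (auto simp: span_finite)
    then have "w = T (\<Sum>b\<in>B. scale (u (T b)) b)"
      using Tsum[OF fB B(1), of "\<lambda>b. u (T b)"] by (simp add: sum.reindex[OF injB])
    moreover have "(\<Sum>b\<in>B. scale (u (T b)) b) \<in> span G"
      using B(1) by (intro span_sum span_scale) auto
    ultimately show False using nw by blast
  qed
  ultimately have ind: "independent (insert w (T ` B))" by (rule independent_insertI[rotated])
  have "insert w (T ` B) \<subseteq> span B" using w T B(1,3) by blast
  from independent_span_bound[OF fB ind this]
  have "card (insert w (T ` B)) \<le> card B" by blast
  moreover have "w \<notin> T ` B" using nw B(1) by blast
  ultimately show False using fB card_image[OF injB] by simp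
qed

section \<open>The Dirichlet problem for polynomials\<close>

text \<open>Degree at most \<open>d\<close>, not exactly \<open>d\<close>: a finite set whose span
  is the space of polynomials of degree at most \<open>d\<close>, which gives the dimension argument
  its finite generating set.\<close>

primrec monomials :: "nat \<Rightarrow> (real^'n \<Rightarrow> real) set" where
  "monomials 0 = {\<lambda>x. 1}"
| "monomials (Suc d) = monomials d \<union> (\<lambda>(i, m) x. x $ i * m x) ` (UNIV \<times> monomials d)"

lemma finite_monomials: "finite (monomials d)"
  by (induction d) auto

abbreviation (input) fscale :: "real \<Rightarrow> ('a \<Rightarrow> real) \<Rightarrow> 'a \<Rightarrow> real" where
  "fscale c f \<equiv> (\<lambda>x. c * f x)"

interpretation fun_space: vector_space "fscale :: real \<Rightarrow> ('a \<Rightarrow> real) \<Rightarrow> 'a \<Rightarrow> real"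
  by unfold_locales (auto simp: fun_eq_iff algebra_simps)

definition polys :: "nat \<Rightarrow> (real^'n \<Rightarrow> real) set" where
  "polys d = fun_space.span (monomials d)"

lemma polys_add: "f \<in> polys d \<Longrightarrow> g \<in> polys d \<Longrightarrow> (\<lambda>x. f x + g x) \<in> polys d"
  unfolding polys_def using fun_space.span_add[of f _ g] by (simp add: plus_fun_def)

lemma polys_cmult: "f \<in> polys d \<Longrightarrow> (\<lambda>x. c * f x) \<in> polys d"
  unfolding polys_def by (rule fun_space.span_scale)

lemma polys_zero: "(\<lambda>x. 0) \<in> polys d"
  unfolding polys_def using fun_space.span_zero by (simp add: zero_fun_def)

lemma polys_sum: "finite I \<Longrightarrow> (\<And>i. i \<in> I \<Longrightarrow> f i \<in> polys d) \<Longrightarrow> (\<lambda>x. \<Sum>i\<in>I. f i x) \<in> polys d"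
  by (induction I rule: finite_induct) (auto intro: polys_zero polys_add)

lemma polys_induct [consumes 1, case_names monomial zero add cmult]:
  assumes "f \<in> polys d" and "\<And>m. m \<in> monomials d \<Longrightarrow> P m" and "P (\<lambda>x. 0)"
    and "\<And>f g. f \<in> polys d \<Longrightarrow> g \<in> polys d \<Longrightarrow> P f \<Longrightarrow> P g \<Longrightarrow> P (\<lambda>x. f x + g x)"
    and "\<And>c f. f \<in> polys d \<Longrightarrow> P f \<Longrightarrow> P (\<lambda>x. c * f x)"
  shows "P f"
proof -
  have "f \<in> fun_space.span (monomials d)" using assms(1) by (simp add: polys_def)
  then have "f \<in> polys d \<and> P f"
  proof (induction rule: fun_space.span_induct)
    case base
    show ?case
      unfolding fun_space.subspace_def zero_fun_def plus_fun_def
      using polys_zero polys_add polys_cmult assms by auto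
  next
    case (step x)
    then show ?case using assms(2) by (auto simp: polys_def intro: fun_space.span_base)
  qed
  then show ?thesis ..
qed

lemma monomials_polys: "m \<in> monomials d \<Longrightarrow> m \<in> polys d"
  by (simp add: polys_def fun_space.span_base)

lemma polys_mono: "d \<le> e \<Longrightarrow> polys d \<subseteq> polys e"
  unfolding polys_def using lift_Suc_mono_le[of monomials d e] by (intro fun_space.span_mono) auto

lemma polys_const: "(\<lambda>x. c) \<in> polys d"
proof -
  have "(\<lambda>x. c * (\<lambda>x. 1) x) \<in> polys 0" by (intro polys_cmult monomials_polys) simp
  then show ?thesis using polys_mono[of 0 d] by auto
qed

lemma polys_coord_mult: 
  assumes "f \<in> polys d" shows "(\<lambda>x. x $ i * f x) \<in> polys (Suc d)"
  using assms
proof (induction rule: polys_induct)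
  case (monomial m)
  then show ?case by (intro monomials_polys) force
next
  case (add f g)
  then show ?case using polys_add[OF add(3,4)] by (simp add: distrib_left)
next
  case (cmult c f)
  then show ?case using polys_cmult[OF cmult(2), of c] by (simp add: mult.left_commute)
qed (simp add: polys_zero)

lemma polys_mult:
  assumes f: "f \<in> polys d" and g: "g \<in> polys e" 
  shows "(\<lambda>x. f x * g x) \<in> polys (d + e)"
  using f
proof (induction rule: polys_induct)
  case (monomial m)
  then show ?case
  proof (induction d arbitrary: m)
    case 0
    then show ?case using g by simp
  next
    case (Suc d)
    then consider "m \<in> monomials d" | i n where "n \<in> monomials d" "m = (\<lambda>x. x $ i * n x)" by auto
    then show ?case
    proof cases
      case 1
      then show ?thesis using Suc.IH[OF 1] polys_mono[of "d + e" "Suc d + e"] by auto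
    next
      case 2
      then show ?thesis using polys_coord_mult[OF Suc.IH[OF 2(1)], of i] by (simp add: mult.assoc)
    qed
  qed
next
  case (add f g)
  then show ?case using polys_add[OF add(3,4)] by (simp add: distrib_right)
next
  case (cmult c f)
  then show ?case using polys_cmult[OF cmult(2), of c] by (simp add: mult.assoc)
qed (simp add: polys_zero)

lemma polys_imp_real_polynomial_function:
  assumes "f \<in> polys d" shows "real_polynomial_function f"
  using assms
proof (induction rule: polys_induct)
  case (monomial m)
  then show ?case
  proof (induction d arbitrary: m)
    case (Suc d)
    then show ?case
      by (auto intro: real_polynomial_function.intros(4)[OF real_polynomial_function.intros(1)[OF bounded_linear_vec_nth]])
  qed (auto intro: real_polynomial_function.intros)
qed (auto intro: real_polynomial_function.intros)

lemma real_polynomial_function_imp_polys: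
  fixes f :: "real^'n \<Rightarrow> real"
  assumes "real_polynomial_function f" shows "\<exists>d. f \<in> polys d"
  using assms
proof induction
  case (linear f)
  interpret bounded_linear f by fact
  have "f x = (\<Sum>i\<in>UNIV. f (axis i 1) * (x $ i * 1))" for x
  proof -
    have "f x = f (\<Sum>i\<in>UNIV. x $ i *s axis i 1)" by (simp add: basis_expansion)
    then show ?thesis by (simp add: sum scale scalar_mult_eq_scaleR mult.commute)
  qed
  then have "f = (\<lambda>x. \<Sum>i\<in>UNIV. f (axis i 1) * (x $ i * 1))" by blast
  moreover have "\<dots> \<in> polys (Suc 0)"
    by (intro polys_sum polys_cmult polys_coord_mult polys_const) auto
  ultimately show ?case by metis
next
  case (const c)
  then show ?case using polys_const by blast
next
  case (add f g)
  then obtain d e where "f \<in> polys d" "g \<in> polys e" by blast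
  then have "f \<in> polys (d + e)" "g \<in> polys (d + e)"
    using polys_mono[of d "d + e"] polys_mono[of e "d + e"] by auto
  then show ?case using polys_add by blast
next
  case (mult f g)
  then show ?case using polys_mult by blast
qed

lemma partial_deriv_add_poly:
  assumes "real_polynomial_function f" "real_polynomial_function g"
  shows "partial_deriv i (\<lambda>x. f x + g x) = (\<lambda>x. partial_deriv i f x + partial_deriv i g x)"
  using assms by (auto simp: partial_deriv_add differentiable_at_real_polynomial_function)

lemma partial_deriv_cmult_poly:
  assumes "real_polynomial_function f"
  shows "partial_deriv i (\<lambda>x. c * f x) = (\<lambda>x. c * partial_deriv i f x)"
  using assms by (auto simp: partial_deriv_cmult differentiable_at_real_polynomial_function)

lemma partial_deriv_coord_mult:
  assumes "f differentiable (at x)"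
  shows "partial_deriv i (\<lambda>x. x $ j * f x) x = x $ j * partial_deriv i f x + (if i = j then f x else 0)"
proof -
  have "((\<lambda>x. x $ j) has_derivative (\<lambda>h. h $ j)) (at x)"
    by (intro bounded_linear_imp_has_derivative bounded_linear_vec_nth)
  from partial_deriv_eqI[OF has_derivative_mult[OF this has_derivative_frechet[OF assms]], of i]
  show ?thesis by (simp add: partial_deriv_def axis_def)
qed

lemma polys_partial_deriv:
  assumes "f \<in> polys d" shows "partial_deriv i f \<in> polys (d - 1)"
  using assms
proof (induction rule: polys_induct)
  case (monomial m)
  then show ?case
  proof (induction d arbitrary: m)
    case 0
    then show ?case by (simp add: partial_deriv_const polys_zero)
  next
    case (Suc d)
    then consider "m \<in> monomials d" | j n where "n \<in> monomials d" "m = (\<lambda>x. x $ j * n x)" by auto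
    then show ?case
    proof cases
      case 1
      then show ?thesis using Suc.IH[OF 1] polys_mono[of "d - 1" "d"] by auto
    next
      case 2
      have n: "n \<in> polys d" using 2 monomials_polys by blast
      have "(\<lambda>x. x $ j * partial_deriv i n x) \<in> polys d"
      \<comment> \<open>For \<open>d = 0\<close> the truncated \<open>d - 1\<close> does not leave
        the degree that the coordinate factor takes up, but then the derivative is zero.\<close>
      proof (cases d)
        case 0
        then have "n = (\<lambda>x. 1)" using 2 by simp
        then show ?thesis by (simp add: partial_deriv_const polys_zero)
      next
        case (Suc d')
        then show ?thesis using polys_coord_mult[OF Suc.IH[OF 2(1)], of j] by simp
      qed
      moreover have "(\<lambda>x. if i = j then n x else 0) \<in> polys d"
        using n by (cases "i = j") (simp_all add: polys_zero)
      moreover have "n differentiable (at x)" for x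
        using n polys_imp_real_polynomial_function differentiable_at_real_polynomial_function by blast
      then have "partial_deriv i m = (\<lambda>x. x $ j * partial_deriv i n x + (if i = j then n x else 0))"
        by (simp add: 2(2) partial_deriv_coord_mult fun_eq_iff)
      ultimately show ?thesis using polys_add by simp
    qed
  qed
next
  case (add f g)
  then show ?case using polys_add[OF add(3,4)]
    by (simp add: partial_deriv_add_poly polys_imp_real_polynomial_function)
next
  case (cmult c f)
  then show ?case using polys_cmult[OF cmult(2), of c]
    by (simp add: partial_deriv_cmult_poly polys_imp_real_polynomial_function)
qed (simp add: polys_zero partial_deriv_const)

text \<open>On the line through \<open>a\<close> and \<open>x\<close> the polynomial becomes one of
  a single variable with infinitely many zeros.\<close>

lemma polynomial_eq_0:
  fixes q :: "real^'n \<Rightarrow> real"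
  assumes q: "real_polynomial_function q" and z: "\<And>x. x \<in> ball a r \<Longrightarrow> q x = 0" and r: "0 < r"
  shows "q x = 0"
proof -
  define p where "p t = q (a + t *\<^sub>R (x - a))" for t :: real
  have "polynomial_function (\<lambda>t::real. a + t *\<^sub>R (x - a))"
    by (intro polynomial_function_add polynomial_function_const polynomial_function_mult polynomial_function_id)
  from real_polynomial_function_compose[OF this q]
  have "real_polynomial_function p" by (simp add: p_def[abs_def] o_def)
  then obtain c n where c: "p = (\<lambda>t. \<Sum>i\<le>n. c i * t ^ i)"
    using real_polynomial_function_iff_sum by blast
  define e where "e = r / (norm (x - a) + 1)"
  have e: "0 < e" using r by (simp add: e_def add_nonneg_pos)
  have "{0<..<e} \<subseteq> {t. (\<Sum>i\<le>n. c i * t ^ i) = 0}"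
  proof
    fix t assume t: "t \<in> {0<..<e}"
    have "t * norm (x - a) \<le> t * (norm (x - a) + 1)" using t by (intro mult_left_mono) auto
    also have "\<dots> < r" using t by (simp add: e_def pos_less_divide_eq add_nonneg_pos)
    finally have "p t = 0" unfolding p_def using t by (intro z) (simp add: dist_norm)
    then show "t \<in> {t. (\<Sum>i\<le>n. c i * t ^ i) = 0}" by (simp add: c)
  qed
  moreover have "infinite {0<..<e}" using e by (simp add: infinite_Ioo)
  ultimately have "infinite {t. (\<Sum>i\<le>n. c i * t ^ i) = 0}" using finite_subset by blast
  then have "\<forall>i\<le>n. c i = 0" using polyfun_finite_roots[of c n] by blast
  then have "p 1 = 0" by (simp add: c)
  then show ?thesis by (simp add: p_def)
qed

text \<open>On polynomials of degree at most \<open>d\<close>, the map \<open>q \<mapsto> L ((r\<^sup>2 - |x - a|\<^sup>2) q)\<close>, where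
  \<open>L f = E \<bullet> hess f\<close>, preserves the degree bound and is injective by the maximum principle.\<close>

theorem polynomial_dirichlet_problem:
  fixes E :: "real^'n^'n" and p :: "real^'n \<Rightarrow> real"
  assumes E: "\<And>P. P \<in> psd_mats \<Longrightarrow> 0 \<le> E \<bullet> P" and EI: "0 < E \<bullet> mat 1"
    and r: "0 < r" and p: "real_polynomial_function p"
  obtains \<phi> where "real_polynomial_function \<phi>" "\<And>x. E \<bullet> hess \<phi> x = 0" "\<And>x. x \<in> sphere a r \<Longrightarrow> \<phi> x = p x"
proof -
  define w :: "real^'n \<Rightarrow> real" where "w x = r\<^sup>2 - (norm (x - a))\<^sup>2" for x
  have weq: "w = (\<lambda>x. r\<^sup>2 + (-1) * (\<Sum>i\<in>UNIV. ((x $ i * 1 + (- (a $ i))) * (x $ i * 1 + (- (a $ i))))))"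
    by (simp add: w_def fun_eq_iff power2_norm_eq_inner inner_vec_def power2_eq_square[of "_ - _"])
  have lin: "(\<lambda>x. x $ i * 1 + (- (a $ i))) \<in> polys 1" for i
    using polys_add[OF polys_coord_mult[OF polys_const[of 1 0], of i] polys_const[of "- (a $ i)" "Suc 0"]] by simp
  have w: "w \<in> polys 2"
    unfolding weq using polys_mult[OF lin lin]
    by (intro polys_add polys_const polys_cmult polys_sum) (auto simp: numeral_2_eq_2)
  have wp: "real_polynomial_function w" using w by (rule polys_imp_real_polynomial_function)
  obtain d where d: "p \<in> polys d" using real_polynomial_function_imp_polys[OF p] by blast
  define L where "L f x = E \<bullet> hess f x" for f :: "real^'n \<Rightarrow> real" and x
  define T where "T q = L (\<lambda>x. w x * q x)" for q :: "real^'n \<Rightarrow> real"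
  have Leq: "L f = (\<lambda>x. \<Sum>i\<in>UNIV. \<Sum>j\<in>UNIV. E $ i $ j * partial_deriv i (partial_deriv j f) x)" for f
    by (simp add: L_def hess_def inner_vec_def fun_eq_iff)
  have Lpolys: "L f \<in> polys (e - 2)" if "f \<in> polys e" for f e
    unfolding Leq using polys_partial_deriv[OF polys_partial_deriv[OF that]]
    by (intro polys_sum polys_cmult) (simp_all add: diff_diff_left numeral_2_eq_2)
  have td: "twice_diff f x" if "f \<in> polys e" for f x e
    using that polys_imp_real_polynomial_function twice_diff_real_polynomial_function by blast
  have wq: "(\<lambda>x. w x * q x) \<in> polys (d + 2)" if "q \<in> polys d" for q
    using polys_mult[OF w that] by (simp add: add.commute)
  have Ladd: "L (\<lambda>x. f x + g x) = (\<lambda>x. L f x + L g x)" if "f \<in> polys e" "g \<in> polys e" for f g e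
    using twice_diff_add(2)[OF td[OF that(1)] td[OF that(2)]] by (simp add: L_def inner_add_right fun_eq_iff)
  have Lcm: "L (\<lambda>x. c * f x) = (\<lambda>x. c * L f x)" if "f \<in> polys e" for c f e
    using twice_diff_cmult(2)[OF td[OF that]] by (simp add: L_def fun_eq_iff)
  \<comment> \<open>The product \<open>w * q\<close> is harmonic and vanishes on the sphere, so the
    maximum principle for it and for its negative makes it zero in the ball, where \<open>w\<close>
    does not vanish.\<close>
  have inj: "q = 0" if q: "q \<in> polys d" and Tq: "T q = 0" for q
  proof -
    define f where "f x = w x * q x" for x
    have fp: "f \<in> polys (d + 2)" unfolding f_def using wq[OF q] .
    have Lf: "L f x = 0" for x using fun_cong[OF Tq, of x] by (simp add: T_def f_def[abs_def])
    have cont: "continuous_on A f" for A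
      using polys_imp_real_polynomial_function[OF fp] continuous_real_polymonial_function
      by (blast intro: continuous_at_imp_continuous_on)
    have sph: "f y = 0" if "y \<in> sphere a r" for y
      using that by (simp add: f_def w_def dist_norm norm_minus_commute)
    have "f x = 0" if x: "x \<in> ball a r" for x
    proof -
      have "x \<in> cball a r" using x by simp
      then have "\<exists>y\<in>sphere a r. f x \<le> f y"
        by (intro weak_max_principle[OF E EI cont td[OF fp]]) (use Lf in \<open>auto simp: L_def\<close>)
      moreover have "\<exists>y\<in>sphere a r. -1 * f x \<le> -1 * f y"
      proof (rule weak_max_principle[OF E EI, where f = "\<lambda>x. -1 * f x"])
        show "0 \<le> E \<bullet> hess (\<lambda>x. -1 * f x) x" for x
          using twice_diff_cmult(2)[OF td[OF fp], of "-1" x] Lf[of x] by (simp add: L_def)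
        show "twice_diff (\<lambda>x. -1 * f x) x" for x by (intro twice_diff_cmult td[OF fp])
        show "continuous_on (cball a r) (\<lambda>x. -1 * f x)" by (intro continuous_intros cont)
      qed (use x in auto)
      ultimately show ?thesis using sph by fastforce
    qed
    moreover have "w x \<noteq> 0" if "x \<in> ball a r" for x
      using that r power_strict_mono[of "norm (x - a)" r 2] by (simp add: w_def dist_norm norm_minus_commute)
    ultimately have "q x = 0" if "x \<in> ball a r" for x
      using that by (auto simp: f_def)
    from polynomial_eq_0[OF polys_imp_real_polynomial_function[OF q] this r]
    show ?thesis by (simp add: fun_eq_iff)
  qed
  \<comment> \<open>Solving \<open>T q = - L p\<close> makes \<open>p + w * q\<close> harmonic, and
    \<open>w = 0\<close> on the sphere keeps the boundary values.\<close>
  have rhs: "(\<lambda>x. -1 * L p x) \<in> polys d"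
    by (rule polys_cmult) (use Lpolys[OF d] polys_mono[of "d - 2" d] in auto)
  have "(\<lambda>x. -1 * L p x) \<in> T ` polys d"
    unfolding polys_def
  proof (rule fun_space.injective_endo_span_surj[OF finite_monomials])
    show "T ` fun_space.span (monomials d) \<subseteq> fun_space.span (monomials d)"
      using Lpolys[OF wq] by (auto simp: T_def polys_def)
    show "T (f + g) = T f + T g" if "f \<in> fun_space.span (monomials d)" "g \<in> fun_space.span (monomials d)" for f g
      using Ladd[OF wq[of f] wq[of g]] that by (simp add: T_def polys_def plus_fun_def distrib_left)
    show "T (\<lambda>x. c * f x) = (\<lambda>x. c * T f x)" if "f \<in> fun_space.span (monomials d)" for c f
      using Lcm[OF wq[of f], of c] that by (simp add: T_def polys_def mult.left_commute)
  qed (use inj rhs in \<open>auto simp: polys_def\<close>)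
  then obtain q where q: "q \<in> polys d" "T q = (\<lambda>x. -1 * L p x)" by (elim imageE) simp
  have pd2: "p \<in> polys (d + 2)" using d polys_mono[of d "d + 2"] by auto
  show ?thesis
  proof
    show "real_polynomial_function (\<lambda>x. p x + w x * q x)"
      using polys_add[OF pd2 wq[OF q(1)]] by (rule polys_imp_real_polynomial_function)
    show "E \<bullet> hess (\<lambda>x. p x + w x * q x) x = 0" for x
      using fun_cong[OF Ladd[OF pd2 wq[OF q(1)]], of x] fun_cong[OF q(2), of x] by (simp add: L_def T_def)
    show "p x + w x * q x = p x" if "x \<in> sphere a r" for x
      using that by (simp add: w_def dist_norm norm_minus_commute)
  qed
qed

section \<open>Approachability\<close>

text \<open>Blackwell's greedy strategy. Each new point is chosen with the negative parts of the
  current sums as weights, so the cross term does not increase the squared distance of the vector of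
  sums to the non-negative orthant; each step adds at most \<open>card J * C\<^sup>2\<close>. The
  distance therefore grows like the square root of \<open>N\<close>, and the defect per step tends
  to zero. It turns an inequality for every single non-negative combination into one sequence of
  points that serves all \<open>f j\<close> simultaneously.\<close>

lemma approachability:
  fixes f :: "'j \<Rightarrow> 'a \<Rightarrow> real"
  assumes J: "finite J" and bound: "\<And>j x. j \<in> J \<Longrightarrow> x \<in> S \<Longrightarrow> \<bar>f j x\<bar> \<le> C"
    and pos: "\<And>\<alpha>. (\<And>j. j \<in> J \<Longrightarrow> 0 \<le> \<alpha> j) \<Longrightarrow> \<exists>x\<in>S. 0 \<le> (\<Sum>j\<in>J. \<alpha> j * f j x)"
    and "0 < e"
  obtains N and x :: "nat \<Rightarrow> 'a" where "0 < N" "\<And>t. t < N \<Longrightarrow> x t \<in> S"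
    "\<And>j. j \<in> J \<Longrightarrow> - e * N \<le> (\<Sum>t<N. f j (x t))"
proof -
  have step: "\<exists>x. (\<forall>t<N. x t \<in> S) \<and> (\<Sum>j\<in>J. (min 0 (\<Sum>t<N. f j (x t)))\<^sup>2) \<le> N * (card J * C\<^sup>2)" for N :: nat
  proof (induction N)
    case 0
    then show ?case by simp
  next
    case (Suc N)
    then obtain x where x: "\<And>t. t < N \<Longrightarrow> x t \<in> S" 
      "(\<Sum>j\<in>J. (min 0 (\<Sum>t<N. f j (x t)))\<^sup>2) \<le> N * (card J * C\<^sup>2)" by blast
    define s where "s j = (\<Sum>t<N. f j (x t))" for j
    obtain y where y: "y \<in> S" "0 \<le> (\<Sum>j\<in>J. - min 0 (s j) * f j y)"
      using pos[of "\<lambda>j. - min 0 (s j)"] by auto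
    define x' where "x' = x(N := y)"
    have s': "(\<Sum>t<Suc N. f j (x' t)) = s j + f j y" for j
      by (simp add: s_def x'_def)
    \<comment> \<open>If \<open>min 0 (a + b)\<close> is negative, then \<open>a + b\<close> is
      negative and \<open>min 0 a + b\<close> is at most \<open>a + b\<close>.\<close>
    have sq: "(min 0 (a + b))\<^sup>2 \<le> (min 0 a + b)\<^sup>2" for a b :: real
      by (rule abs_le_square_iff[THEN iffD1]) auto
    have "(\<Sum>j\<in>J. (min 0 (s j + f j y))\<^sup>2) \<le> (\<Sum>j\<in>J. (min 0 (s j))\<^sup>2 + C\<^sup>2 - 2 * (- min 0 (s j) * f j y))"
    proof (rule sum_mono)
      fix j assume j: "j \<in> J"
      have "(f j y)\<^sup>2 \<le> C\<^sup>2" using bound[OF j y(1)] by (simp add: abs_le_square_iff[symmetric])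
      then show "(min 0 (s j + f j y))\<^sup>2 \<le> (min 0 (s j))\<^sup>2 + C\<^sup>2 - 2 * (- min 0 (s j) * f j y)"
        using sq[of "s j" "f j y"] by (simp add: power2_sum)
    qed
    also have "\<dots> \<le> N * (card J * C\<^sup>2) + card J * C\<^sup>2"
    proof -
      have "(\<Sum>j\<in>J. 2 * (- min 0 (s j) * f j y)) = 2 * (\<Sum>j\<in>J. - min 0 (s j) * f j y)"
        by (rule sum_distrib_left[symmetric])
      then show ?thesis
        using x(2) y(2) unfolding sum.distrib sum_subtractf s_def by simp
    qed
    finally show ?case
      using x(1) y(1) s' by (intro exI[of _ x']) (auto simp: x'_def less_Suc_eq algebra_simps simp del: sum.lessThan_Suc)
  qed
  \<comment> \<open>Beyond this \<open>N\<close> the bound \<open>N * card J * C\<^sup>2\<close> on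
    the squared distance is below \<open>(e * N)\<^sup>2\<close>.\<close>
  obtain N :: nat where N: "card J * C\<^sup>2 / e\<^sup>2 < N" using reals_Archimedean2 by blast
  then have N0: "0 < N" using \<open>0 < e\<close> by (smt (verit, best) divide_nonneg_nonneg mult_nonneg_nonneg of_nat_0_less_iff of_nat_less_0_iff zero_le_power2)
  obtain x where x: "\<And>t. t < N \<Longrightarrow> x t \<in> S" 
      "(\<Sum>j\<in>J. (min 0 (\<Sum>t<N. f j (x t)))\<^sup>2) \<le> N * (card J * C\<^sup>2)" using step[of N] by blast
  have "- e * N \<le> (\<Sum>t<N. f j (x t))" if j: "j \<in> J" for j
  proof (rule ccontr)
    assume "\<not> ?thesis"
    then have "e * N < \<bar>min 0 (\<Sum>t<N. f j (x t))\<bar>" by auto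
    then have "(e * N)\<^sup>2 < (min 0 (\<Sum>t<N. f j (x t)))\<^sup>2"
      using \<open>0 < e\<close> by (metis abs_le_square_iff abs_of_nonneg linorder_not_le mult_nonneg_nonneg of_nat_0_le_iff less_imp_le)
    also have "\<dots> \<le> (\<Sum>j\<in>J. (min 0 (\<Sum>t<N. f j (x t)))\<^sup>2)"
      using J j by (intro member_le_sum) auto
    also have "\<dots> \<le> N * (card J * C\<^sup>2)" by (rule x(2))
    also have "\<dots> < N * (N * e\<^sup>2)"
      using N N0 \<open>0 < e\<close> by (intro mult_strict_left_mono) (simp_all add: field_simps)
    finally show False by (simp add: power2_eq_square algebra_simps)
  qed
  with N0 x(1) that show ?thesis by blast
qed

section \<open>The multiplicative Brunn--Minkowski inequality\<close>

text \<open>Minkowski average with equal weights; unequal weights are covered by letting the sets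
  repeat along the index set.\<close>

definition mean_set :: "'t set \<Rightarrow> ('t \<Rightarrow> 'a::real_vector set) \<Rightarrow> 'a set" where
  "mean_set T A = {(\<Sum>t\<in>T. y t) /\<^sub>R card T | y. \<forall>t\<in>T. y t \<in> A t}"

lemma mean_set_mono: "(\<And>t. t \<in> T \<Longrightarrow> A t \<subseteq> B t) \<Longrightarrow> mean_set T A \<subseteq> mean_set T B"
  unfolding mean_set_def by blast

lemma open_mean_set:
  fixes A :: "'t \<Rightarrow> 'a::real_normed_vector set"
  assumes T: "finite T" "T \<noteq> {}" and A: "\<And>t. t \<in> T \<Longrightarrow> open (A t)"
  shows "open (mean_set T A)"
  unfolding open_dist
proof
  fix z assume "z \<in> mean_set T A"
  then obtain y where y: "z = (\<Sum>t\<in>T. y t) /\<^sub>R card T" "\<And>t. t \<in> T \<Longrightarrow> y t \<in> A t"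
    unfolding mean_set_def by blast
  obtain s where s: "s \<in> T" using T by blast
  obtain r where r: "r > 0" "\<And>w. dist w (y s) < r \<Longrightarrow> w \<in> A s"
    using A[OF s] y(2)[OF s] unfolding open_dist by blast
  have n: "0 < real (card T)" using T by (simp add: card_gt_0_iff)
  have "w \<in> mean_set T A" if w: "dist w z < r / card T" for w
  proof -
    \<comment> \<open>The whole displacement goes into the summand \<open>s\<close>, multiplied by
      \<open>card T\<close> to survive the averaging.\<close>
    define y' where "y' = y(s := y s + card T *\<^sub>R (w - z))"
    have "(\<Sum>t\<in>T. y' t) = (\<Sum>t\<in>T. y t) + card T *\<^sub>R (w - z)"
      using T s by (simp add: y'_def sum.remove add.assoc)
    then have "(\<Sum>t\<in>T. y' t) /\<^sub>R card T = w"
      using n y(1) by (simp add: algebra_simps)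
    moreover have "y' s \<in> A s"
      using w n by (intro r(2)) (simp add: y'_def dist_norm pos_less_divide_eq mult.commute)
    then have "\<forall>t\<in>T. y' t \<in> A t" using y(2) by (auto simp: y'_def)
    ultimately show ?thesis unfolding mean_set_def by blast
  qed
  then show "\<exists>e>0. \<forall>w. dist w z < e \<longrightarrow> w \<in> mean_set T A"
    using r(1) n by (intro exI[of _ "r / card T"]) auto
qed

lemma bounded_mean_set:
  fixes A :: "'t \<Rightarrow> 'a::real_normed_vector set"
  assumes T: "finite T" and A: "\<And>t. t \<in> T \<Longrightarrow> bounded (A t)"
  shows "bounded (mean_set T A)"
proof -
  have "\<exists>B. \<forall>x\<in>A t. norm x \<le> B" if "t \<in> T" for t using A[OF that] by (simp add: bounded_iff)
  then obtain B where B: "\<And>t x. t \<in> T \<Longrightarrow> x \<in> A t \<Longrightarrow> norm x \<le> B t" by metis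
  have "norm z \<le> (\<Sum>t\<in>T. B t) / card T" if "z \<in> mean_set T A" for z
    using that B unfolding mean_set_def
    by (auto intro!: divide_right_mono sum_norm_le simp: divide_inverse_commute)
      (meson inverse_nonnegative_iff_nonnegative mult_left_mono of_nat_0_le_iff sum_norm_le)
  then show ?thesis unfolding bounded_iff by blast
qed

section \<open>Half-space cuts of finite box families\<close>

lemma box_Int_halfspace:
  fixes a b :: "'a::euclidean_space"
  assumes "i \<in> Basis"
  shows "\<exists>a' b'. box a b \<inter> {x. x \<bullet> i < c} = box a' b'" "\<exists>a' b'. box a b \<inter> {x. c < x \<bullet> i} = box a' b'"
proof -
  have "box a b \<inter> {x. x \<bullet> i < c} = box a (b + (min (b \<bullet> i) c - b \<bullet> i) *\<^sub>R i)"
    using assms by (auto simp: box_def inner_add_left inner_Basis split: if_splits)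
  moreover have "box a b \<inter> {x. c < x \<bullet> i} = box (a + (max (a \<bullet> i) c - a \<bullet> i) *\<^sub>R i) b"
    using assms by (auto simp: box_def inner_add_left inner_Basis split: if_splits)
  ultimately show "\<exists>a' b'. box a b \<inter> {x. x \<bullet> i < c} = box a' b'" "\<exists>a' b'. box a b \<inter> {x. c < x \<bullet> i} = box a' b'"
    by blast+
qed

definition box_family :: "'a::euclidean_space set set \<Rightarrow> bool" where
  "box_family \<D> \<longleftrightarrow> finite \<D> \<and> \<D> \<noteq> {} \<and> pairwise disjnt \<D> \<and> (\<forall>D\<in>\<D>. D \<noteq> {} \<and> (\<exists>a b. D = box a b))"

lemma open_Union_box_family: "box_family \<D> \<Longrightarrow> open (\<Union>\<D>)"
  unfolding box_family_def using open_box by (metis open_Union)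

lemma bounded_Union_box_family: "box_family \<D> \<Longrightarrow> bounded (\<Union>\<D>)"
  unfolding box_family_def using bounded_box by (metis bounded_Union)

lemma measure_open_pos:
  fixes S :: "'a::euclidean_space set"
  assumes "open S" "bounded S" "S \<noteq> {}"
  shows "0 < measure lebesgue S"
  using assms open_not_negligible[of S] negligible_iff_measure[of S] lmeasurable_open[of S]
  by (metis less_eq_real_def measure_nonneg)

text \<open>Empty pieces are discarded so that the number of boxes drops as soon as one box misses
  \<open>H\<close>; this number drives the induction for unions of boxes.\<close>

lemma box_family_Int:
  assumes "box_family \<D>" and H: "\<And>a b. \<exists>a' b'. box a b \<inter> H = box a' b'" and "\<Union>\<D> \<inter> H \<noteq> {}"
  shows "box_family ((\<lambda>D. D \<inter> H) ` \<D> - {{}})" "\<Union>((\<lambda>D. D \<inter> H) ` \<D> - {{}}) = \<Union>\<D> \<inter> H"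
    "card ((\<lambda>D. D \<inter> H) ` \<D> - {{}}) \<le> card \<D>"
    "D \<in> \<D> \<Longrightarrow> D \<inter> H = {} \<Longrightarrow> card ((\<lambda>D. D \<inter> H) ` \<D> - {{}}) < card \<D>"
proof -
  have fin: "finite \<D>" using assms by (simp add: box_family_def)
  show U: "\<Union>((\<lambda>D. D \<inter> H) ` \<D> - {{}}) = \<Union>\<D> \<inter> H" by auto
  have "pairwise disjnt ((\<lambda>D. D \<inter> H) ` \<D> - {{}})"
    using assms(1) unfolding box_family_def pairwise_def disjnt_def by blast
  moreover have "\<exists>a b. D \<inter> H = box a b" if "D \<in> \<D>" for D
    using assms(1) that H unfolding box_family_def by metis
  moreover have "(\<lambda>D. D \<inter> H) ` \<D> - {{}} \<noteq> {}"
    using assms(3) by blast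
  ultimately show "box_family ((\<lambda>D. D \<inter> H) ` \<D> - {{}})"
    using fin unfolding box_family_def by blast
  show "card ((\<lambda>D. D \<inter> H) ` \<D> - {{}}) \<le> card \<D>"
    using fin by (meson card_Diff1_le card_image_le order_trans)
  show "card ((\<lambda>D. D \<inter> H) ` \<D> - {{}}) < card \<D>" if "D \<in> \<D>" "D \<inter> H = {}"
  proof -
    have "(\<lambda>D. D \<inter> H) ` \<D> - {{}} \<subseteq> (\<lambda>D. D \<inter> H) ` (\<D> - {D})" using that by auto
    then have "card ((\<lambda>D. D \<inter> H) ` \<D> - {{}}) \<le> card (\<D> - {D})"
      using fin by (meson card_image_le card_mono finite_Diff finite_imageI order_trans)
    also have "\<dots> < card \<D>" using fin that by (meson card_Diff1_less)
    finally show ?thesis .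
  qed
qed

lemma measure_split_halfspace:
  fixes S :: "'a::euclidean_space set"
  assumes "open S" "bounded S" "i \<in> Basis"
  shows "measure lebesgue S = measure lebesgue (S \<inter> {x. x \<bullet> i < c}) + measure lebesgue (S \<inter> {x. c < x \<bullet> i})"
proof -
  have o: "open (S \<inter> {x. x \<bullet> i < c})" "open (S \<inter> {x. c < x \<bullet> i})"
    using assms by (auto intro!: open_Int open_halfspace_component_lt open_halfspace_component_gt)
  then have m: "S \<inter> {x. x \<bullet> i < c} \<in> lmeasurable" "S \<inter> {x. c < x \<bullet> i} \<in> lmeasurable"
    using assms by (auto intro!: lmeasurable_open bounded_Int)
  have "measure lebesgue S = measure lebesgue (S \<inter> {x. x \<bullet> i < c} \<union> S \<inter> {x. c < x \<bullet> i})"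
    by (rule measure_negligible_symdiff)
      (use fmeasurable.Un[OF m] lmeasurable_open[OF assms(2,1)] in \<open>auto intro!: negligible_subset[OF negligible_standard_hyperplane[OF assms(3), of c]]\<close>)
  also have "\<dots> = measure lebesgue (S \<inter> {x. x \<bullet> i < c}) + measure lebesgue (S \<inter> {x. c < x \<bullet> i})"
  proof -
    have "(S \<inter> {x. x \<bullet> i < c}) \<inter> (S \<inter> {x. c < x \<bullet> i}) = {}" by auto
    then show ?thesis using measure_Un3[OF m] by simp
  qed
  finally show ?thesis .
qed

text \<open>Intermediate value theorem: the volume below height \<open>c\<close> is Lipschitz in
  \<open>c\<close>, because the slab between two heights meets the bounded set inside a box of fixed
  cross-section.\<close>

lemma halfspace_split_value:
  fixes S :: "'a::euclidean_space set"
  assumes S: "open S" "bounded S" and i: "i \<in> Basis" and \<theta>: "0 < \<theta>" "\<theta> < 1"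
  shows "\<exists>c. measure lebesgue (S \<inter> {x. x \<bullet> i < c}) = \<theta> * measure lebesgue S"
proof -
  define F where "F c = measure lebesgue (S \<inter> {x. x \<bullet> i < c})" for c
  obtain R where R: "R > 0" "\<And>x. x \<in> S \<Longrightarrow> norm x \<le> R"
    using S(2) bounded_pos by metis
  have xi: "\<bar>x \<bullet> j\<bar> \<le> R" if "x \<in> S" "j \<in> Basis" for x j
    using Basis_le_norm[of j x] R(2) that by fastforce
  have m: "S \<inter> {x. x \<bullet> i < c} \<in> lmeasurable" for c
    using S by (auto intro!: lmeasurable_open bounded_Int open_Int open_halfspace_component_lt)
  \<comment> \<open>The cross-section, orthogonal to \<open>i\<close>, of a cube of side
    \<open>2 * R\<close> that contains \<open>S\<close>.\<close>
  define L where "L = (\<Prod>j\<in>Basis - {i}. 2 * R)"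
  have lip1: "F c' - F c \<le> (c' - c) * L" "F c \<le> F c'" if "c \<le> c'" for c c'
  proof -
    show "F c \<le> F c'" unfolding F_def
      using that m by (intro measure_mono_fmeasurable) (auto dest: fmeasurableD)
    define u v where "u = (\<Sum>j\<in>Basis. (if j = i then c else -R) *\<^sub>R j)" and "v = (\<Sum>j\<in>Basis. (if j = i then c' else R) *\<^sub>R j)"
    have uv: "u \<bullet> j = (if j = i then c else -R)" "v \<bullet> j = (if j = i then c' else R)" if "j \<in> Basis" for j
      using that by (simp_all add: u_def v_def)
    have "S \<inter> {x. x \<bullet> i < c'} \<subseteq> (S \<inter> {x. x \<bullet> i < c}) \<union> cbox u v"
    proof
      fix x assume x: "x \<in> S \<inter> {x. x \<bullet> i < c'}"
      show "x \<in> (S \<inter> {x. x \<bullet> i < c}) \<union> cbox u v"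
      proof (cases "x \<bullet> i < c")
        case False
        then have "u \<bullet> j \<le> x \<bullet> j \<and> x \<bullet> j \<le> v \<bullet> j" if "j \<in> Basis" for j
          using xi[of x j] x uv[OF that] that by auto
        then show ?thesis by (simp add: mem_box)
      qed (use x in auto)
    qed
    then have "F c' \<le> measure lebesgue ((S \<inter> {x. x \<bullet> i < c}) \<union> cbox u v)"
      unfolding F_def using m by (intro measure_mono_fmeasurable fmeasurable.Un) (auto dest: fmeasurableD)
    also have "\<dots> \<le> F c + measure lebesgue (cbox u v)"
      unfolding F_def using m by (intro measure_Un_le) (auto dest: fmeasurableD)
    also have "measure lebesgue (cbox u v) = (\<Prod>j\<in>Basis. v \<bullet> j - u \<bullet> j)"
    proof -
      have "\<forall>j\<in>Basis. u \<bullet> j \<le> v \<bullet> j" using that R uv by auto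
      then show ?thesis by (simp add: measure_lborel_cbox_eq inner_diff_left)
    qed
    also have "\<dots> = (c' - c) * L"
      using i uv by (simp add: L_def prod.remove[of Basis i])
    finally show "F c' - F c \<le> (c' - c) * L" by simp
  qed
  have "L \<ge> 0" using R by (auto simp: L_def intro!: prod_nonneg)
  have "continuous_on {-R..R + 1} F"
  proof (rule lipschitz_on_continuous_on)
    have "\<bar>F x - F y\<bar> \<le> L * \<bar>x - y\<bar>" for x y
      using lip1[of x y] lip1[of y x] by (cases "x \<le> y") (auto simp: mult.commute)
    then show "lipschitz_on L {-R..R + 1} F"
      using \<open>L \<ge> 0\<close> by (auto simp: lipschitz_on_def dist_real_def)
  qed
  moreover have "S \<inter> {x. x \<bullet> i < - R} = {}" "S \<inter> {x. x \<bullet> i < R + 1} = S"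
    using xi[OF _ i] by (force simp: abs_le_iff not_less)+
  then have "F (-R) = 0" "F (R + 1) = measure lebesgue S" by (simp_all add: F_def)
  ultimately obtain c where "F c = \<theta> * measure lebesgue S"
    using IVT'[of F "-R" "\<theta> * measure lebesgue S" "R + 1"] \<theta> R by (auto simp: mult_left_le_one_le)
  then show ?thesis by (auto simp: F_def)
qed

lemma measure_lebesgue_box:
  fixes a b :: "'a::euclidean_space"
  assumes "\<And>i. i \<in> Basis \<Longrightarrow> a \<bullet> i \<le> b \<bullet> i"
  shows "measure lebesgue (box a b) = (\<Prod>i\<in>Basis. b \<bullet> i - a \<bullet> i)"
  using assms by (subst measure_completion) (auto simp: measure_lborel_box_eq inner_diff_left)

text \<open>The box whose corners are the averaged corners lies in the mean; its side lengths are
  averages, and the arithmetic-geometric mean inequality applies to each coordinate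
  separately.\<close>

lemma mean_set_boxes:
  fixes a b :: "'t \<Rightarrow> 'a::euclidean_space"
  assumes T: "finite T" "T \<noteq> {}" and ne: "\<And>t. t \<in> T \<Longrightarrow> box (a t) (b t) \<noteq> {}"
  shows "(\<Prod>t\<in>T. measure lebesgue (box (a t) (b t))) powr (1 / card T)
           \<le> measure lebesgue (mean_set T (\<lambda>t. box (a t) (b t)))"
proof -
  define \<alpha> \<beta> where "\<alpha> = (\<Sum>t\<in>T. a t) /\<^sub>R card T" and "\<beta> = (\<Sum>t\<in>T. b t) /\<^sub>R card T"
  have n: "0 < real (card T)" using T by (simp add: card_gt_0_iff)
  have lt: "a t \<bullet> i < b t \<bullet> i" if "t \<in> T" "i \<in> Basis" for t i
    using ne[OF that(1)] that(2) by (simp add: box_ne_empty)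
  have len: "\<beta> \<bullet> i - \<alpha> \<bullet> i = (\<Sum>t\<in>T. (b t \<bullet> i - a t \<bullet> i) / card T)" for i
    by (simp add: \<alpha>_def \<beta>_def inner_sum_left sum_subtractf divide_inverse_commute right_diff_distrib
        flip: sum_distrib_left)
  have lt': "\<alpha> \<bullet> i < \<beta> \<bullet> i" if "i \<in> Basis" for i
  proof -
    have "0 < (\<Sum>t\<in>T. (b t \<bullet> i - a t \<bullet> i) / card T)"
      using T n lt that by (intro sum_pos) auto
    then show ?thesis by (simp flip: len)
  qed
  have sub: "box \<alpha> \<beta> \<subseteq> mean_set T (\<lambda>t. box (a t) (b t))"
  proof
    fix z assume z: "z \<in> box \<alpha> \<beta>"
    define \<tau> where "\<tau> i = (z \<bullet> i - \<alpha> \<bullet> i) / (\<beta> \<bullet> i - \<alpha> \<bullet> i)" for i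
    have \<tau>: "0 < \<tau> i" "\<tau> i < 1" if "i \<in> Basis" for i
      using z lt'[OF that] that by (auto simp: \<tau>_def mem_box)
    define y where "y t = (\<Sum>i\<in>Basis. (a t \<bullet> i + \<tau> i * (b t \<bullet> i - a t \<bullet> i)) *\<^sub>R i)" for t
    have yi: "y t \<bullet> i = a t \<bullet> i + \<tau> i * (b t \<bullet> i - a t \<bullet> i)" if "i \<in> Basis" for t i
      using that by (simp add: y_def)
    have "y t \<in> box (a t) (b t)" if t: "t \<in> T" for t
    proof -
      have "a t \<bullet> i < y t \<bullet> i \<and> y t \<bullet> i < b t \<bullet> i" if i: "i \<in> Basis" for i
      proof -
        have "0 < \<tau> i * (b t \<bullet> i - a t \<bullet> i)" "\<tau> i * (b t \<bullet> i - a t \<bullet> i) < 1 * (b t \<bullet> i - a t \<bullet> i)"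
          using \<tau>[OF i] lt[OF t i] by (auto intro!: mult_strict_right_mono simp del: mult_1)
        then show ?thesis using yi[OF i, of t] by auto
      qed
      then show ?thesis by (simp add: mem_box)
    qed
    moreover have "(\<Sum>t\<in>T. y t) /\<^sub>R card T = z"
    proof (rule euclidean_eqI)
      fix i :: 'a assume i: "i \<in> Basis"
      have "((\<Sum>t\<in>T. y t) /\<^sub>R card T) \<bullet> i = (\<Sum>t\<in>T. a t \<bullet> i + \<tau> i * (b t \<bullet> i - a t \<bullet> i)) / card T"
        using i by (simp add: inner_sum_left yi divide_inverse_commute)
      also have "\<dots> = (\<Sum>t\<in>T. a t \<bullet> i) / card T + \<tau> i * (\<Sum>t\<in>T. (b t \<bullet> i - a t \<bullet> i) / card T)"
        by (simp add: sum.distrib add_divide_distrib sum_divide_distrib sum_distrib_left)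
      also have "\<dots> = \<alpha> \<bullet> i + \<tau> i * (\<beta> \<bullet> i - \<alpha> \<bullet> i)"
        unfolding len by (simp add: \<alpha>_def inner_sum_left divide_inverse_commute)
      also have "\<dots> = z \<bullet> i" using lt'[OF i] by (simp add: \<tau>_def)
      finally show "((\<Sum>t\<in>T. y t) /\<^sub>R card T) \<bullet> i = z \<bullet> i" .
    qed
    ultimately show "z \<in> mean_set T (\<lambda>t. box (a t) (b t))" unfolding mean_set_def by blast
  qed
  have "(\<Prod>t\<in>T. measure lebesgue (box (a t) (b t))) powr (1 / card T)
      = (\<Prod>t\<in>T. \<Prod>i\<in>Basis. b t \<bullet> i - a t \<bullet> i) powr (1 / card T)"
    using lt by (intro arg_cong[where f = "\<lambda>x. x powr _"] prod.cong measure_lebesgue_box) (auto simp: less_imp_le)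
  also have "\<dots> = (\<Prod>i\<in>Basis. (\<Prod>t\<in>T. b t \<bullet> i - a t \<bullet> i) powr (1 / card T))"
    using lt by (subst prod.swap) (auto simp: prod_powr_distrib prod_nonneg less_imp_le)
  also have "\<dots> \<le> (\<Prod>i\<in>Basis. \<Sum>t\<in>T. (b t \<bullet> i - a t \<bullet> i) / card T)"
    using T lt by (intro prod_mono conjI arith_geom_mean) (auto simp: less_imp_le)
  also have "\<dots> = measure lebesgue (box \<alpha> \<beta>)"
    using lt' by (subst measure_lebesgue_box) (auto simp: len less_imp_le)
  also have "\<dots> \<le> measure lebesgue (mean_set T (\<lambda>t. box (a t) (b t)))"
    using T sub by (intro measure_mono_fmeasurable lmeasurable_open bounded_mean_set open_mean_set) (auto dest: fmeasurableD)
  finally show ?thesis .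
qed

text \<open>The Hadwiger--Ohmann argument: a hyperplane separating two boxes of one family is matched by
  parallel hyperplanes cutting the other unions in the same ratio.\<close>

lemma mean_set_box_families:
  fixes \<D> :: "'t \<Rightarrow> 'a::euclidean_space set set"
  assumes T: "finite T" "T \<noteq> {}" and "\<And>t. t \<in> T \<Longrightarrow> box_family (\<D> t)"
  shows "(\<Prod>t\<in>T. measure lebesgue (\<Union>(\<D> t))) powr (1 / card T)
           \<le> measure lebesgue (mean_set T (\<lambda>t. \<Union>(\<D> t)))"
  using assms(3)
\<comment> \<open>Induction on the total number of boxes: a cut strictly shrinks the family of
  \<open>s\<close> on both sides and enlarges no other family.\<close>
proof (induction "\<Sum>t\<in>T. card (\<D> t)" arbitrary: \<D> rule: less_induct)
  case less
  have n: "0 < real (card T)" using T by (simp add: card_gt_0_iff)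
  show ?case
  proof (cases "\<forall>t\<in>T. card (\<D> t) = 1")
    case True
    have "\<exists>a b. \<D> t = {box a b} \<and> box a b \<noteq> {}" if "t \<in> T" for t
      using True that less.prems[OF that] unfolding box_family_def by (metis card_1_singletonE insertI1)
    then obtain a b where ab: "\<And>t. t \<in> T \<Longrightarrow> \<D> t = {box (a t) (b t)} \<and> box (a t) (b t) \<noteq> {}" by metis
    have "mean_set T (\<lambda>t. \<Union>(\<D> t)) = mean_set T (\<lambda>t. box (a t) (b t))"
      using ab by (intro antisym mean_set_mono) auto
    then show ?thesis using mean_set_boxes[OF T, of a b] ab by simp
  next
    case False
    then obtain s where s: "s \<in> T" "card (\<D> s) \<noteq> 1" by blast
    have "card (\<D> s) \<noteq> 0" using less.prems[OF s(1)] by (simp add: box_family_def)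
    then obtain D1 D2 where D: "D1 \<in> \<D> s" "D2 \<in> \<D> s" "D1 \<noteq> D2"
      using s(2) by (metis One_nat_def card_1_singleton_iff card_eq_0_iff is_singletonI' is_singleton_def)
    obtain a1 b1 a2 b2 where box: "D1 = box a1 b1" "D2 = box a2 b2" and ne: "box a1 b1 \<noteq> {}" "box a2 b2 \<noteq> {}"
      using D less.prems[OF s(1)] unfolding box_family_def by metis
    have "box a1 b1 \<inter> box a2 b2 = {}"
      using less.prems[OF s(1)] D box unfolding box_family_def pairwise_def disjnt_def by blast
    then have "\<exists>i\<in>Basis. b1 \<bullet> i \<le> a2 \<bullet> i \<or> b2 \<bullet> i \<le> a1 \<bullet> i"
      using ne unfolding disjoint_interval box_ne_empty by force
    \<comment> \<open>Disjoint non-empty boxes are separated by a coordinate hyperplane, so each of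
      its open sides misses one whole box.\<close>
    then have "\<exists>i\<in>Basis. \<exists>c. \<exists>E\<in>\<D> s. \<exists>G\<in>\<D> s. (\<forall>x\<in>E. x \<bullet> i < c) \<and> (\<forall>x\<in>G. c < x \<bullet> i)"
    proof (elim bexE disjE)
      fix i :: 'a assume i: "i \<in> Basis"
      { assume "b1 \<bullet> i \<le> a2 \<bullet> i"
        then show ?thesis using i D box by (intro bexI[OF _ i] exI[of _ "b1 \<bullet> i"] bexI[OF _ D(1)] bexI[OF _ D(2)]) (auto simp: mem_box; fastforce) }
      { assume "b2 \<bullet> i \<le> a1 \<bullet> i"
        then show ?thesis using i D box by (intro bexI[OF _ i] exI[of _ "b2 \<bullet> i"] bexI[OF _ D(2)] bexI[OF _ D(1)]) (auto simp: mem_box; fastforce) }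
    qed
    then obtain i c0 E G where i: "i \<in> Basis" and EG: "E \<in> \<D> s" "G \<in> \<D> s"
      "\<And>x. x \<in> E \<Longrightarrow> x \<bullet> i < c0" "\<And>x. x \<in> G \<Longrightarrow> c0 < x \<bullet> i" by metis
    define V where "V t = measure lebesgue (\<Union>(\<D> t))" for t
    have op: "open (\<Union>(\<D> t))" and bd: "bounded (\<Union>(\<D> t))" and ne': "\<Union>(\<D> t) \<noteq> {}" if "t \<in> T" for t
      using less.prems[OF that] open_Union_box_family bounded_Union_box_family by (auto simp: box_family_def)
    have V: "0 < V t" if "t \<in> T" for t
      unfolding V_def using that op bd ne' by (intro measure_open_pos) auto
    define lo up where "lo c = {x. x \<bullet> i < c}" and "up c = {x. c < x \<bullet> i}" for c
    have oplu: "open (lo c)" "open (up c)" for c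
      unfolding lo_def up_def by (auto intro: open_halfspace_component_lt open_halfspace_component_gt)
    have split: "V t = measure lebesgue (\<Union>(\<D> t) \<inter> lo c) + measure lebesgue (\<Union>(\<D> t) \<inter> up c)" if "t \<in> T" for t c
      unfolding V_def lo_def up_def by (rule measure_split_halfspace[OF op[OF that] bd[OF that] i])
    have "E \<noteq> {}" "G \<noteq> {}" using EG less.prems[OF s(1)] by (auto simp: box_family_def)
    then have "\<Union>(\<D> s) \<inter> lo c0 \<noteq> {}" "\<Union>(\<D> s) \<inter> up c0 \<noteq> {}"
      using EG by (auto simp: lo_def up_def)
    then have pos: "0 < measure lebesgue (\<Union>(\<D> s) \<inter> lo c0)" "0 < measure lebesgue (\<Union>(\<D> s) \<inter> up c0)"
      by (auto simp del: measure_completion intro!: measure_open_pos open_Int bounded_Int op[OF s(1)] bd[OF s(1)] oplu)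
    define \<theta> where "\<theta> = measure lebesgue (\<Union>(\<D> s) \<inter> lo c0) / V s"
    have \<theta>: "0 < \<theta>" "\<theta> < 1"
      using pos split[OF s(1), of c0] V[OF s(1)] by (auto simp: \<theta>_def)
    have "\<exists>c. measure lebesgue (\<Union>(\<D> t) \<inter> lo c) = \<theta> * V t \<and> (t = s \<longrightarrow> c = c0)" if "t \<in> T" for t
    proof (cases "t = s")
      case True
      then show ?thesis using V[OF s(1)] by (auto simp: \<theta>_def)
    next
      case False
      then show ?thesis
        using halfspace_split_value[OF op[OF that] bd[OF that] i \<theta>] by (auto simp: lo_def V_def)
    qed
    then obtain c where c: "\<And>t. t \<in> T \<Longrightarrow> measure lebesgue (\<Union>(\<D> t) \<inter> lo (c t)) = \<theta> * V t" "c s = c0"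
      using s(1) by metis
    have c': "measure lebesgue (\<Union>(\<D> t) \<inter> up (c t)) = (1 - \<theta>) * V t" if "t \<in> T" for t
      using split[OF that, of "c t"] c(1)[OF that] by (simp add: algebra_simps)
    define \<L> \<U> where "\<L> t = (\<lambda>D. D \<inter> lo (c t)) ` \<D> t - {{}}" and "\<U> t = (\<lambda>D. D \<inter> up (c t)) ` \<D> t - {{}}" for t
    have box_lu: "\<exists>a' b'. box a b \<inter> lo c = box a' b'" "\<exists>a' b'. box a b \<inter> up c = box a' b'" for a b c
      unfolding lo_def up_def by (rule box_Int_halfspace[OF i])+
    have neL: "\<Union>(\<D> t) \<inter> lo (c t) \<noteq> {}" if "t \<in> T" for t
      using c(1)[OF that] \<theta> V[OF that] by (metis measure_empty mult_pos_pos less_irrefl)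
    have neU: "\<Union>(\<D> t) \<inter> up (c t) \<noteq> {}" if "t \<in> T" for t
      using c'[OF that] \<theta> V[OF that] by (metis measure_empty mult_pos_pos less_irrefl diff_gt_0_iff_gt)
    have L: "box_family (\<L> t)" "\<Union>(\<L> t) = \<Union>(\<D> t) \<inter> lo (c t)" "card (\<L> t) \<le> card (\<D> t)" 
      and U: "box_family (\<U> t)" "\<Union>(\<U> t) = \<Union>(\<D> t) \<inter> up (c t)" "card (\<U> t) \<le> card (\<D> t)" if "t \<in> T" for t
      unfolding \<L>_def \<U>_def
      by (rule box_family_Int[OF less.prems[OF that] box_lu(1) neL[OF that]]
          box_family_Int[OF less.prems[OF that] box_lu(2) neU[OF that]])+
    have sL: "card (\<L> s) < card (\<D> s)" unfolding \<L>_def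
      by (rule box_family_Int(4)[OF less.prems[OF s(1)] box_lu(1) neL[OF s(1)] EG(2)])
         (use EG(4) c(2) in \<open>force simp: lo_def\<close>)
    have sU: "card (\<U> s) < card (\<D> s)" unfolding \<U>_def
      by (rule box_family_Int(4)[OF less.prems[OF s(1)] box_lu(2) neU[OF s(1)] EG(1)])
         (use EG(3) c(2) in \<open>force simp: up_def\<close>)
    \<comment> \<open>The geometric mean is homogeneous of degree one, so the two halves contribute
      the shares \<open>\<theta>\<close> and \<open>1 - \<theta>\<close> of the same
      quantity.\<close>
    have hom: "(\<Prod>t\<in>T. r * V t) powr (1 / card T) = r * (\<Prod>t\<in>T. V t) powr (1 / card T)" if "0 < r" for r
    proof -
      have "(r ^ card T) powr (1 / card T) = r"
        using that n by (simp flip: powr_realpow add: powr_powr)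
      then show ?thesis using that V by (simp add: prod.distrib powr_mult prod_nonneg less_imp_le)
    qed
    have "\<theta> * (\<Prod>t\<in>T. V t) powr (1 / card T) = (\<Prod>t\<in>T. measure lebesgue (\<Union>(\<L> t))) powr (1 / card T)"
      using hom[OF \<theta>(1)] c(1) L(2) by (simp cong: prod.cong)
    also have "\<dots> \<le> measure lebesgue (mean_set T (\<lambda>t. \<Union>(\<L> t)))"
      using T s(1) sL L by (intro less.hyps sum_strict_mono_ex1) auto
    finally have mL: "\<theta> * (\<Prod>t\<in>T. V t) powr (1 / card T) \<le> measure lebesgue (mean_set T (\<lambda>t. \<Union>(\<L> t)))" .
    have "(1 - \<theta>) * (\<Prod>t\<in>T. V t) powr (1 / card T) = (\<Prod>t\<in>T. measure lebesgue (\<Union>(\<U> t))) powr (1 / card T)"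
      using hom[of "1 - \<theta>"] \<theta> c' U(2) by (simp cong: prod.cong)
    also have "\<dots> \<le> measure lebesgue (mean_set T (\<lambda>t. \<Union>(\<U> t)))"
      using T s(1) sU U by (intro less.hyps sum_strict_mono_ex1) auto
    finally have mU: "(1 - \<theta>) * (\<Prod>t\<in>T. V t) powr (1 / card T) \<le> measure lebesgue (mean_set T (\<lambda>t. \<Union>(\<U> t)))" .
    have lm: "mean_set T (\<lambda>t. \<Union>(\<L> t)) \<in> lmeasurable" "mean_set T (\<lambda>t. \<Union>(\<U> t)) \<in> lmeasurable"
      "mean_set T (\<lambda>t. \<Union>(\<D> t)) \<in> lmeasurable"
      using T L(1) U(1) less.prems
      by (auto intro!: lmeasurable_open bounded_mean_set open_mean_set bounded_Union_box_family open_Union_box_family)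
    \<comment> \<open>The means of the lower and of the upper parts lie on opposite sides of the
      averaged hyperplane, so they are disjoint and their volumes add.\<close>
    have "x \<bullet> i < (\<Sum>t\<in>T. c t) / card T" if "x \<in> mean_set T (\<lambda>t. \<Union>(\<L> t))" for x
    proof -
      obtain y where y: "x = (\<Sum>t\<in>T. y t) /\<^sub>R card T" "\<And>t. t \<in> T \<Longrightarrow> y t \<in> \<Union>(\<L> t)"
        using \<open>x \<in> mean_set T (\<lambda>t. \<Union>(\<L> t))\<close> unfolding mean_set_def by auto
      have "y t \<bullet> i < c t" if "t \<in> T" for t
        using y(2)[OF that] L(2)[OF that] by (auto simp: lo_def)
      then have "(\<Sum>t\<in>T. y t \<bullet> i) < (\<Sum>t\<in>T. c t)" using T by (intro sum_strict_mono) auto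
      then show ?thesis using n by (simp add: y(1) inner_sum_left divide_inverse_commute)
    qed
    moreover have "(\<Sum>t\<in>T. c t) / card T < x \<bullet> i" if "x \<in> mean_set T (\<lambda>t. \<Union>(\<U> t))" for x
    proof -
      obtain y where y: "x = (\<Sum>t\<in>T. y t) /\<^sub>R card T" "\<And>t. t \<in> T \<Longrightarrow> y t \<in> \<Union>(\<U> t)"
        using \<open>x \<in> mean_set T (\<lambda>t. \<Union>(\<U> t))\<close> unfolding mean_set_def by auto
      have "c t < y t \<bullet> i" if "t \<in> T" for t
        using y(2)[OF that] U(2)[OF that] by (auto simp: up_def)
      then have "(\<Sum>t\<in>T. c t) < (\<Sum>t\<in>T. y t \<bullet> i)" using T by (intro sum_strict_mono) auto
      then show ?thesis using n by (simp add: y(1) inner_sum_left divide_inverse_commute)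
    qed
    ultimately have disj: "mean_set T (\<lambda>t. \<Union>(\<L> t)) \<inter> mean_set T (\<lambda>t. \<Union>(\<U> t)) = {}"
      by (metis disjoint_iff less_asym)
    have "(\<Prod>t\<in>T. V t) powr (1 / card T) = \<theta> * (\<Prod>t\<in>T. V t) powr (1 / card T) + (1 - \<theta>) * (\<Prod>t\<in>T. V t) powr (1 / card T)"
      by (simp add: algebra_simps)
    also have "\<dots> \<le> measure lebesgue (mean_set T (\<lambda>t. \<Union>(\<L> t))) + measure lebesgue (mean_set T (\<lambda>t. \<Union>(\<U> t)))"
      using mL mU by (rule add_mono)
    also have "\<dots> = measure lebesgue (mean_set T (\<lambda>t. \<Union>(\<L> t)) \<union> mean_set T (\<lambda>t. \<Union>(\<U> t)))"
      using measure_Un3[OF lm(1,2)] disj by simp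
    also have "\<dots> \<le> measure lebesgue (mean_set T (\<lambda>t. \<Union>(\<D> t)))"
    proof (rule measure_mono_fmeasurable)
      show "mean_set T (\<lambda>t. \<Union>(\<L> t)) \<union> mean_set T (\<lambda>t. \<Union>(\<U> t)) \<subseteq> mean_set T (\<lambda>t. \<Union>(\<D> t))"
        using L(2) U(2) by (intro Un_least mean_set_mono) auto
    qed (use lm in \<open>auto simp: fmeasurableD\<close>)
    finally show ?thesis by (simp add: V_def)
  qed
qed

text \<open>Non-overlapping closed boxes fill the open set, finitely many of them carry almost all
  its volume, and passing to interiors loses no volume while making them disjoint.\<close>

lemma open_box_family_approx:
  fixes S :: "'a::euclidean_space set"
  assumes "open S" "bounded S" "S \<noteq> {}" "r < measure lebesgue S"
  obtains \<D> where "box_family \<D>" "\<Union>\<D> \<subseteq> S" "r < measure lebesgue (\<Union>\<D>)"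
proof -
  obtain a b where ab: "S \<subseteq> cbox a b" "box a b \<noteq> {}"
    using bounded_subset_cbox_symmetric[OF assms(2)] assms(1,3)
    by (metis interior_cbox interior_mono interior_open subset_empty)
  \<comment> \<open>This gauge forces every box of the covering, being tagged by a point of
    \<open>S\<close>, to lie inside \<open>S\<close>.\<close>
  have "gauge (\<lambda>x. if x \<in> S then S else UNIV)" using assms(1) by (auto simp: gauge_def)
  from covering_lemma[OF ab this] obtain \<C> where
    \<C>: "countable \<C>" "\<And>K. K \<in> \<C> \<Longrightarrow> interior K \<noteq> {} \<and> (\<exists>c d. K = cbox c d)"
      "pairwise (\<lambda>A B. interior A \<inter> interior B = {}) \<C>" "S \<subseteq> \<Union>\<C>" and
    sub: "\<And>K. K \<in> \<C> \<Longrightarrow> \<exists>x\<in>S \<inter> K. K \<subseteq> (if x \<in> S then S else UNIV)"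
    by metis
  have subS: "K \<subseteq> S" if "K \<in> \<C>" for K using sub[OF that] by auto
  have lmK: "K \<in> lmeasurable" if "K \<in> \<C>" for K using \<C>(2)[OF that] by auto
  \<comment> \<open>With \<open>max 0 r\<close> in place of \<open>r\<close> the finite subfamily
    has positive volume, hence is non-empty, even for negative \<open>r\<close>.\<close>
  obtain \<C>' where \<C>': "\<C>' \<subseteq> \<C>" "finite \<C>'" "measure lebesgue (\<Union>\<C>) - (measure lebesgue S - max 0 r) < measure lebesgue (\<Union>\<C>')"
  proof (rule measure_countable_Union_approachable[OF \<C>(1)])
    show "0 < measure lebesgue S - max 0 r" using measure_open_pos[OF assms(1-3)] assms(4) by (simp del: measure_completion)
    show "measure lebesgue (\<Union>D') \<le> measure lebesgue S" if "D' \<subseteq> \<C>" "finite D'" for D'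
      using that subS lmK lmeasurable_open[OF assms(2,1)]
      by (intro measure_mono_fmeasurable) (auto intro!: sets.finite_Union dest: fmeasurableD)
  qed (use lmK in auto)
  have "\<Union>\<C> = S" using subS \<C>(4) by blast
  then have gt: "max 0 r < measure lebesgue (\<Union>\<C>')" using \<C>'(3) by simp
  have int: "\<exists>c d. interior K = box c d" "measure lebesgue (interior K) = measure lebesgue K" "interior K \<in> lmeasurable" if KC: "K \<in> \<C>'" for K
  proof -
    obtain c d where K: "K = cbox c d" using \<C>(2)[of K] \<C>'(1) KC by blast
    show "\<exists>c d. interior K = box c d" "interior K \<in> lmeasurable" by (auto simp: K)
    have "\<not> box c d = {}" using \<C>(2)[of K] \<C>'(1) KC K by auto
    then show "measure lebesgue (interior K) = measure lebesgue K"
      by (simp add: K content_cbox_cases measure_lborel_box_eq inner_diff_left)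
  qed
  have ne: "interior K \<noteq> {}" if "K \<in> \<C>'" for K using \<C>(2) \<C>'(1) that by blast
  have inj: "inj_on interior \<C>'"
    using \<C>(3) \<C>'(1) ne unfolding inj_on_def pairwise_def by (metis inf.idem subsetD)
  have pw: "pairwise disjnt (interior ` \<C>')"
    using \<C>(3) \<C>'(1) by (intro pairwise_imageI) (auto simp: pairwise_def disjnt_def subset_iff)
  have "max 0 r < measure lebesgue (\<Union>\<C>')" by (rule gt)
  also have "\<dots> \<le> (\<Sum>K\<in>\<C>'. measure lebesgue K)"
    using \<C>'(1,2) lmK by (intro measure_Union_le) (auto dest: fmeasurableD)
  also have "\<dots> = (\<Sum>K\<in>interior ` \<C>'. measure lebesgue K)"
    using int by (simp add: sum.reindex[OF inj])
  also have "\<dots> = measure lebesgue (\<Union>(interior ` \<C>'))"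
    using \<C>'(2) pw int by (intro measure_Union'[symmetric]) auto
  finally have m: "max 0 r < measure lebesgue (\<Union>(interior ` \<C>'))" .
  have "\<C>' \<noteq> {}" using gt by auto
  then have "box_family (interior ` \<C>')"
    using \<C>'(2) pw ne int(1) unfolding box_family_def by blast
  moreover have "\<Union>(interior ` \<C>') \<subseteq> S"
    using subS \<C>'(1) interior_subset by blast
  ultimately show ?thesis using m that by auto
qed

text \<open>Inner approximation by box families that keep more than the share \<open>r\<close> of
  each volume costs a factor \<open>r\<close> in the geometric mean; \<open>r\<close> is then
  arbitrary below 1.\<close>

theorem multiplicative_Brunn_Minkowski:
  fixes A :: "'t \<Rightarrow> 'a::euclidean_space set"
  assumes T: "finite T" "T \<noteq> {}" and A: "\<And>t. t \<in> T \<Longrightarrow> open (A t) \<and> bounded (A t) \<and> A t \<noteq> {}"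
  shows "(\<Prod>t\<in>T. measure lebesgue (A t)) powr (1 / card T) \<le> measure lebesgue (mean_set T A)"
proof (rule field_le_mult_one_interval)
  fix r :: real assume r: "0 < r" "r < 1"
  have n: "0 < real (card T)" using T by (simp add: card_gt_0_iff)
  have V: "0 < measure lebesgue (A t)" if "t \<in> T" for t
    using A[OF that] by (intro measure_open_pos) auto
  have "\<exists>\<D>. box_family \<D> \<and> \<Union>\<D> \<subseteq> A t \<and> r * measure lebesgue (A t) < measure lebesgue (\<Union>\<D>)" if "t \<in> T" for t
  proof -
    have "r * measure lebesgue (A t) < measure lebesgue (A t)" using V[OF that] r by (simp del: measure_completion)
    from open_box_family_approx[OF _ _ _ this] A[OF that] show ?thesis by metis
  qed
  then obtain \<D> where \<D>: "\<And>t. t \<in> T \<Longrightarrow> box_family (\<D> t)" "\<And>t. t \<in> T \<Longrightarrow> \<Union>(\<D> t) \<subseteq> A t"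
    "\<And>t. t \<in> T \<Longrightarrow> r * measure lebesgue (A t) < measure lebesgue (\<Union>(\<D> t))" by metis
  have "(r ^ card T) powr (1 / card T) = r"
    using r n by (simp flip: powr_realpow add: powr_powr)
  then have "r * (\<Prod>t\<in>T. measure lebesgue (A t)) powr (1 / card T) = (\<Prod>t\<in>T. r * measure lebesgue (A t)) powr (1 / card T)"
    using r by (simp add: prod.distrib powr_mult prod_nonneg)
  also have "\<dots> \<le> (\<Prod>t\<in>T. measure lebesgue (\<Union>(\<D> t))) powr (1 / card T)"
    using r \<D>(3) by (intro powr_mono2 prod_mono prod_nonneg) (auto simp: less_imp_le)
  also have "\<dots> \<le> measure lebesgue (mean_set T (\<lambda>t. \<Union>(\<D> t)))"
    by (rule mean_set_box_families[OF T \<D>(1)])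
  also have "\<dots> \<le> measure lebesgue (mean_set T A)"
    using T A \<D> 
    by (intro measure_mono_fmeasurable mean_set_mono fmeasurableD lmeasurable_open open_mean_set bounded_mean_set)
       (auto intro: open_Union_box_family bounded_Union_box_family)
  finally show "r * (\<Prod>t\<in>T. measure lebesgue (A t)) powr (1 / card T) \<le> measure lebesgue (mean_set T A)" .
qed

section \<open>Penalized test functions\<close>

definition fstv :: "real^('n::finite + 'm::finite) \<Rightarrow> real^'n" where
  "fstv z = (\<chi> i. z $ Inl i)"

definition sndv :: "real^('n::finite + 'm::finite) \<Rightarrow> real^'m" where
  "sndv z = (\<chi> j. z $ Inr j)"

lemma join_nth [simp]: "join x y $ Inl i = x $ i" "join x y $ Inr j = y $ j"
  by (simp_all add: join_def)

lemma fstv_nth [simp]: "fstv z $ i = z $ Inl i" and sndv_nth [simp]: "sndv z $ j = z $ Inr j"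
  by (simp_all add: fstv_def sndv_def)

lemma vec_sum_eq_iff: "(z :: real^('n::finite + 'm::finite)) = w \<longleftrightarrow> (\<forall>i. z $ Inl i = w $ Inl i) \<and> (\<forall>j. z $ Inr j = w $ Inr j)"
  unfolding vec_eq_iff by (auto simp: split_sum_all)

lemma fstv_join [simp]: "fstv (join x y) = x" and sndv_join [simp]: "sndv (join x y) = y"
  by (simp_all add: vec_eq_iff)

lemma join_fstv_sndv [simp]: "join (fstv z) (sndv z) = z"
  by (simp add: vec_sum_eq_iff)

lemma join_add: "join x y + join x' y' = join (x + x') (y + y')"
  and join_diff: "join x y - join x' y' = join (x - x') (y - y')"
  by (simp_all add: vec_sum_eq_iff)

lemma sum_UNIV_sum_type:
  "(\<Sum>i\<in>UNIV. f i) = (\<Sum>i\<in>UNIV. f (Inl i)) + (\<Sum>j\<in>UNIV. f (Inr j))"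
  for f :: "'a::finite + 'b::finite \<Rightarrow> 'c::comm_monoid_add"
  using sum.Plus[of UNIV UNIV f] by (simp add: UNIV_Plus_UNIV)

lemma inner_join: "join x y \<bullet> join x' y' = x \<bullet> x' + y \<bullet> y'"
  by (simp add: inner_vec_def sum_UNIV_sum_type)

lemma norm_join_sq: "(norm (join x y))\<^sup>2 = (norm x)\<^sup>2 + (norm y)\<^sup>2"
  by (simp add: power2_norm_eq_inner inner_join)

lemma norm_join_le: "norm (join x y) \<le> norm x + norm y"
proof -
  have "join x y = join x 0 + join 0 y" by (simp add: join_add)
  moreover have "norm (join x 0) = norm x" "norm (join 0 y) = norm y"
    using norm_join_sq[of x 0] norm_join_sq[of 0 y] by simp_all
  ultimately show ?thesis by (metis norm_triangle_ineq)
qed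

lemma norm_le_norm_join: "norm x \<le> norm (join x y)" "norm y \<le> norm (join x y)"
  by (rule power2_le_imp_le; simp add: norm_join_sq)+

lemma bounded_linear_fstv: "bounded_linear fstv"
  by (rule bounded_linear_intro[where K = 1])
    (simp_all add: vec_eq_iff, metis join_fstv_sndv norm_le_norm_join(1))

lemma bounded_linear_sndv: "bounded_linear sndv"
  by (rule bounded_linear_intro[where K = 1])
    (simp_all add: vec_eq_iff, metis join_fstv_sndv norm_le_norm_join(2))

lemmas continuous_on_fstv [continuous_intros] = bounded_linear.continuous_on[OF bounded_linear_fstv]
lemmas continuous_on_sndv [continuous_intros] = bounded_linear.continuous_on[OF bounded_linear_sndv]

lemma continuous_on_join [continuous_intros]:
  assumes "continuous_on A f" "continuous_on A g"
  shows "continuous_on A (\<lambda>x. join (f x) (g x))"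
proof -
  have "continuous_on A (\<lambda>x. join (f x) (g x) $ i)" for i
    using assms by (cases i) (auto intro!: continuous_intros)
  then show ?thesis by (simp add: join_def continuous_on_vec_lambda)
qed

lemma continuous_on_join' [continuous_intros]: "continuous_on A (join x)"
  using continuous_on_join[OF continuous_on_const continuous_on_id] by simp

text \<open>Without a maximum the sets of points with \<open>F y < F x\<close> cover
  \<open>N\<close>; the largest of the finitely many values \<open>F x\<close> of a subcover would
  be attained at a point left uncovered.\<close>

lemma usc_attains_sup:
  fixes F :: "'a::topological_space \<Rightarrow> ereal"
  assumes "compact N" "N \<noteq> {}" and usc: "\<And>a. openin (top_of_set N) {x \<in> N. F x < a}"
  shows "\<exists>z\<in>N. \<forall>y\<in>N. F y \<le> F z"
proof (rule ccontr)
  assume na: "\<not> ?thesis"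
  have lt: "F x < Sup (F ` N)" if "x \<in> N" for x
    using that na by (metis SUP_upper le_less not_le order_trans)
  define C where "C = (\<lambda>x. {y \<in> N. F y < F x}) ` N"
  have "\<exists>y\<in>N. F x < F y" if "x \<in> N" for x using na that by (meson not_le)
  then have "N \<subseteq> \<Union>C" unfolding C_def by fastforce
  moreover have "\<forall>c\<in>C. openin (top_of_set N) c" using usc by (auto simp: C_def)
  ultimately obtain D where D: "D \<subseteq> C" "finite D" "N \<subseteq> \<Union>D"
    using assms(1) unfolding compact_eq_openin_cover by meson
  obtain P where P: "P \<subseteq> N" "finite P" "D = (\<lambda>x. {y \<in> N. F y < F x}) ` P"
    using finite_subset_image[OF D(2) D(1)[unfolded C_def]] by blast
  have "P \<noteq> {}" using D(3) P(3) assms(2) by auto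
  then have "Max (F ` P) \<in> F ` P" using P(2) by simp
  then obtain p where p: "p \<in> P" "F p = Max (F ` P)" by auto
  then have "F p < F x" if "x \<in> P" "p \<in> N" "F p < F x" for x
    using that by simp
  moreover obtain x where "x \<in> P" "F p < F x" using D(3) P p(1) by blast
  ultimately show False using p(2) P(2) by (metis Max_ge finite_imageI image_eqI not_le)
qed

text \<open>A real number inserted between \<open>\<rho> x\<close> and
  \<open>a - ereal (c x)\<close> separates the condition on the sum into one on
  \<open>\<rho>\<close> and one on \<open>c\<close>.\<close>

lemma usc_add_continuous:
  fixes \<rho> :: "'a::topological_space \<Rightarrow> ereal"
  assumes usc: "usc_on U \<rho>" and N: "N \<subseteq> U" and c: "continuous_on N c"
  shows "openin (top_of_set N) {x \<in> N. \<rho> x + ereal (c x) < a}"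
proof -
  have "(\<exists>t. \<rho> x < ereal t \<and> ereal (t + c x) < a) \<longleftrightarrow> \<rho> x + ereal (c x) < a" for x
  proof
    assume "\<exists>t. \<rho> x < ereal t \<and> ereal (t + c x) < a"
    then obtain t where t: "\<rho> x < ereal t" "ereal (t + c x) < a" by blast
    then have "\<rho> x + ereal (c x) \<le> ereal t + ereal (c x)" by (intro add_right_mono) auto
    then show "\<rho> x + ereal (c x) < a" using t(2) by simp
  next
    assume *: "\<rho> x + ereal (c x) < a"
    then have "\<rho> x < a - ereal (c x)" by (cases a; cases "\<rho> x") auto
    then obtain t where "\<rho> x < ereal t" "ereal t < a - ereal (c x)" using ereal_dense2 by blast
    then show "\<exists>t. \<rho> x < ereal t \<and> ereal (t + c x) < a" by (cases a) auto
  qed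
  then have "{x \<in> N. \<rho> x + ereal (c x) < a} = (\<Union>t. {x \<in> N. \<rho> x < ereal t} \<inter> {x \<in> N. ereal (t + c x) < a})"
    by blast
  moreover have "openin (top_of_set N) {x \<in> N. \<rho> x < ereal t}" for t
  proof -
    have "openin (top_of_set N) (N \<inter> {x \<in> U. \<rho> x < ereal t})"
    proof -
      have "openin (top_of_set U) (U \<inter> {x \<in> U. \<rho> x < ereal t})"
        using usc by (simp add: usc_on_def Collect_conj_eq Int_assoc[symmetric])
      then show ?thesis using N by (rule openin_subtopology_Int_subset)
    qed
    moreover have "N \<inter> {x \<in> U. \<rho> x < ereal t} = {x \<in> N. \<rho> x < ereal t}" using N by auto
    ultimately show ?thesis by simp
  qed
  moreover have "openin (top_of_set N) {x \<in> N. ereal (t + c x) < a}" for t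
  proof -
    have "continuous_on N (\<lambda>x. ereal (t + c x))" by (intro continuous_intros c)
    then have "openin (top_of_set N) (N \<inter> (\<lambda>x. ereal (t + c x)) -` {..<a})"
      by (rule continuous_openin_preimage_gen) simp
    moreover have "N \<inter> (\<lambda>x. ereal (t + c x)) -` {..<a} = {x \<in> N. ereal (t + c x) < a}" by auto
    ultimately show ?thesis by simp
  qed
  ultimately show ?thesis by (auto intro!: openin_Union openin_Int)
qed

text \<open>As \<open>k\<close> grows, the maximum of \<open>\<rho> + b - k q\<close> over \<open>N\<close> is pushed towards the zero set of
  \<open>q\<close>; at the maximum, \<open>k q - b\<close> is a test function up to a constant.\<close>

lemma penalized_test_function:
  fixes \<rho> :: "real^'a \<Rightarrow> ereal"
  assumes sub: "subharmonic G U \<rho>" and N: "compact N" "N \<subseteq> U" and W: "open W" "W \<subseteq> N"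
    and q: "real_polynomial_function q" "\<And>z. z \<in> N \<Longrightarrow> 0 \<le> q z"
    and b: "real_polynomial_function b"
    and bdry: "\<And>z. z \<in> N - W \<Longrightarrow> q z = 0 \<Longrightarrow> \<rho> z \<le> ereal (m - b z)"
    and z1: "z1 \<in> N" "q z1 = 0" "ereal (m - b z1) < \<rho> z1"
  obtains c k z where "z \<in> W" "hess (\<lambda>w. c + k * q w - b w) z \<in> G"
proof -
  have usc: "usc_on U \<rho>" and fin: "\<And>z. z \<in> U \<Longrightarrow> \<rho> z \<noteq> \<infinity>" using sub by (auto simp: subharmonic_def)
  have contq: "continuous_on A q" and contb: "continuous_on A b" for A
    using q(1) b continuous_real_polymonial_function by (blast intro: continuous_at_imp_continuous_on)+
  obtain r1 where r1: "\<rho> z1 = ereal r1" using z1(3) fin[of z1] z1(1) N(2) by (cases "\<rho> z1") auto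
  define M where "M = r1 + b z1"
  have M: "m < M" using z1(3) by (simp add: r1 M_def)
  have ne: "N \<noteq> {}" using z1 by auto
  have op: "openin (top_of_set N) {x \<in> N. \<rho> x + ereal (b x) < a}" for a
    by (rule usc_add_continuous[OF usc N(2) contb])
  obtain zC where zC: "zC \<in> N" "\<And>y. y \<in> N \<Longrightarrow> \<rho> y + ereal (b y) \<le> \<rho> zC + ereal (b zC)"
    using usc_attains_sup[OF N(1) ne op] by blast
  have "\<rho> zC + ereal (b zC) \<noteq> \<infinity>" using fin[of zC] zC(1) N(2) by (cases "\<rho> zC") auto
  then obtain C where C: "\<rho> zC + ereal (b zC) \<le> ereal C" by (cases "\<rho> zC + ereal (b zC)") auto
  \<comment> \<open>The part of \<open>N\<close> outside \<open>W\<close> that could compete with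
    \<open>z1\<close>. It is compact and \<open>q\<close> is positive on it, so \<open>q\<close> has
    a positive lower bound \<open>\<eta>\<close> there.\<close>
  define Z where "Z = (N - W) - {x \<in> N. \<rho> x + ereal (b x) < ereal M}"
  have "closedin (top_of_set N) Z"
  proof -
    have "Z = (N - {x \<in> N. \<rho> x + ereal (b x) < ereal M}) \<inter> (N - W)" by (auto simp: Z_def)
    moreover have "closedin (top_of_set N) (N - {x \<in> N. \<rho> x + ereal (b x) < ereal M})"
      using op by (simp add: closedin_diff)
    moreover have "closedin (top_of_set N) (N - W)"
      using W by (simp add: closedin_diff open_subset)
    ultimately show ?thesis by (simp add: closedin_Int)
  qed
  then have "compact Z" using N(1) closedin_compact by blast
  have qZ: "0 < q z" if "z \<in> Z" for z
  proof (rule ccontr)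
    assume "\<not> 0 < q z"
    then have "q z = 0" using q(2)[of z] that by (auto simp: Z_def)
    then have "\<rho> z \<le> ereal (m - b z)" using bdry that by (auto simp: Z_def)
    then have "\<rho> z + ereal (b z) \<le> ereal m" by (cases "\<rho> z") auto
    also have "\<dots> < ereal M" using M by simp
    finally show False using that by (auto simp: Z_def)
  qed
  obtain \<eta> where \<eta>: "0 < \<eta>" "\<And>z. z \<in> Z \<Longrightarrow> \<eta> \<le> q z"
  proof (cases "Z = {}")
    case False
    obtain z where "z \<in> Z" "\<And>y. y \<in> Z \<Longrightarrow> q z \<le> q y"
      using continuous_attains_inf[OF \<open>compact Z\<close> False contq] by blast
    then show ?thesis using that[of "q z"] qZ by blast
  qed (use that[of 1] in auto)
  \<comment> \<open>Large enough that on \<open>Z\<close> the penalized value, at most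
    \<open>C - k * \<eta>\<close>, falls below the value \<open>M\<close> at \<open>z1\<close>,
    where the penalty vanishes; so the maximum lies in \<open>W\<close>.\<close>
  define k where "k = max 0 ((C - M) / \<eta>) + 1"
  have k0: "0 \<le> k" by (simp add: k_def)
  have "(C - M) / \<eta> < k" by (simp add: k_def)
  then have k: "C - k * \<eta> < M" using \<eta>(1) by (simp add: pos_divide_less_eq)
  have contkq: "continuous_on N (\<lambda>x. b x - k * q x)" by (intro continuous_intros contb contq)
  obtain z where z: "z \<in> N" "\<And>y. y \<in> N \<Longrightarrow> \<rho> y + ereal (b y - k * q y) \<le> \<rho> z + ereal (b z - k * q z)"
    using usc_attains_sup[OF N(1) ne usc_add_continuous[OF usc N(2) contkq]] by blast
  have Mz: "ereal M \<le> \<rho> z + ereal (b z - k * q z)"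
    using z(2)[OF z1(1)] by (simp add: z1(2) r1 M_def)
  obtain rz where rz: "\<rho> z = ereal rz"
    using Mz fin[of z] z(1) N(2) by (cases "\<rho> z") auto
  have zW: "z \<in> W"
  proof (rule ccontr)
    assume nW: "z \<notin> W"
    have "0 \<le> k * q z" using k0 q(2)[OF z(1)] by simp
    then have "M \<le> rz + b z" using Mz by (simp add: rz)
    then have "z \<in> Z" using z(1) nW by (simp add: Z_def rz)
    then have "k * \<eta> \<le> k * q z" using k0 \<eta>(2) by (intro mult_left_mono) auto
    moreover have "rz + b z \<le> C" using order_trans[OF zC(2)[OF z(1)] C] by (simp add: rz)
    ultimately show False using Mz k by (simp add: rz)
  qed
  define c where "c = rz + b z - k * q z"
  define g where "g = (\<lambda>w. c + k * q w - b w)"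
  have "real_polynomial_function g" unfolding g_def
    using q(1) b by (intro real_polynomial_function_diff real_polynomial_function.intros(2-4))
  then have "smooth_on W g" by (rule smooth_on_real_polynomial_function)
  moreover have "\<rho> x \<le> ereal (g x)" if "x \<in> W" for x
  proof -
    have "\<rho> x + ereal (b x - k * q x) \<le> ereal c"
      using z(2)[of x] that W(2) by (auto simp: rz c_def algebra_simps)
    then show ?thesis by (cases "\<rho> x") (auto simp: g_def)
  qed
  moreover have "ereal (g z) = \<rho> z" by (simp add: g_def c_def rz)
  ultimately have "test_function U \<rho> z W g"
    using W N zW by (auto simp: test_function_def)
  then have "hess g z \<in> G" using sub W N zW unfolding subharmonic_def by blast
  then show ?thesis using that zW unfolding g_def by blast
qed

section \<open>Convexity along fibres and harmonic graphs\<close>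

lemma graph_mat_mult: "graph_mat \<Gamma> *v v = join v (\<Gamma> *v v)"
  by (simp add: vec_sum_eq_iff graph_mat_def matrix_vector_mult_def mat_def if_distrib if_distribR cong: if_cong)

lemma inner_pullback: "v \<bullet> (pullback \<Gamma> A *v v) = join v (\<Gamma> *v v) \<bullet> (A *v join v (\<Gamma> *v v))"
proof -
  have "v \<bullet> (pullback \<Gamma> A *v v) = ((A *v (graph_mat \<Gamma> *v v)) v* graph_mat \<Gamma>) \<bullet> v"
    by (simp only: pullback_def matrix_vector_mul_assoc[symmetric] transpose_matrix_vector inner_commute)
  also have "\<dots> = join v (\<Gamma> *v v) \<bullet> (A *v join v (\<Gamma> *v v))"
    by (metis dot_lmul_matrix graph_mat_mult inner_commute)
  finally show ?thesis .
qed

lemma inner_lower_block: "w \<bullet> (lower_block A *v w) = join 0 w \<bullet> (A *v join 0 w)"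
  by (simp add: inner_vec_def sum_UNIV_sum_type matrix_vector_mult_def lower_block_def)

lemma pullback_sym: 
  assumes "A \<in> sym_mats" shows "pullback \<Gamma> A \<in> sym_mats"
  using assms by (simp add: sym_mats_def pullback_def matrix_transpose_mul matrix_mul_assoc)

lemma real_polynomial_function_nth: "real_polynomial_function (\<lambda>z. z $ i)"
  by (intro real_polynomial_function.intros(1) bounded_linear_vec_nth)

lemma real_polynomial_function_fstv:
  assumes "real_polynomial_function p" shows "real_polynomial_function (\<lambda>z. p (fstv z))"
  using real_polynomial_function_compose[OF polynomial_function_bounded_linear[OF bounded_linear_fstv] assms]
  by (simp add: o_def)

lemma norm_sq_vec: "(norm v)\<^sup>2 = (\<Sum>i\<in>UNIV. (v $ i)\<^sup>2)" for v :: "real^'k"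
  by (simp add: power2_norm_eq_inner inner_vec_def power2_eq_square[of "_ $ _"])

lemma compact_neighbourhood:
  fixes S :: "'a::euclidean_space set"
  assumes "compact S" "open U" "S \<subseteq> U"
  obtains \<eta> where "0 < \<eta>" "\<And>x z. x \<in> S \<Longrightarrow> dist x z \<le> \<eta> \<Longrightarrow> z \<in> U"
proof -
  obtain e where e: "0 < e" "(\<Union>x\<in>S. ball x e) \<subseteq> U"
    using compact_subset_open_imp_ball_epsilon_subset[OF assms] by blast
  show ?thesis
  proof
    show "0 < e / 2" using e by simp
    show "z \<in> U" if "x \<in> S" "dist x z \<le> e / 2" for x z
      using that e(1) by (intro subsetD[OF e(2)] UN_I[of x]) auto
  qed
qed

lemma ereal_pos_real: "0 < (x::ereal) \<Longrightarrow> \<exists>e>0. ereal e < x"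
  using ereal_dense2[of 0 x] by auto

text \<open>If \<open>\<rho>\<close> were above \<open>e\<close> somewhere on the segment,
  penalizing the distance to its line and adding \<open>e * (T z)\<^sup>2\<close> would give a test
  function with second derivative \<open>- 2 * e\<close> in the fibre direction \<open>w\<close>,
  against the positive semidefinite lower block. The whole segment must lie in \<open>U\<close>, the
  only place where \<open>\<rho>\<close> is controlled.\<close>

lemma subharmonic_star_psd_segment:
  fixes \<rho> :: "real^('n::finite + 'm::finite) \<Rightarrow> ereal"
  assumes sub: "subharmonic (star_psd F) U \<rho>" and U: "open U"
    and seg: "\<And>t. 0 \<le> t \<Longrightarrow> t \<le> 1 \<Longrightarrow> join x (a + t *\<^sub>R w) \<in> U"
    and ends: "\<rho> (join x a) \<le> 0" "\<rho> (join x (a + w)) \<le> 0"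
    and t1: "0 \<le> t1" "t1 \<le> 1"
  shows "\<rho> (join x (a + t1 *\<^sub>R w)) \<le> 0"
proof (rule ccontr)
  assume na: "\<not> ?thesis"
  then obtain e where e: "0 < e" "ereal e < \<rho> (join x (a + t1 *\<^sub>R w))"
    using ereal_pos_real by (meson not_le)
  have w0: "w \<noteq> 0" using na ends by auto
  then have ww: "0 < w \<bullet> w" by simp
  have "compact ((\<lambda>t. join x (a + t *\<^sub>R w)) ` {0..1})"
    by (intro compact_continuous_image continuous_intros) auto
  moreover have "(\<lambda>t. join x (a + t *\<^sub>R w)) ` {0..1} \<subseteq> U" using seg by auto
  ultimately obtain \<eta> where \<eta>: "0 < \<eta>" 
    "\<And>t z. 0 \<le> t \<Longrightarrow> t \<le> 1 \<Longrightarrow> dist (join x (a + t *\<^sub>R w)) z \<le> \<eta> \<Longrightarrow> z \<in> U"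
    by (rule compact_neighbourhood[OF _ U]) force+
  \<comment> \<open>Affine parameter of the orthogonal projection of the fibre component to the
    line; it runs from 0 to 1 along the segment.\<close>
  define T where "T z = (sndv z - a) \<bullet> w / (w \<bullet> w)" for z :: "real^('n + 'm)"
  define q where "q z = (norm (fstv z - x))\<^sup>2 + (norm (sndv z - a - T z *\<^sub>R w))\<^sup>2" for z
  define b where "b z = e * (T z)\<^sup>2" for z
  have Tp: "real_polynomial_function T"
  proof -
    have "T = (\<lambda>z. \<Sum>j\<in>UNIV. (z $ Inr j - a $ j) * (w $ j / (w \<bullet> w)))"
    proof
      fix z :: "real^('n + 'm)"
      have "(sndv z - a) \<bullet> w = (\<Sum>j\<in>UNIV. (z $ Inr j - a $ j) * w $ j)" by (simp add: inner_vec_def)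
      then show "T z = (\<Sum>j\<in>UNIV. (z $ Inr j - a $ j) * (w $ j / (w \<bullet> w)))"
        by (simp add: T_def sum_divide_distrib)
    qed
    moreover have "real_polynomial_function \<dots>"
      by (intro real_polynomial_function_sum real_polynomial_function.intros(2,4) 
          real_polynomial_function_diff real_polynomial_function_nth) auto
    ultimately show ?thesis by simp
  qed
  have qp: "real_polynomial_function q"
  proof -
    have "q = (\<lambda>z. (\<Sum>i\<in>UNIV. (z $ Inl i - x $ i)\<^sup>2) + (\<Sum>j\<in>UNIV. (z $ Inr j - a $ j - T z * w $ j)\<^sup>2))"
      by (simp add: q_def norm_sq_vec fun_eq_iff)
    moreover have "real_polynomial_function \<dots>"
      by (intro real_polynomial_function_sum real_polynomial_function.intros(2-4) real_polynomial_function_power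
          real_polynomial_function_diff real_polynomial_function_nth Tp) auto
    ultimately show ?thesis by simp
  qed
  have bp: "real_polynomial_function b"
    unfolding b_def by (intro real_polynomial_function.intros(2,4) real_polynomial_function_power Tp)
  have contT: "continuous_on A T" and contq: "continuous_on A q" for A
    using Tp qp continuous_real_polymonial_function by (blast intro: continuous_at_imp_continuous_on)+
  have T_seg: "T (join x (a + t *\<^sub>R w)) = t" and q_seg: "q (join x (a + t *\<^sub>R w)) = 0" for t
    using ww by (simp_all add: T_def q_def)
  define N where "N = {z. 0 \<le> T z \<and> T z \<le> 1 \<and> q z \<le> \<eta>\<^sup>2}"
  define W where "W = {z. 0 < T z \<and> T z < 1 \<and> q z < \<eta>\<^sup>2}"
  have dist_le: "dist (join x (a + T z *\<^sub>R w)) z \<le> \<eta>" if "q z \<le> \<eta>\<^sup>2" for z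
  proof -
    have "(dist (join x (a + T z *\<^sub>R w)) z)\<^sup>2 = (norm (join (fstv z - x) (sndv z - a - T z *\<^sub>R w)))\<^sup>2"
    proof -
      have "z - join x (a + T z *\<^sub>R w) = join (fstv z - x) (sndv z - a - T z *\<^sub>R w)"
        by (simp add: vec_sum_eq_iff)
      then show ?thesis by (simp add: dist_norm norm_minus_commute)
    qed
    also have "\<dots> = q z" by (simp add: norm_join_sq q_def)
    finally have "(dist (join x (a + T z *\<^sub>R w)) z)\<^sup>2 \<le> \<eta>\<^sup>2" using that by simp
    then show ?thesis by (rule power2_le_imp_le) (use \<eta>(1) in simp)
  qed
  have NU: "N \<subseteq> U" using \<eta>(2) dist_le by (auto simp: N_def)
  have "closed N" unfolding N_def
    by (intro closed_Collect_conj closed_Collect_le continuous_on_const contT contq)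
  moreover have "bounded N"
  proof -
    have "bounded ((\<lambda>t. join x (a + t *\<^sub>R w)) ` {0..1})"
      by (intro compact_imp_bounded compact_continuous_image continuous_intros) auto
    then obtain R where R: "\<And>t. 0 \<le> t \<Longrightarrow> t \<le> 1 \<Longrightarrow> norm (join x (a + t *\<^sub>R w)) \<le> R"
      unfolding bounded_iff by force
    have "norm z \<le> R + \<eta>" if "z \<in> N" for z
      using R[of "T z"] dist_le[of z] that norm_triangle_ineq2[of z "join x (a + T z *\<^sub>R w)"]
      by (auto simp: N_def dist_norm norm_minus_commute)
    then show ?thesis unfolding bounded_iff by blast
  qed
  ultimately have cN: "compact N" using compact_eq_bounded_closed by blast
  have oW: "open W" unfolding W_def
    by (intro open_Collect_conj open_Collect_less continuous_on_const contT contq)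
  have WN: "W \<subseteq> N" by (auto simp: W_def N_def)
  have bdry: "\<rho> z \<le> ereal (e - b z)" if "z \<in> N - W" "q z = 0" for z
  proof -
    have "T z = 0 \<or> T z = 1" using that \<eta>(1) by (auto simp: N_def W_def)
    moreover have "z = join x (a + T z *\<^sub>R w)"
    proof -
      have "fstv z = x" "sndv z = a + T z *\<^sub>R w"
        using that(2) by (simp_all add: q_def add_nonneg_eq_0_iff algebra_simps)
      then show ?thesis by (metis join_fstv_sndv)
    qed
    ultimately have "\<rho> z \<le> 0" "(T z)\<^sup>2 \<le> 1" using ends by auto
    moreover have "e * (T z)\<^sup>2 \<le> e * 1" using \<open>(T z)\<^sup>2 \<le> 1\<close> e(1) by (intro mult_left_mono) auto
    ultimately show ?thesis by (auto simp: b_def intro: order_trans)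
  qed
  have z1: "join x (a + t1 *\<^sub>R w) \<in> N" "q (join x (a + t1 *\<^sub>R w)) = 0" 
    using t1 by (simp_all add: N_def T_seg q_seg)
  have lt: "ereal (e - b (join x (a + t1 *\<^sub>R w))) < \<rho> (join x (a + t1 *\<^sub>R w))"
    using e by (intro le_less_trans[OF _ e(2)]) (auto simp: b_def)
  have q0: "0 \<le> q z" for z by (simp add: q_def)
  obtain c k z where z: "z \<in> W" "hess (\<lambda>z. c + k * q z - b z) z \<in> star_psd F"
    by (rule penalized_test_function[OF sub cN NU oW WN qp q0 bp bdry z1 lt])
  define g where "g = (\<lambda>z. c + k * q z - b z)"
  have gp: "real_polynomial_function g" unfolding g_def
    by (intro real_polynomial_function_diff real_polynomial_function.intros(2-4) qp bp)
  have "0 \<le> w \<bullet> (lower_block (hess g z) *v w)"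
    using z(2) by (simp add: star_psd_def psd_mats_def g_def)
  also have "\<dots> = join 0 w \<bullet> (hess g z *v join 0 w)" by (rule inner_lower_block)
  \<comment> \<open>A step along \<open>w\<close> shifts \<open>T\<close> and leaves
    \<open>q\<close> unchanged, so whatever the size of \<open>k\<close>, only \<open>b\<close>
    contributes.\<close>
  also have "\<dots> = - (2 * e)"
  proof (rule second_derivative_unique[OF twice_diff_real_polynomial_function[OF gp]])
    have sh: "fstv (z + s *\<^sub>R join 0 w) = fstv z" "sndv (z + s *\<^sub>R join 0 w) = sndv z + s *\<^sub>R w" for s
      by (simp_all add: vec_eq_iff)
    have Ts: "T (z + s *\<^sub>R join 0 w) = T z + s" for s
      using ww by (simp add: T_def sh inner_diff_left inner_add_left add_divide_distrib diff_divide_distrib)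
    have "g (z + s *\<^sub>R join 0 w) = c + k * q z - e * (T z + s)\<^sup>2" for s
      by (simp add: g_def b_def Ts) (simp add: q_def Ts, simp add: sh algebra_simps)
    then show "((\<lambda>s. g (z + s *\<^sub>R join 0 w)) has_real_derivative - (e * (2 * (T z + s)))) (at s)" for s
      by (auto intro!: derivative_eq_intros)
    show "((\<lambda>s. - (e * (2 * (T z + s)))) has_real_derivative - (2 * e)) (at 0)"
      by (auto intro!: derivative_eq_intros)
  qed
  finally show False using e by simp
qed

text \<open>At the penalized maximum neither \<open>k\<close> nor the offset \<open>s\<close> from
  the graph is controlled. Pulling back by the derivative \<open>\<Gamma>\<close> of
  \<open>\<gamma>\<close> removes the squared first-order terms of \<open>q\<close>; what remains of
  the penalty is a combination of the Hessians of the components of \<open>\<gamma>\<close>, and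
  pairing with \<open>E\<close> kills it because these are harmonic. Only
  \<open>- 2 * e * (E \<bullet> mat 1)\<close> survives, which contradicts membership of the
  pullback in \<open>F\<close>.\<close>

lemma subharmonic_star_psd_graph:
  fixes \<rho> :: "real^('n::finite + 'm::finite) \<Rightarrow> ereal" and \<gamma> :: "real^'n \<Rightarrow> real^'m"
  assumes sub: "subharmonic (star_psd F) U \<rho>" and U: "open U"
    and E: "\<And>A. A \<in> F \<Longrightarrow> 0 \<le> E \<bullet> A" and EI: "0 < E \<bullet> mat 1"
    and \<gamma>: "\<And>j. real_polynomial_function (\<lambda>x. \<gamma> x $ j)" "\<And>j x. E \<bullet> hess (\<lambda>x. \<gamma> x $ j) x = 0"
    and r: "0 < r"
    and graph: "\<And>x. x \<in> cball x0 r \<Longrightarrow> join x (\<gamma> x) \<in> U"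
    and sph: "\<And>x. x \<in> sphere x0 r \<Longrightarrow> \<rho> (join x (\<gamma> x)) \<le> 0"
    and x1: "x1 \<in> cball x0 r"
  shows "\<rho> (join x1 (\<gamma> x1)) \<le> 0"
proof (rule ccontr)
  assume "\<not> ?thesis"
  then obtain e0 where e0: "0 < e0" "ereal e0 < \<rho> (join x1 (\<gamma> x1))"
    using ereal_pos_real by (meson not_le)
  \<comment> \<open>Scaled so that \<open>b\<close> equals \<open>e0\<close> on the sphere, where
    the bound required of \<open>\<rho>\<close> becomes exactly 0.\<close>
  define e where "e = e0 / r\<^sup>2"
  have e: "0 < e" "e0 = e * r\<^sup>2" using e0 r by (simp_all add: e_def)
  have cont\<gamma>: "continuous_on A \<gamma>" for A
  proof -
    have "continuous_on A (\<lambda>x. \<chi> j. \<gamma> x $ j)"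
      using \<gamma>(1) continuous_real_polymonial_function
      by (intro continuous_on_vec_lambda) (blast intro: continuous_at_imp_continuous_on)
    then show ?thesis by simp
  qed
  have cgraph: "compact ((\<lambda>x. join x (\<gamma> x)) ` cball x0 r)"
    by (intro compact_continuous_image continuous_intros cont\<gamma> compact_cball)
  moreover have "(\<lambda>x. join x (\<gamma> x)) ` cball x0 r \<subseteq> U" using graph by auto
  ultimately obtain \<eta> where \<eta>: "0 < \<eta>" 
    "\<And>x z. x \<in> cball x0 r \<Longrightarrow> dist (join x (\<gamma> x)) z \<le> \<eta> \<Longrightarrow> z \<in> U"
    by (rule compact_neighbourhood[OF _ U]) blast+
  define q where "q z = (norm (sndv z - \<gamma> (fstv z)))\<^sup>2" for z :: "real^('n + 'm)"
  define b where "b z = e * (norm (fstv z - x0))\<^sup>2" for z :: "real^('n + 'm)"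
  have qeq: "q = (\<lambda>z. \<Sum>j\<in>UNIV. (z $ Inr j - \<gamma> (fstv z) $ j)\<^sup>2)"
    by (simp add: q_def norm_sq_vec fun_eq_iff)
  have qp: "real_polynomial_function q"
    unfolding qeq
    by (intro real_polynomial_function_sum real_polynomial_function_power
        real_polynomial_function_diff real_polynomial_function_nth real_polynomial_function_fstv[OF \<gamma>(1)]) auto
  have bp: "real_polynomial_function b"
    unfolding b_def by (intro real_polynomial_function.intros(2,4) real_polynomial_function_fstv real_polynomial_function_norm_sq)
  have contq: "continuous_on A q" for A
    using qp continuous_real_polymonial_function by (blast intro: continuous_at_imp_continuous_on)
  define N where "N = {z. dist x0 (fstv z) \<le> r \<and> q z \<le> \<eta>\<^sup>2}"
  define W where "W = {z. dist x0 (fstv z) < r \<and> q z < \<eta>\<^sup>2}"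
  have dist_le: "dist (join (fstv z) (\<gamma> (fstv z))) z \<le> \<eta>" if "q z \<le> \<eta>\<^sup>2" for z
  proof -
    have "(dist (join (fstv z) (\<gamma> (fstv z))) z)\<^sup>2 = (norm (join (fstv z - fstv z) (sndv z - \<gamma> (fstv z))))\<^sup>2"
    proof -
      have "z - join (fstv z) (\<gamma> (fstv z)) = join (fstv z - fstv z) (sndv z - \<gamma> (fstv z))"
        by (simp add: vec_sum_eq_iff)
      then show ?thesis by (simp add: dist_norm norm_minus_commute)
    qed
    also have "\<dots> = q z" by (simp add: norm_join_sq q_def)
    finally have "(dist (join (fstv z) (\<gamma> (fstv z))) z)\<^sup>2 \<le> \<eta>\<^sup>2" using that by simp
    then show ?thesis by (rule power2_le_imp_le) (use \<eta>(1) in simp)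
  qed
  have NU: "N \<subseteq> U" using \<eta>(2) dist_le by (auto simp: N_def)
  have contd: "continuous_on A (\<lambda>z. dist x0 (fstv z))" for A by (intro continuous_intros)
  have "closed N" unfolding N_def
    by (intro closed_Collect_conj closed_Collect_le continuous_on_const contd contq)
  moreover have "bounded N"
  proof -
    obtain R where R: "\<And>x. x \<in> cball x0 r \<Longrightarrow> norm (join x (\<gamma> x)) \<le> R"
      using compact_imp_bounded[OF cgraph] unfolding bounded_iff by force
    have "norm z \<le> R + \<eta>" if "z \<in> N" for z
      using R[of "fstv z"] dist_le[of z] that norm_triangle_ineq2[of z "join (fstv z) (\<gamma> (fstv z))"]
      by (auto simp: N_def dist_norm norm_minus_commute)
    then show ?thesis unfolding bounded_iff by blast
  qed
  ultimately have cN: "compact N" using compact_eq_bounded_closed by blast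
  have oW: "open W" unfolding W_def
    by (intro open_Collect_conj open_Collect_less continuous_on_const contd contq)
  have WN: "W \<subseteq> N" by (auto simp: W_def N_def)
  have bdry: "\<rho> z \<le> ereal (e0 - b z)" if "z \<in> N - W" "q z = 0" for z
  proof -
    have zs: "dist x0 (fstv z) = r" using that \<eta>(1) by (auto simp: N_def W_def)
    have "z = join (fstv z) (\<gamma> (fstv z))"
      using that(2) by (simp add: q_def) (metis join_fstv_sndv)
    moreover have "\<rho> (join (fstv z) (\<gamma> (fstv z))) \<le> 0" using zs by (intro sph) simp
    ultimately have "\<rho> z \<le> 0" by simp
    moreover have "e0 - b z = 0" using zs by (simp add: b_def e(2) dist_norm norm_minus_commute)
    ultimately show ?thesis by (simp add: zero_ereal_def)
  qed
  have z1: "join x1 (\<gamma> x1) \<in> N" "q (join x1 (\<gamma> x1)) = 0" 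
    using x1 by (simp_all add: N_def q_def)
  have lt: "ereal (e0 - b (join x1 (\<gamma> x1))) < \<rho> (join x1 (\<gamma> x1))"
    using e by (intro le_less_trans[OF _ e0(2)]) (auto simp: b_def)
  have q0: "0 \<le> q z" for z by (simp add: q_def)
  obtain c k z where z: "z \<in> W" "hess (\<lambda>z. c + k * q z - b z) z \<in> star_psd F"
    by (rule penalized_test_function[OF sub cN NU oW WN qp q0 bp bdry z1 lt])
  define g where "g = (\<lambda>z. c + k * q z - b z)"
  have gp: "real_polynomial_function g" unfolding g_def
    by (intro real_polynomial_function_diff real_polynomial_function.intros(2-4) qp bp)
  define x where "x = fstv z"
  define s where "s = sndv z - \<gamma> x"
  define H where "H j = hess (\<lambda>x. \<gamma> x $ j) x" for j
  define D where "D j i = partial_deriv i (\<lambda>x. \<gamma> x $ j)" for i j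
  define \<Gamma> :: "real^'n^'m" where "\<Gamma> = (\<chi> j i. D j i x)"
  define M where "M = (- 2 * e) *\<^sub>R mat 1 - (\<Sum>j\<in>UNIV. (2 * k * s $ j) *\<^sub>R H j)"
  have Hsym: "H j \<in> sym_mats" for j
    unfolding H_def by (intro hess_symmetric twice_diff_real_polynomial_function \<gamma>(1))
  have "pullback \<Gamma> (hess g z) = M"
  proof (rule sym_mats_eqI)
    show "pullback \<Gamma> (hess g z) \<in> sym_mats"
      by (intro pullback_sym hess_symmetric twice_diff_real_polynomial_function gp)
    have "H j $ i $ l = H j $ l $ i" for j i l
      using Hsym[of j] by (simp add: sym_mats_def transpose_def vec_eq_iff)
    then show "M \<in> sym_mats" by (simp add: M_def sym_mats_def transpose_def vec_eq_iff mat_def sum_component)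
    fix v :: "real^'n"
    define u where "u = join v (\<Gamma> *v v)"
    define G where "G j t = (\<Sum>i\<in>UNIV. v $ i * D j i (x + t *\<^sub>R v))" for j t
    have G: "((\<lambda>t. \<gamma> (x + t *\<^sub>R v) $ j) has_real_derivative G j t) (at t)" for j t
      unfolding G_def D_def
      by (rule has_derivative_along_line) (intro differentiable_at_real_polynomial_function \<gamma>(1))
    have G': "(G j has_real_derivative v \<bullet> (H j *v v)) (at 0)" for j
      unfolding G_def[abs_def] D_def H_def
      by (rule second_derivative_along_line) (intro twice_diff_real_polynomial_function \<gamma>(1))
    have G0: "G j 0 = (\<Gamma> *v v) $ j" for j
      by (simp add: G_def \<Gamma>_def matrix_vector_mult_def mult.commute)
    have "v \<bullet> (pullback \<Gamma> (hess g z) *v v) = u \<bullet> (hess g z *v u)" by (simp add: inner_pullback u_def)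
    also have "\<dots> = (\<Sum>j\<in>UNIV. - (2 * k * s $ j) * (v \<bullet> (H j *v v))) - 2 * e * (v \<bullet> v)"
    proof (rule second_derivative_unique[OF twice_diff_real_polynomial_function[OF gp]])
      have sh: "fstv (z + t *\<^sub>R u) = x + t *\<^sub>R v" for t
        by (simp add: x_def u_def vec_eq_iff)
      \<comment> \<open>The \<open>j\<close>-th offset from the graph along \<open>u\<close>. Its
        derivative at 0 vanishes by the choice of \<open>\<Gamma>\<close>, so the second derivative
        of its square at 0 is twice its value times its second derivative.\<close>
      define f where "f j t = sndv z $ j + t * (\<Gamma> *v v) $ j - \<gamma> (x + t *\<^sub>R v) $ j" for j t
      have bsh: "(norm (x + t *\<^sub>R v - x0))\<^sup>2 = (x - x0) \<bullet> (x - x0) + t * (2 * ((x - x0) \<bullet> v)) + t\<^sup>2 * (v \<bullet> v)" for t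
        unfolding power2_norm_eq_inner
        by (simp add: inner_simps inner_commute power2_eq_square algebra_simps)
      have geq: "g (z + t *\<^sub>R u) = c + k * (\<Sum>j\<in>UNIV. (f j t)\<^sup>2) 
         - e * ((x - x0) \<bullet> (x - x0) + t * (2 * ((x - x0) \<bullet> v)) + t\<^sup>2 * (v \<bullet> v))" for t
        unfolding bsh[symmetric] by (simp add: g_def qeq b_def sh f_def) (simp add: u_def)
      have fd: "(f j has_real_derivative (\<Gamma> *v v) $ j - G j t) (at t)" for j t
        unfolding f_def[abs_def] by (auto intro!: derivative_eq_intros G)
      show "((\<lambda>t. g (z + t *\<^sub>R u)) has_real_derivative
         k * (\<Sum>j\<in>UNIV. 2 * (f j t * ((\<Gamma> *v v) $ j - G j t))) - e * (2 * ((x - x0) \<bullet> v) + t * (2 * (v \<bullet> v)))) (at t)" for t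
      proof -
        have "((\<lambda>t. (f j t)\<^sup>2) has_real_derivative 2 * (f j t * ((\<Gamma> *v v) $ j - G j t))) (at t)" for j
          by (auto intro!: derivative_eq_intros fd)
        then have ds: "((\<lambda>t. \<Sum>j\<in>UNIV. (f j t)\<^sup>2) has_real_derivative (\<Sum>j\<in>UNIV. 2 * (f j t * ((\<Gamma> *v v) $ j - G j t)))) (at t)"
          by (intro DERIV_sum)
        have dp: "((\<lambda>t. (x - x0) \<bullet> (x - x0) + t * (2 * ((x - x0) \<bullet> v)) + t\<^sup>2 * (v \<bullet> v)) has_real_derivative
            2 * ((x - x0) \<bullet> v) + t * (2 * (v \<bullet> v))) (at t)"
          by (auto intro!: derivative_eq_intros)
        show ?thesis unfolding geq
          by (rule DERIV_cong[OF DERIV_diff[OF DERIV_add[OF DERIV_const DERIV_cmult[OF ds]] DERIV_cmult[OF dp]]]) simp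
      qed
      have "f j 0 = s $ j" for j by (simp add: f_def s_def)
      then show "((\<lambda>t. k * (\<Sum>j\<in>UNIV. 2 * (f j t * ((\<Gamma> *v v) $ j - G j t))) - e * (2 * ((x - x0) \<bullet> v) + t * (2 * (v \<bullet> v))))
        has_real_derivative (\<Sum>j\<in>UNIV. - (2 * k * s $ j) * (v \<bullet> (H j *v v))) - 2 * e * (v \<bullet> v)) (at 0)"
        by (auto intro!: derivative_eq_intros fd G' sum.cong simp: G0 sum_distrib_left)
    qed
    also have "\<dots> = v \<bullet> (M *v v)"
    proof -
      have "(\<Sum>j\<in>S. A j) *v v = (\<Sum>j\<in>S. A j *v v)" for S and A :: "'m \<Rightarrow> real^'n^'n"
        by (induction S rule: infinite_finite_induct) (auto simp: matrix_vector_mult_add_rdistrib)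
      then have "M *v v = (- 2 * e) *\<^sub>R v - (\<Sum>j\<in>UNIV. (2 * k * s $ j) *\<^sub>R (H j *v v))"
        by (simp only: M_def matrix_vector_mult_diff_rdistrib scaleR_matrix_vector_assoc[symmetric] matrix_vector_mul_lid)
      then show ?thesis by (simp add: inner_diff_right inner_sum_right sum_negf)
    qed
    finally show "v \<bullet> (pullback \<Gamma> (hess g z) *v v) = v \<bullet> (M *v v)" .
  qed
  moreover have "E \<bullet> M = - 2 * e * (E \<bullet> mat 1)"
    using \<gamma>(2) by (simp add: M_def inner_diff_right inner_sum_right H_def)
  moreover have "0 \<le> E \<bullet> pullback \<Gamma> (hess g z)"
    using z(2) by (intro E) (simp add: star_psd_def g_def)
  ultimately show False using mult_pos_pos[OF e(1) EI] by simp
qed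

section \<open>Convex fibres\<close>

text \<open>For fixed \<open>a\<close>, the points whose segment from \<open>a\<close> stays in the
  fibre form a closed set, and also a relatively open one: segments close to one inside
  \<open>K\<close> stay in \<open>U\<close>, where the segment lemma applies. Connectedness makes
  this set the whole fibre.\<close>

lemma convex_slice:
  fixes \<rho> :: "real^('n::finite + 'm::finite) \<Rightarrow> ereal"
  assumes sub: "subharmonic (star_psd F) U \<rho>" and U: "open U" and K: "K = {z \<in> U. \<rho> z \<le> 0}"
    and cl: "closed (slice K x)" and conn: "connected (slice K x)"
  shows "convex (slice K x)"
proof -
  define S where "S = slice K x"
  have seg: "a + t *\<^sub>R (b - a) \<in> S" if a: "a \<in> S" and b: "b \<in> S" and t: "0 \<le> t" "t \<le> 1" for a b t
  proof -
    define A where "A = {b \<in> S. \<forall>t\<in>{0..1}. a + t *\<^sub>R (b - a) \<in> S}"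
    have "closedin (top_of_set S) A"
    proof -
      have "A = S \<inter> (\<Inter>t\<in>{0..1}. (\<lambda>b. a + t *\<^sub>R (b - a)) -` S)" by (auto simp: A_def)
      moreover have "closed ((\<lambda>b. a + t *\<^sub>R (b - a)) -` S)" for t
        using cl by (intro closed_vimage continuous_intros) (simp add: S_def)
      ultimately have "closed A" using cl by (auto simp: S_def intro!: closed_Int closed_INT)
      then show ?thesis by (rule closed_subset[rotated]) (auto simp: A_def)
    qed
    moreover have "openin (top_of_set S) A"
      unfolding openin_euclidean_subtopology_iff
    proof (intro conjI ballI)
      show "A \<subseteq> S" by (auto simp: A_def)
      fix b0 assume b0: "b0 \<in> A"
      have "compact ((\<lambda>t. join x (a + t *\<^sub>R (b0 - a))) ` {0..1})"
        by (intro compact_continuous_image continuous_intros) auto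
      moreover have "(\<lambda>t. join x (a + t *\<^sub>R (b0 - a))) ` {0..1} \<subseteq> U"
        using b0 by (auto simp: A_def S_def slice_def K)
      ultimately obtain \<eta> where \<eta>: "0 < \<eta>" 
        "\<And>y z. y \<in> (\<lambda>t. join x (a + t *\<^sub>R (b0 - a))) ` {0..1} \<Longrightarrow> dist y z \<le> \<eta> \<Longrightarrow> z \<in> U"
        by (rule compact_neighbourhood[OF _ U]) (rule that)
      have "b' \<in> A" if b': "b' \<in> S" "dist b' b0 < \<eta>" for b'
      proof -
        have inU: "join x (a + t *\<^sub>R (b' - a)) \<in> U" if "0 \<le> t" "t \<le> 1" for t
        proof (rule \<eta>(2))
          show "join x (a + t *\<^sub>R (b0 - a)) \<in> (\<lambda>t. join x (a + t *\<^sub>R (b0 - a))) ` {0..1}" using that by auto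
          have "join x (a + t *\<^sub>R (b0 - a)) - join x (a + t *\<^sub>R (b' - a)) = join 0 (t *\<^sub>R (b0 - b'))"
            by (simp add: join_diff algebra_simps)
          then have "dist (join x (a + t *\<^sub>R (b0 - a))) (join x (a + t *\<^sub>R (b' - a))) \<le> t * norm (b0 - b')"
            using norm_join_le[of "0 :: real^'n" "t *\<^sub>R (b0 - b')"] that by (simp add: dist_norm)
          also have "\<dots> \<le> 1 * norm (b0 - b')" using that by (intro mult_right_mono) auto
          finally show "dist (join x (a + t *\<^sub>R (b0 - a))) (join x (a + t *\<^sub>R (b' - a))) \<le> \<eta>"
            using b'(2) by (simp add: dist_norm norm_minus_commute)
        qed
        have "\<rho> (join x a) \<le> 0" "\<rho> (join x (a + (b' - a))) \<le> 0"
          using a b'(1) by (simp_all add: S_def slice_def K)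
        from subharmonic_star_psd_segment[OF sub U inU this]
        show ?thesis using b'(1) inU by (auto simp: A_def S_def slice_def K)
      qed
      then show "\<exists>e>0. \<forall>x'\<in>S. dist x' b0 < e \<longrightarrow> x' \<in> A" using \<eta>(1) by blast
    qed
    ultimately have "A = {} \<or> A = S"
      using conn unfolding connected_clopen S_def by blast
    moreover have "a \<in> A" using a by (auto simp: A_def)
    ultimately have "b \<in> A" using b by auto
    then show ?thesis using t by (simp add: A_def)
  qed
  show ?thesis
    unfolding convex_alt S_def[symmetric]
  proof (intro ballI allI impI)
    fix a b :: "real^'m" and u :: real assume "a \<in> S" "b \<in> S" "0 \<le> u \<and> u \<le> 1"
    then show "(1 - u) *\<^sub>R a + u *\<^sub>R b \<in> S" using seg[of a b u] by (simp add: algebra_simps)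
  qed
qed

text \<open>\<open>K\<close> is closed only relative to the cylinder over \<open>X\<close>, so
  \<open>closed_over\<close> records what this gives in the full space: closedness over closed
  subsets of \<open>X\<close>.\<close>

locale convex_fibres =
  fixes X :: "(real^'n) set" and K :: "(real^('n::finite + 'm::finite)) set"
  assumes open_base: "open X" and bounded_total: "bounded K"
    and closed_over: "\<And>S. closed S \<Longrightarrow> S \<subseteq> X \<Longrightarrow> closed {z \<in> K. fstv z \<in> S}"
    and interior_fibre: "\<And>x. x \<in> X \<Longrightarrow> slice (interior K) x = interior (slice K x)"
    and interior_fibre_nonempty: "\<And>x. x \<in> X \<Longrightarrow> interior (slice K x) \<noteq> {}"
    and convex_fibre: "\<And>x. x \<in> X \<Longrightarrow> convex (slice K x)"
begin

section \<open>Compactness, selections and volume of the fibres\<close>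

lemma compact_over: "compact S \<Longrightarrow> S \<subseteq> X \<Longrightarrow> compact {z \<in> K. fstv z \<in> S}"
  using closed_over bounded_total by (auto simp: compact_eq_bounded_closed intro: bounded_subset)

lemma compact_fibre:
  assumes "x \<in> X" shows "compact (slice K x)"
proof -
  have "slice K x = sndv ` {z \<in> K. fstv z \<in> {x}}"
  proof safe
    fix y assume "y \<in> slice K x"
    then show "y \<in> sndv ` {z \<in> K. fstv z \<in> {x}}"
      by (intro image_eqI[of _ _ "join x y"]) (auto simp: slice_def)
  next
    fix z assume "z \<in> K" "x = fstv z"
    then show "sndv z \<in> slice K (fstv z)" by (simp add: slice_def)
  qed
  then show ?thesis
    using compact_over[of "{x}"] assms
    by (auto intro!: compact_continuous_image continuous_intros)
qed

lemma fibre_lmeasurable: "x \<in> X \<Longrightarrow> slice K x \<in> lmeasurable"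
  by (simp add: compact_fibre lmeasurable_compact)

lemma measure_interior_fibre:
  assumes "x \<in> X"
  shows "measure lebesgue (interior (slice K x)) = measure lebesgue (slice K x)"
  using assms compact_fibre compact_imp_bounded convex_fibre
  by (intro measure_interior negligible_convex_frontier) auto

lemma measure_fibre_pos:
  assumes "x \<in> X"
  shows "0 < measure lebesgue (slice K x)"
  using measure_open_pos[of "interior (slice K x)"] assms compact_fibre[OF assms] interior_fibre_nonempty[OF assms]
  by (simp add: measure_interior_fibre compact_imp_bounded bounded_interior del: measure_completion)

lemma fibre_bound:
  obtains R where "\<And>x y. y \<in> slice K x \<Longrightarrow> norm y \<le> R"
proof -
  obtain R where "\<And>z. z \<in> K \<Longrightarrow> norm z \<le> R" using bounded_total bounded_iff by blast
  then have "norm y \<le> R" if "y \<in> slice K x" for x y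
    using that norm_le_norm_join(2)[of y x] by (force simp: slice_def)
  then show ?thesis by (rule that)
qed

text \<open>Upper semicontinuity of the fibres: over a closed ball the points of \<open>K\<close>
  that violate the bound form a compact set, whose projection is closed and misses
  \<open>x\<close>.\<close>

lemma fibre_upper_bound_open:
  assumes x: "x \<in> X" and less: "\<And>y. y \<in> slice K x \<Longrightarrow> \<xi> \<bullet> y < c"
  obtains O' where "open O'" "x \<in> O'" "O' \<subseteq> X" "\<And>x' y. x' \<in> O' \<Longrightarrow> y \<in> slice K x' \<Longrightarrow> \<xi> \<bullet> y < c"
proof -
  obtain r where r: "0 < r" "cball x r \<subseteq> X"
    using open_base x open_contains_cball by blast
  define P where "P = {z \<in> K. fstv z \<in> cball x r} \<inter> {z. c \<le> \<xi> \<bullet> sndv z}"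
  have "closed {z. c \<le> \<xi> \<bullet> sndv z}"
    by (intro closed_Collect_le continuous_intros)
  then have "compact P" unfolding P_def
    using compact_over[OF compact_cball r(2)] by (intro compact_Int_closed)
  then have "compact (fstv ` P)" by (intro compact_continuous_image continuous_intros)
  then have "closed (fstv ` P)" by (rule compact_imp_closed)
  show ?thesis
  proof
    show "open (ball x r - fstv ` P)" using \<open>closed (fstv ` P)\<close> by (intro open_Diff) auto
    have "fstv z \<noteq> x" if "z \<in> P" for z
    proof
      assume "fstv z = x"
      then have "sndv z \<in> slice K x" using that join_fstv_sndv[of z] by (auto simp: P_def slice_def)
      then show False using less[of "sndv z"] that by (simp add: P_def)
    qed
    then show "x \<in> ball x r - fstv ` P" using r by auto
    show "ball x r - fstv ` P \<subseteq> X" using r(2) by auto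
    show "\<xi> \<bullet> y < c" if "x' \<in> ball x r - fstv ` P" "y \<in> slice K x'" for x' y
    proof (rule ccontr)
      assume "\<not> \<xi> \<bullet> y < c"
      then have "join x' y \<in> P" using that by (simp add: P_def slice_def)
      then show False using that(1) by (metis DiffD2 fstv_join imageI)
    qed
  qed
qed

text \<open>A near-maximizer of \<open>\<xi>\<close> can be moved into the interior of the convex
  fibre. By \<open>interior_fibre\<close> it is then interior to \<open>K\<close> itself, so the
  same constant \<open>y\<close> works for all nearby base points.\<close>

lemma local_selection:
  assumes x: "x \<in> X" and \<delta>: "0 < \<delta>"
  shows "\<exists>O' y. open O' \<and> x \<in> O' \<and> O' \<subseteq> X \<and>
    (\<forall>x'\<in>O'. join x' y \<in> interior K \<and> (\<forall>y'\<in>slice K x'. \<xi> \<bullet> y' \<le> \<xi> \<bullet> y + \<delta>))"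
proof -
  have ne: "slice K x \<noteq> {}" using interior_fibre_nonempty[OF x] interior_subset by blast
  have "continuous_on (slice K x) (\<lambda>y. \<xi> \<bullet> y)" by (intro continuous_intros)
  from continuous_attains_sup[OF compact_fibre[OF x] ne this]
  obtain y0 where y0: "y0 \<in> slice K x" "\<And>y. y \<in> slice K x \<Longrightarrow> \<xi> \<bullet> y \<le> \<xi> \<bullet> y0"
    by blast
  have "y0 \<in> closure (interior (slice K x))"
    using convex_closure_interior[OF convex_fibre[OF x] interior_fibre_nonempty[OF x]] y0(1) closure_subset by blast
  moreover have "open {y. \<xi> \<bullet> y0 - \<delta> / 2 < \<xi> \<bullet> y}"
    by (intro open_Collect_less continuous_intros)
  moreover have "y0 \<in> {y. \<xi> \<bullet> y0 - \<delta> / 2 < \<xi> \<bullet> y}" using \<delta> by simp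
  ultimately have "{y. \<xi> \<bullet> y0 - \<delta> / 2 < \<xi> \<bullet> y} \<inter> interior (slice K x) \<noteq> {}"
    using open_Int_closure_eq_empty[of "{y. \<xi> \<bullet> y0 - \<delta> / 2 < \<xi> \<bullet> y}" "interior (slice K x)"] by blast
  then obtain y where y: "y \<in> interior (slice K x)" "\<xi> \<bullet> y0 - \<delta> / 2 < \<xi> \<bullet> y" by blast
  have "\<xi> \<bullet> y < \<xi> \<bullet> y0 + \<delta> / 2" if "y \<in> slice K x" for y
    using y0(2)[OF that] \<delta> by simp
  note upper = fibre_upper_bound_open[OF x this]
  obtain O' where O': "open O'" "x \<in> O'" "O' \<subseteq> X" "\<And>x' y. x' \<in> O' \<Longrightarrow> y \<in> slice K x' \<Longrightarrow> \<xi> \<bullet> y < \<xi> \<bullet> y0 + \<delta> / 2"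
    by (rule upper, assumption, rule that)
  define O2 where "O2 = O' \<inter> (\<lambda>x'. join x' y) -` interior K"
  have "open O2" unfolding O2_def
    using O'(1) by (intro open_Int open_vimage open_interior continuous_intros)
  moreover have "x \<in> O2" using O'(2) y(1) interior_fibre[OF x] by (auto simp: O2_def slice_def)
  moreover have "join x' y \<in> interior K \<and> (\<forall>y'\<in>slice K x'. \<xi> \<bullet> y' \<le> \<xi> \<bullet> y + \<delta>)" if "x' \<in> O2" for x'
    using that O'(4)[of x'] y(2) by (force simp: O2_def)
  moreover have "O2 \<subseteq> X" using O'(3) by (auto simp: O2_def)
  ultimately show ?thesis by blast
qed

text \<open>Local constant selections are glued by a partition of unity, which convexity of the
  fibres permits. The result lies in the interior of \<open>K\<close>, and this leaves a margin for
  Stone-Weierstrass approximation.\<close>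

lemma polynomial_selection:
  assumes S: "compact S" "S \<subseteq> X" and \<delta>: "0 < \<delta>"
  obtains p where "polynomial_function p" "\<And>x. x \<in> S \<Longrightarrow> join x (p x) \<in> interior K"
    "\<And>x y. x \<in> S \<Longrightarrow> y \<in> slice K x \<Longrightarrow> \<xi> \<bullet> y \<le> \<xi> \<bullet> p x + \<delta>"
proof -
  have "\<forall>x\<in>S. \<exists>O' y. open O' \<and> x \<in> O' \<and> O' \<subseteq> X \<and>
    (\<forall>x'\<in>O'. join x' y \<in> interior K \<and> (\<forall>y'\<in>slice K x'. \<xi> \<bullet> y' \<le> \<xi> \<bullet> y + \<delta> / 2))"
    using local_selection[of _ "\<delta> / 2"] S(2) \<delta> by (simp add: subset_iff)
  then obtain N where N: "\<And>x. x \<in> S \<Longrightarrow> open (N x) \<and> x \<in> N x \<and> (\<exists>y. 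
    (\<forall>x'\<in>N x. join x' y \<in> interior K \<and> (\<forall>y'\<in>slice K x'. \<xi> \<bullet> y' \<le> \<xi> \<bullet> y + \<delta> / 2)))"
    by metis
  obtain D where D: "D \<subseteq> S" "finite D" "S \<subseteq> (\<Union>x\<in>D. N x)"
    using compactE_image[OF S(1), of S N] N by (metis UN_I subsetI)
  define \<C> where "\<C> = N ` D"
  have fC: "finite \<C>" using D(2) by (simp add: \<C>_def)
  have "\<forall>V\<in>\<C>. \<exists>y. \<forall>x'\<in>V. join x' y \<in> interior K \<and> (\<forall>y'\<in>slice K x'. \<xi> \<bullet> y' \<le> \<xi> \<bullet> y + \<delta> / 2)"
    using N D(1) by (auto simp: \<C>_def)
  then obtain y where y: "\<And>V x'. V \<in> \<C> \<Longrightarrow> x' \<in> V \<Longrightarrow> join x' (y V) \<in> interior K"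
    "\<And>V x' y'. V \<in> \<C> \<Longrightarrow> x' \<in> V \<Longrightarrow> y' \<in> slice K x' \<Longrightarrow> \<xi> \<bullet> y' \<le> \<xi> \<bullet> y V + \<delta> / 2" by metis
  have locfin: "\<exists>V. open V \<and> x \<in> V \<and> finite {U \<in> \<C>. U \<inter> V \<noteq> {}}" if "x \<in> S" for x
    using fC by (intro exI[of _ UNIV]) auto
  have cover: "S \<subseteq> \<Union>\<C>" using D(3) by (simp add: \<C>_def)
  have opC: "open V" if "V \<in> \<C>" for V using that N D(1) by (auto simp: \<C>_def)
  obtain G :: "(real^'n) set \<Rightarrow> real^'n \<Rightarrow> real" where G: "\<And>V. V \<in> \<C> \<Longrightarrow> continuous_on S (G V) \<and> (\<forall>x\<in>S. 0 \<le> G V x)"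
    "\<And>x V. \<lbrakk>V \<in> \<C>; x \<in> S; x \<notin> V\<rbrakk> \<Longrightarrow> G V x = 0" "\<And>x. x \<in> S \<Longrightarrow> supp_sum (\<lambda>V. G V x) \<C> = 1"
    by (rule subordinate_partition_of_unity[OF cover opC locfin], assumption, assumption, rule that)
  have G1: "(\<Sum>V\<in>\<C>. G V x) = 1" if "x \<in> S" for x
    using G(3)[OF that] fC by (simp add: supp_sum_def support_on_def sum.mono_neutral_left[of \<C> "{V \<in> \<C>. G V x \<noteq> 0}"] cong: conj_cong)
  define s where "s x = (\<Sum>V\<in>\<C>. G V x *\<^sub>R y V)" for x
  have conts: "continuous_on S s" unfolding s_def
    using G(1) by (intro continuous_intros) auto
  have s_int: "join x (s x) \<in> interior K" if x: "x \<in> S" for x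
  proof -
    define \<C>' where "\<C>' = {V \<in> \<C>. x \<in> V}"
    have fC': "finite \<C>'" "\<C>' \<subseteq> \<C>" using fC by (auto simp: \<C>'_def)
    have z: "\<forall>V\<in>\<C> - \<C>'. G V x = 0" using G(2) x by (auto simp: \<C>'_def)
    have "s x = (\<Sum>V\<in>\<C>'. G V x *\<^sub>R y V)" unfolding s_def
      using fC fC' z by (intro sum.mono_neutral_right) auto
    moreover have "(\<Sum>V\<in>\<C>'. G V x) = 1"
      using sum.mono_neutral_right[OF fC fC'(2) z] G1[OF x] by simp
    moreover have "y V \<in> interior (slice K x)" if "V \<in> \<C>'" for V
      using y(1)[of V x] that interior_fibre[of x] x S(2) by (auto simp: \<C>'_def slice_def)
    moreover have "convex (interior (slice K x))" using convex_fibre x S(2) by (intro convex_interior) auto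
    ultimately have "s x \<in> interior (slice K x)"
      using fC' G(1) x by (auto intro!: convex_sum)
    then show ?thesis using interior_fibre[of x] x S(2) by (auto simp: slice_def)
  qed
  have s_sup: "\<xi> \<bullet> y' \<le> \<xi> \<bullet> s x + \<delta> / 2" if x: "x \<in> S" and y': "y' \<in> slice K x" for x y'
  proof -
    have "G V x * (\<xi> \<bullet> y' - \<delta> / 2) \<le> G V x * (\<xi> \<bullet> y V)" if V: "V \<in> \<C>" for V
    proof (cases "x \<in> V")
      case True
      then show ?thesis using y(2)[OF V True y'] G(1)[OF V] x by (intro mult_left_mono) auto
    next
      case False
      then show ?thesis using G(2)[OF V x] by simp
    qed
    then have "(\<Sum>V\<in>\<C>. G V x * (\<xi> \<bullet> y' - \<delta> / 2)) \<le> (\<Sum>V\<in>\<C>. G V x * (\<xi> \<bullet> y V))"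
      by (rule sum_mono)
    then show ?thesis by (simp add: s_def inner_sum_right G1[OF x] flip: sum_distrib_right)
  qed
  have "compact ((\<lambda>x. join x (s x)) ` S)"
    using S(1) conts by (intro compact_continuous_image continuous_intros)
  moreover have "(\<lambda>x. join x (s x)) ` S \<subseteq> interior K" using s_int by auto
  ultimately obtain \<eta> where \<eta>: "0 < \<eta>" 
    "\<And>w z. w \<in> (\<lambda>x. join x (s x)) ` S \<Longrightarrow> dist w z \<le> \<eta> \<Longrightarrow> z \<in> interior K"
    by (rule compact_neighbourhood[OF _ open_interior]) (rule that)
  \<comment> \<open>One tolerance for two purposes: staying in the interior of \<open>K\<close>, and
    losing at most \<open>\<delta> / 2\<close> in the direction \<open>\<xi>\<close>.\<close>
  define e where "e = min \<eta> (\<delta> / 2 / (norm \<xi> + 1))"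
  have e: "0 < e" "e \<le> \<eta>" using \<eta>(1) \<delta> by (auto simp: e_def add_nonneg_pos)
  have e2: "norm \<xi> * e \<le> \<delta> / 2"
  proof -
    have "norm \<xi> * e \<le> (norm \<xi> + 1) * e" using e by (intro mult_right_mono) auto
    also have "\<dots> \<le> (norm \<xi> + 1) * (\<delta> / 2 / (norm \<xi> + 1))" by (intro mult_left_mono) (auto simp: e_def)
    also have "\<dots> = \<delta> / 2" 
    proof -
      have "norm \<xi> + 1 \<noteq> 0" using norm_ge_zero[of \<xi>] by linarith
      then show ?thesis by (metis nonzero_mult_div_cancel_left times_divide_eq_right)
    qed
    finally show ?thesis .
  qed
  obtain p where p: "polynomial_function p" "\<And>x. x \<in> S \<Longrightarrow> norm (s x - p x) < e"
    using Stone_Weierstrass_polynomial_function[OF S(1) conts e(1)] by blast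
  show ?thesis
  proof
    show "polynomial_function p" by fact
    show "join x (p x) \<in> interior K" if "x \<in> S" for x
    proof (rule \<eta>(2))
      show "join x (s x) \<in> (\<lambda>x. join x (s x)) ` S" using that by blast
      show "dist (join x (s x)) (join x (p x)) \<le> \<eta>"
        using norm_join_le[of "x - x" "s x - p x"] p(2)[OF that] e by (simp add: dist_norm join_diff)
    qed
    show "\<xi> \<bullet> y \<le> \<xi> \<bullet> p x + \<delta>" if "x \<in> S" "y \<in> slice K x" for x y
    proof -
      have "\<xi> \<bullet> (s x - p x) \<le> norm \<xi> * norm (s x - p x)" by (rule norm_cauchy_schwarz)
      also have "\<dots> \<le> norm \<xi> * e" using p(2)[OF that(1)] by (intro mult_left_mono) auto
      finally show ?thesis using s_sup[OF that] e2 by (simp add: inner_diff_right)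
    qed
  qed
qed

text \<open>Shrinking the fibre slightly towards an interior point gives a compact subset of its
  interior with almost the full volume; \<open>interior_fibre\<close> and compactness keep this
  subset inside all nearby fibres.\<close>

lemma measure_fibre_lower_semicontinuous:
  assumes x: "x \<in> X" and c: "c < measure lebesgue (slice K x)"
  obtains O' where "open O'" "x \<in> O'" "O' \<subseteq> X" "\<And>x'. x' \<in> O' \<Longrightarrow> c < measure lebesgue (slice K x')"
proof -
  obtain y0 where y0: "y0 \<in> interior (slice K x)" using interior_fibre_nonempty[OF x] by blast
  define v where "v = measure lebesgue (slice K x)"
  have v: "0 < v" "c < v" using measure_fibre_pos[OF x] c by (simp_all add: v_def)
  have "((\<lambda>t. t ^ CARD('m) * v) \<longlongrightarrow> 1 ^ CARD('m) * v) (at_left (1::real))"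
    by (intro tendsto_intros)
  then have "\<forall>\<^sub>F t in at_left (1::real). c < t ^ CARD('m) * v" using v by (intro order_tendstoD) auto
  moreover have "\<forall>\<^sub>F t in at_left (1::real). t \<in> {0<..<1}"
    by (rule eventually_at_leftI[of 0]) auto
  ultimately have "\<exists>t. c < t ^ CARD('m) * v \<and> t \<in> {0<..<1}"
    using eventually_happens'[OF _ eventually_conj] trivial_limit_at_left_real by blast
  then obtain t where t: "0 < t" "t < 1" "c < t ^ CARD('m) * v" by auto
  define S where "S = (\<lambda>y. t *\<^sub>R y + (1 - t) *\<^sub>R y0) ` slice K x"
  have compS: "compact S" unfolding S_def
    using compact_fibre[OF x] by (intro compact_continuous_image continuous_intros)
  have mS: "measure lebesgue S = t ^ CARD('m) * v"
    unfolding S_def v_def using t measure_lebesgue_affine[of t "(1 - t) *\<^sub>R y0" "slice K x"] by simp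
  have "S \<subseteq> interior (slice K x)"
  proof
    fix z assume "z \<in> S"
    then obtain y where y: "y \<in> slice K x" "z = t *\<^sub>R y + (1 - t) *\<^sub>R y0" by (auto simp: S_def)
    have "y - (1 - t) *\<^sub>R (y - y0) \<in> interior (slice K x)"
      using t y(1) by (intro mem_interior_convex_shrink convex_fibre[OF x] y0) auto
    then show "z \<in> interior (slice K x)" by (simp add: y(2) algebra_simps)
  qed
  then have "join x ` S \<subseteq> interior K" using interior_fibre[OF x] by (auto simp: slice_def)
  moreover have "compact (join x ` S)" using compS by (intro compact_continuous_image continuous_intros)
  moreover note compact_neighbourhood[OF _ open_interior]
  ultimately obtain \<eta> where \<eta>: "0 < \<eta>" "\<And>w z. w \<in> join x ` S \<Longrightarrow> dist w z \<le> \<eta> \<Longrightarrow> z \<in> interior K"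
    by metis
  show ?thesis
  proof
    show "open (ball x \<eta> \<inter> X)" "x \<in> ball x \<eta> \<inter> X" "ball x \<eta> \<inter> X \<subseteq> X"
      using open_base x \<eta>(1) by auto
    fix x' assume x': "x' \<in> ball x \<eta> \<inter> X"
    have "S \<subseteq> slice K x'"
    proof
      fix y assume y: "y \<in> S"
      have "dist (join x y) (join x' y) \<le> \<eta>"
        using norm_join_le[of "x - x'" "y - y"] x' by (simp add: dist_norm join_diff)
      then have "join x' y \<in> interior K" using \<eta>(2) y by blast
      then show "y \<in> slice K x'" using interior_subset by (auto simp: slice_def)
    qed
    then have "measure lebesgue S \<le> measure lebesgue (slice K x')"
      using x' fibre_lmeasurable compS by (intro measure_mono_fmeasurable) (auto dest: lmeasurable_compact fmeasurableD)
    then show "c < measure lebesgue (slice K x')" using t(3) mS by simp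
  qed
qed

end

section \<open>Harmonic maps into the fibres\<close>

text \<open>Every point of the ball of radius \<open>R\<close> at distance at least \<open>d\<close>
  from \<open>S\<close> is strictly separated from \<open>S\<close>; compactness leaves finitely
  many half-spaces. The slack \<open>\<delta>\<close> is reserved for the errors of selection and
  averaging.\<close>

lemma finite_halfspace_approx:
  fixes S :: "'a::euclidean_space set"
  assumes "compact S" "convex S" "0 < d"
  obtains J :: "('a \<times> real \<times> real) set" where "finite J"
    "\<And>\<xi> c \<delta>. (\<xi>, c, \<delta>) \<in> J \<Longrightarrow> 0 < \<delta> \<and> (\<forall>y\<in>S. \<xi> \<bullet> y \<le> c - \<delta>)"
    "\<And>y. norm y \<le> R \<Longrightarrow> \<forall>(\<xi>, c, \<delta>)\<in>J. \<xi> \<bullet> y \<le> c \<Longrightarrow> \<exists>s\<in>S. dist s y < d"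
proof -
  define Z where "Z = cball 0 R - (\<Union>s\<in>S. ball s d)"
  have "compact Z" unfolding Z_def by (intro compact_diff compact_cball) auto
  have ex: "\<exists>\<xi> c \<delta>. 0 < \<delta> \<and> (\<forall>y\<in>S. \<xi> \<bullet> y \<le> c - \<delta>) \<and> c < \<xi> \<bullet> p" if "p \<in> Z" for p
  proof -
    have "p \<notin> S" using that assms(3) by (auto simp: Z_def)
    then obtain a b where ab: "a \<bullet> p < b" "\<And>x. x \<in> S \<Longrightarrow> b < a \<bullet> x"
      using separating_hyperplane_closed_point[OF assms(2) compact_imp_closed[OF assms(1)]] by blast
    \<comment> \<open>The bound \<open>c\<close> is placed midway between the separating level and
      the value at \<open>p\<close>, and \<open>\<delta>\<close> is half of that gap.\<close>
    show ?thesis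
      using ab by (intro exI[of _ "-a"] exI[of _ "- ((a \<bullet> p + b) / 2)"] exI[of _ "(b - a \<bullet> p) / 2"])
        (auto simp: field_simps less_imp_le dest!: ab(2))
  qed
  then obtain \<xi> c \<delta> where f: "\<And>p. p \<in> Z \<Longrightarrow> 0 < \<delta> p \<and> (\<forall>y\<in>S. \<xi> p \<bullet> y \<le> c p - \<delta> p) \<and> c p < \<xi> p \<bullet> p"
    by metis
  have "open {y. c p < \<xi> p \<bullet> y}" for p by (intro open_Collect_less continuous_intros)
  moreover have "Z \<subseteq> (\<Union>p\<in>Z. {y. c p < \<xi> p \<bullet> y})" using f by blast
  ultimately obtain P where P: "P \<subseteq> Z" "finite P" "Z \<subseteq> (\<Union>p\<in>P. {y. c p < \<xi> p \<bullet> y})"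
    using compactE_image[OF \<open>compact Z\<close>, of Z "\<lambda>p. {y. c p < \<xi> p \<bullet> y}"] by metis
  show ?thesis
  proof
    show "finite ((\<lambda>p. (\<xi> p, c p, \<delta> p)) ` P)" using P by simp
    show "0 < \<delta>' \<and> (\<forall>y\<in>S. \<xi>' \<bullet> y \<le> c' - \<delta>')" if "(\<xi>', c', \<delta>') \<in> (\<lambda>p. (\<xi> p, c p, \<delta> p)) ` P" for \<xi>' c' \<delta>'
      using that f P(1) by auto
    fix y assume y: "norm y \<le> R" "\<forall>(\<xi>', c', \<delta>')\<in>(\<lambda>p. (\<xi> p, c p, \<delta> p)) ` P. \<xi>' \<bullet> y \<le> c'"
    have "\<xi> p \<bullet> y \<le> c p" if "p \<in> P" for p using y(2) that by auto
    then have "y \<notin> Z" using P(3) by fastforce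
    then show "\<exists>s\<in>S. dist s y < d" using y(1) by (auto simp: Z_def)
  qed
qed

context convex_fibres
begin

text \<open>Continuity method: contract \<open>\<gamma>\<close> to the constant \<open>y0\<close>.
  Each \<open>\<Gamma> t\<close> is harmonic and, by convexity of the fibres, has its graph in
  \<open>K\<close> over the sphere. The parameters whose whole graph lies in \<open>K\<close> form a
  closed set; it is also open, since graphs close to one in \<open>K\<close> lie in \<open>U\<close>
  and the maximum principle returns them to \<open>K\<close>.\<close>

lemma harmonic_graph_in_total:
  fixes \<gamma> :: "real^'n \<Rightarrow> real^'m"
  assumes sub: "subharmonic (star_psd F) U \<rho>" and U: "open U" and K: "K = {z \<in> U. \<rho> z \<le> 0}"
    and E: "\<And>A. A \<in> F \<Longrightarrow> 0 \<le> E \<bullet> A" and EI: "0 < E \<bullet> mat 1"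
    and \<gamma>: "\<And>j. real_polynomial_function (\<lambda>x. \<gamma> x $ j)" "\<And>j x. E \<bullet> hess (\<lambda>x. \<gamma> x $ j) x = 0"
    and r: "0 < r" "cball x0 r \<subseteq> X"
    and y0: "\<And>x. x \<in> cball x0 r \<Longrightarrow> join x y0 \<in> K"
    and sph: "\<And>x. x \<in> sphere x0 r \<Longrightarrow> join x (\<gamma> x) \<in> K"
    and x: "x \<in> cball x0 r"
  shows "join x (\<gamma> x) \<in> K"
proof -
  define \<Gamma> where "\<Gamma> t x = y0 + t *\<^sub>R (\<gamma> x - y0)" for t x
  define B where "B = cball x0 r"
  have cont\<gamma>: "continuous_on A \<gamma>" for A
  proof -
    have "continuous_on A (\<lambda>x. \<chi> j. \<gamma> x $ j)"
      using \<gamma>(1) continuous_real_polymonial_function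
      by (intro continuous_on_vec_lambda) (blast intro: continuous_at_imp_continuous_on)
    then show ?thesis by simp
  qed
  have "compact ((\<lambda>x. \<gamma> x - y0) ` B)"
    unfolding B_def by (intro compact_continuous_image continuous_intros cont\<gamma> compact_cball)
  then have "bounded ((\<lambda>x. \<gamma> x - y0) ` B)" by (rule compact_imp_bounded)
  then obtain M where M: "0 < M" "\<And>x. x \<in> B \<Longrightarrow> norm (\<gamma> x - y0) \<le> M"
    unfolding bounded_pos by auto
  have sphG: "join x (\<Gamma> t x) \<in> K" if x: "x \<in> sphere x0 r" and t: "0 \<le> t" "t \<le> 1" for t x
  proof -
    have "x \<in> B" "x \<in> X" using x r(2) by (auto simp: B_def)
    then have "y0 \<in> slice K x" "\<gamma> x \<in> slice K x" "convex (slice K x)"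
      using y0 sph[OF x] convex_fibre by (auto simp: slice_def B_def)
    then have "(1 - t) *\<^sub>R y0 + t *\<^sub>R \<gamma> x \<in> slice K x"
      using t by (simp add: convex_alt)
    then show ?thesis by (simp add: slice_def \<Gamma>_def algebra_simps)
  qed
  define I where "I = {t \<in> {0..1}. \<forall>x\<in>B. join x (\<Gamma> t x) \<in> K}"
  have "I = {0..1} \<inter> (\<Inter>x\<in>B. (\<lambda>t. join x (\<Gamma> t x)) -` {z \<in> K. fstv z \<in> B})"
    by (auto simp: I_def)
  moreover have "closed ((\<lambda>t. join x (\<Gamma> t x)) -` {z \<in> K. fstv z \<in> B})" for x
    using r(2) unfolding \<Gamma>_def
    by (intro closed_vimage closed_over continuous_intros) (auto simp: B_def)
  ultimately have "closed I" by (simp only:) (intro closed_Int closed_INT ballI closed_atLeastAtMost)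
  then have "closedin (top_of_set {0..1}) I" by (rule closed_subset[rotated]) (auto simp: I_def)
  moreover have "openin (top_of_set {0..1}) I"
    unfolding openin_euclidean_subtopology_iff
  proof (intro conjI ballI)
    show "I \<subseteq> {0..1}" by (auto simp: I_def)
    fix t0 assume t0: "t0 \<in> I"
    have "compact ((\<lambda>x. join x (\<Gamma> t0 x)) ` B)"
      unfolding B_def \<Gamma>_def by (intro compact_continuous_image continuous_intros cont\<gamma> compact_cball)
    moreover have "(\<lambda>x. join x (\<Gamma> t0 x)) ` B \<subseteq> U" using t0 K by (auto simp: I_def)
    ultimately obtain \<eta> where \<eta>: "0 < \<eta>" 
      "\<And>w z. w \<in> (\<lambda>x. join x (\<Gamma> t0 x)) ` B \<Longrightarrow> dist w z \<le> \<eta> \<Longrightarrow> z \<in> U"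
      by (rule compact_neighbourhood[OF _ U]) (rule that)
    have "t \<in> I" if t: "t \<in> {0..1}" "dist t t0 < \<eta> / M" for t
    proof -
      have inU: "join x (\<Gamma> t x) \<in> U" if x: "x \<in> B" for x
      proof (rule \<eta>(2))
        show "join x (\<Gamma> t0 x) \<in> (\<lambda>x. join x (\<Gamma> t0 x)) ` B" using x by blast
        have "join x (\<Gamma> t0 x) - join x (\<Gamma> t x) = join 0 ((t0 - t) *\<^sub>R (\<gamma> x - y0))"
          by (simp add: join_diff \<Gamma>_def algebra_simps)
        then have "dist (join x (\<Gamma> t0 x)) (join x (\<Gamma> t x)) \<le> \<bar>t0 - t\<bar> * norm (\<gamma> x - y0)"
          using norm_join_le[of "0 :: real^'n" "(t0 - t) *\<^sub>R (\<gamma> x - y0)"] by (simp add: dist_norm)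
        also have "\<dots> \<le> \<bar>t0 - t\<bar> * M" using M(2)[OF x] by (intro mult_left_mono) auto
        also have "\<dots> \<le> \<eta>" using t(2) M(1) by (simp add: dist_real_def pos_less_divide_eq abs_minus_commute)
        finally show "dist (join x (\<Gamma> t0 x)) (join x (\<Gamma> t x)) \<le> \<eta>" .
      qed
      have eq: "(\<lambda>x. \<Gamma> t x $ j) = (\<lambda>x. (1 - t) * y0 $ j + t * \<gamma> x $ j)" for j
        by (simp add: \<Gamma>_def fun_eq_iff algebra_simps)
      have poly: "real_polynomial_function (\<lambda>x. \<Gamma> t x $ j)" for j
        unfolding eq by (intro real_polynomial_function.intros(2-4) \<gamma>(1))
      have harm: "E \<bullet> hess (\<lambda>x. \<Gamma> t x $ j) x = 0" for j x
      proof -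
        have td: "twice_diff (\<lambda>x. \<gamma> x $ j) x" "twice_diff (\<lambda>x::real^'n. (1 - t) * y0 $ j) x"
          by (intro twice_diff_real_polynomial_function \<gamma>(1) real_polynomial_function.intros(2))+
        show ?thesis
          unfolding eq twice_diff_add(2)[OF td(2) twice_diff_cmult(1)[OF td(1)]] twice_diff_cmult(2)[OF td(1)] hess_const
          using \<gamma>(2) by simp
      qed
      have "\<rho> (join x (\<Gamma> t x)) \<le> 0" if "x \<in> cball x0 r" for x
        by (rule subharmonic_star_psd_graph[OF sub U E EI poly harm r(1) _ _ that])
          (use inU sphG t(1) K in \<open>auto simp: B_def\<close>)
      then show ?thesis using inU t(1) K by (auto simp: I_def B_def)
    qed
    then show "\<exists>e>0. \<forall>t\<in>{0..1}. dist t t0 < e \<longrightarrow> t \<in> I"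
      using \<eta>(1) M(1) by (intro exI[of _ "\<eta> / M"]) auto
  qed
  ultimately have "I = {} \<or> I = {0..1}"
    using connected_Icc[of 0 "1::real"] unfolding connected_clopen by blast
  moreover have "0 \<in> I" using y0 by (auto simp: I_def \<Gamma>_def B_def)
  ultimately have "1 \<in> I" by auto
  then show ?thesis using x by (auto simp: I_def B_def \<Gamma>_def)
qed

text \<open>The component of a harmonic map in direction \<open>\<xi>\<close>: the boundary data is
  a selection that maximizes \<open>\<xi>\<close> up to \<open>\<delta>\<close>, extended
  componentwise, and its value over \<open>x0\<close> is a point of the fibre.\<close>

lemma harmonic_support_bound:
  assumes sub: "subharmonic (star_psd F) U \<rho>" and U: "open U" and K: "K = {z \<in> U. \<rho> z \<le> 0}"
    and E: "\<And>A. A \<in> F \<Longrightarrow> 0 \<le> E \<bullet> A" and Epsd: "\<And>P. P \<in> psd_mats \<Longrightarrow> 0 \<le> E \<bullet> P" and EI: "0 < E \<bullet> mat 1"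
    and r: "0 < r" "cball x0 r \<subseteq> X"
    and y0: "\<And>x. x \<in> cball x0 r \<Longrightarrow> join x y0 \<in> K"
    and \<delta>: "0 < \<delta>"
  obtains \<phi> where "real_polynomial_function \<phi>" "\<And>x. E \<bullet> hess \<phi> x = 0"
    "\<exists>y\<in>slice K x0. \<phi> x0 = \<xi> \<bullet> y" "\<And>x y. x \<in> sphere x0 r \<Longrightarrow> y \<in> slice K x \<Longrightarrow> \<xi> \<bullet> y \<le> \<phi> x + \<delta>"
proof -
  have S: "compact (sphere x0 r)" "sphere x0 r \<subseteq> X" using r(2) by auto
  obtain p where p: "polynomial_function p" "\<And>x. x \<in> sphere x0 r \<Longrightarrow> join x (p x) \<in> interior K"
    "\<And>x y. x \<in> sphere x0 r \<Longrightarrow> y \<in> slice K x \<Longrightarrow> \<xi> \<bullet> y \<le> \<xi> \<bullet> p x + \<delta>"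
    by (rule polynomial_selection[OF S \<delta>, of \<xi>]) (rule that)
  have "real_polynomial_function (\<lambda>x. p x $ j)" for j
    using p(1) bounded_linear_vec_nth[of j] unfolding polynomial_function_def o_def by blast
  then have "\<exists>\<phi>. real_polynomial_function \<phi> \<and> (\<forall>x. E \<bullet> hess \<phi> x = 0) \<and> (\<forall>x\<in>sphere x0 r. \<phi> x = p x $ j)" for j
    using polynomial_dirichlet_problem[OF Epsd EI r(1), of "\<lambda>x. p x $ j" x0] by metis
  then obtain \<Phi> where \<Phi>: "\<And>j. real_polynomial_function (\<Phi> j)" "\<And>j x. E \<bullet> hess (\<Phi> j) x = 0"
    "\<And>j x. x \<in> sphere x0 r \<Longrightarrow> \<Phi> j x = p x $ j" by metis
  define \<gamma> :: "real^'n \<Rightarrow> real^'m" where "\<gamma> x = (\<chi> j. \<Phi> j x)" for x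
  have \<gamma>p: "\<gamma> x = p x" if "x \<in> sphere x0 r" for x
    using \<Phi>(3)[OF that] by (simp add: \<gamma>_def vec_eq_iff)
  have "join x0 (\<gamma> x0) \<in> K"
  proof (rule harmonic_graph_in_total[OF sub U K E EI _ _ r y0])
    show "join x (\<gamma> x) \<in> K" if "x \<in> sphere x0 r" for x
      using p(2)[OF that] \<gamma>p[OF that] interior_subset by auto
  qed (use \<Phi> r in \<open>auto simp: \<gamma>_def\<close>)
  show ?thesis
  proof
    define \<phi> where "\<phi> x = (\<Sum>j\<in>UNIV. \<xi> $ j * \<Phi> j x)" for x
    have \<phi>: "\<phi> x = \<xi> \<bullet> \<gamma> x" for x by (simp add: \<phi>_def \<gamma>_def inner_vec_def)
    show "real_polynomial_function \<phi>" unfolding \<phi>_def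
      by (intro real_polynomial_function_sum real_polynomial_function.intros(2,4) \<Phi>(1)) auto
    show "E \<bullet> hess \<phi> x = 0" for x
    proof -
      have "twice_diff (\<Phi> j) x" for j by (intro twice_diff_real_polynomial_function \<Phi>(1))
      then have "hess (\<lambda>x. \<Sum>j\<in>UNIV. \<xi> $ j * \<Phi> j x) x = (\<Sum>j\<in>UNIV. \<xi> $ j *\<^sub>R hess (\<Phi> j) x)"
        by (subst twice_diff_sum(2)) (auto simp: twice_diff_cmult)
      then show ?thesis unfolding \<phi>_def[abs_def] by (simp add: inner_sum_right \<Phi>(2))
    qed
    show "\<exists>y\<in>slice K x0. \<phi> x0 = \<xi> \<bullet> y"
      using \<open>join x0 (\<gamma> x0) \<in> K\<close> \<phi> by (intro bexI[of _ "\<gamma> x0"]) (auto simp: slice_def)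
    show "\<xi> \<bullet> y \<le> \<phi> x + \<delta>" if "x \<in> sphere x0 r" "y \<in> slice K x" for x y
      using p(3)[OF that] \<gamma>p[OF that(1)] by (simp add: \<phi>)
  qed
qed

end

section \<open>The main theorem\<close>

context convex_fibres
begin

lemma log_measure_fibre_test:
  assumes sub: "subharmonic (star_psd F) U \<rho>" and U: "open U" and K: "K = {z \<in> U. \<rho> z \<le> 0}"
    and E: "\<And>A. A \<in> F \<Longrightarrow> 0 \<le> E \<bullet> A" and Epsd: "\<And>P. P \<in> psd_mats \<Longrightarrow> 0 \<le> E \<bullet> P" and EI: "0 < E \<bullet> mat 1"
    and V: "open V" "V \<subseteq> X" "x0 \<in> V" and g: "smooth_on V g"
    and ge: "\<And>x. x \<in> V \<Longrightarrow> - ln (measure lebesgue (slice K x)) \<le> g x"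
    and eq: "g x0 = - ln (measure lebesgue (slice K x0))"
  shows "0 \<le> E \<bullet> hess g x0"
proof (rule ccontr)
  assume "\<not> ?thesis"
  then have neg: "E \<bullet> hess g x0 < 0" by simp
  define vol where "vol x = measure lebesgue (slice K x)" for x
  \<comment> \<open>A quarter of the negative ratio: by continuity half of it survives near
    \<open>x0\<close>, and this is just what subtracting
    \<open>\<kappa> * (norm (x - x0))\<^sup>2\<close> from \<open>- g\<close> uses up.\<close>
  define \<kappa> where "\<kappa> = - (E \<bullet> hess g x0) / (4 * (E \<bullet> mat 1))"
  have \<kappa>: "0 < \<kappa>" using neg EI by (auto simp: \<kappa>_def intro!: divide_neg_pos)
  have \<kappa>E: "E \<bullet> hess g x0 = - (4 * \<kappa> * (E \<bullet> mat 1))" using EI by (simp add: \<kappa>_def)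
  have x0X: "x0 \<in> X" using V by auto
  obtain y0 where y0: "y0 \<in> interior (slice K x0)" using interior_fibre_nonempty[OF x0X] by blast
  define O1 where "O1 = V \<inter> (\<lambda>x. E \<bullet> hess g x) -` {..< - (2 * \<kappa> * (E \<bullet> mat 1))}"
  define O2 where "O2 = (\<lambda>x. join x y0) -` interior K"
  have "continuous_on V (\<lambda>x. E \<bullet> hess g x)"
    by (intro continuous_intros smooth_on_imp_continuous_on_hess[OF g])
  then have "open O1" unfolding O1_def using V(1) by (rule continuous_open_preimage) simp
  moreover have "open O2" unfolding O2_def by (intro open_vimage open_interior continuous_intros)
  moreover have "x0 \<in> O1" using V(3) mult_pos_pos[OF \<kappa> EI] by (simp add: O1_def \<kappa>E)
  moreover have "x0 \<in> O2" using y0 interior_fibre[OF x0X] by (auto simp: O2_def slice_def)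
  ultimately obtain r where r: "0 < r" "cball x0 r \<subseteq> O1 \<inter> O2"
    using open_contains_cball[of "O1 \<inter> O2"] open_Int[of O1 O2] by (metis IntI)
  have BV: "cball x0 r \<subseteq> V" using r(2) by (auto simp: O1_def)
  then have BX: "cball x0 r \<subseteq> X" using V(2) by auto
  have Lg: "E \<bullet> hess g x < - (2 * \<kappa> * (E \<bullet> mat 1))" if "x \<in> cball x0 r" for x
    using that r(2) by (auto simp: O1_def)
  have y0K: "join x y0 \<in> K" if "x \<in> cball x0 r" for x
    using that r(2) interior_subset[of K] by (auto simp: O2_def)
  \<comment> \<open>The value of the quadratic correction on the sphere, hence the amount by which
    an average of \<open>g\<close> can be pushed below \<open>g x0\<close>.\<close>
  define \<epsilon> where "\<epsilon> = \<kappa> * r\<^sup>2"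
  have \<epsilon>: "0 < \<epsilon>" using \<kappa> r(1) by (simp add: \<epsilon>_def)
  define S where "S = slice K x0"
  have S: "compact S" "convex S" using compact_fibre convex_fibre x0X by (auto simp: S_def)
  have volpos: "0 < vol x" if "x \<in> X" for x using measure_fibre_pos[OF that] by (simp add: vol_def)
  \<comment> \<open>The permitted volume excess: every measurable subset of the
    \<open>d\<close>-neighbourhood of \<open>S\<close> has volume below
    \<open>vol x0 * exp (\<epsilon> / 2)\<close>.\<close>
  have "0 < vol x0 * (exp (\<epsilon> / 2) - 1)" using volpos[OF x0X] \<epsilon> by simp
  then obtain d where d: "0 < d" 
    "\<And>T. \<lbrakk>T \<in> lmeasurable; \<And>y. y \<in> T \<Longrightarrow> \<exists>x. x \<in> S \<and> dist x y < d\<rbrakk>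
        \<Longrightarrow> measure lebesgue T < measure lebesgue S + vol x0 * (exp (\<epsilon> / 2) - 1)"
    using measure_semicontinuous_with_hausdist_explicit[OF compact_imp_bounded[OF S(1)] negligible_convex_frontier[OF S(2)]]
    by metis
  obtain R where R: "\<And>x y. y \<in> slice K x \<Longrightarrow> norm y \<le> R" by (rule fibre_bound) (rule that)
  obtain J :: "((real^'m) \<times> real \<times> real) set" where J: "finite J"
    "\<And>\<xi> c \<delta>. (\<xi>, c, \<delta>) \<in> J \<Longrightarrow> 0 < \<delta> \<and> (\<forall>y\<in>S. \<xi> \<bullet> y \<le> c - \<delta>)"
    "\<And>y. norm y \<le> R \<Longrightarrow> \<forall>(\<xi>, c, \<delta>)\<in>J. \<xi> \<bullet> y \<le> c \<Longrightarrow> \<exists>s\<in>S. dist s y < d"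
    by (rule finite_halfspace_approx[OF S d(1), of R]) (rule that)
  have "\<exists>\<phi>. real_polynomial_function \<phi> \<and> (\<forall>x. E \<bullet> hess \<phi> x = 0) \<and> (\<exists>y\<in>slice K x0. \<phi> x0 = fst j \<bullet> y) \<and>
     (\<forall>x\<in>sphere x0 r. \<forall>y\<in>slice K x. fst j \<bullet> y \<le> \<phi> x + snd (snd j) / 4)" if "j \<in> J" for j
  proof -
    have "0 < snd (snd j) / 4" using J(2)[of "fst j" "fst (snd j)" "snd (snd j)"] that by simp
    from harmonic_support_bound[OF sub U K E Epsd EI r(1) BX y0K this, of "fst j"] show ?thesis by metis
  qed
  then obtain \<phi> where \<phi>: "\<And>j. j \<in> J \<Longrightarrow> real_polynomial_function (\<phi> j)" "\<And>j x. j \<in> J \<Longrightarrow> E \<bullet> hess (\<phi> j) x = 0"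
    "\<And>j. j \<in> J \<Longrightarrow> \<exists>y\<in>slice K x0. \<phi> j x0 = fst j \<bullet> y"
    "\<And>j x y. j \<in> J \<Longrightarrow> x \<in> sphere x0 r \<Longrightarrow> y \<in> slice K x \<Longrightarrow> fst j \<bullet> y \<le> \<phi> j x + snd (snd j) / 4"
    by metis
  \<comment> \<open>Quantities whose averages are to be nearly non-negative: index
    \<open>None\<close> makes \<open>g\<close> drop on average by almost \<open>\<epsilon>\<close>,
    and \<open>Some j\<close> keeps the average of \<open>\<phi> j\<close> nearly below its value at
    \<open>x0\<close>.\<close>
  define f where "f i x = (case i of None \<Rightarrow> g x0 - \<epsilon> - g x | Some j \<Rightarrow> \<phi> j x0 - \<phi> j x)" for i x
  define Jo where "Jo = insert None (Some ` J)"
  have Jo: "finite Jo" using J(1) by (simp add: Jo_def)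
  have "Ck_on 0 V g" using g by (simp only: smooth_on_def)
  then have contg: "continuous_on (cball x0 r) g" using BV by (auto intro: continuous_on_subset)
  have cont\<phi>: "continuous_on A (\<phi> j)" if "j \<in> J" for A j
    using \<phi>(1)[OF that] continuous_real_polymonial_function by (blast intro: continuous_at_imp_continuous_on)
  have contf: "continuous_on (sphere x0 r) (f i)" if "i \<in> Jo" for i
    unfolding f_def using that continuous_on_subset[OF contg, of "sphere x0 r"]
    by (cases i) (auto simp: Jo_def intro!: continuous_intros cont\<phi>)
  have "\<exists>C. 0 < C \<and> (\<forall>x\<in>sphere x0 r. \<bar>f i x\<bar> \<le> C)" if "i \<in> Jo" for i
    using compact_imp_bounded[OF compact_continuous_image[OF contf[OF that] compact_sphere]]
    unfolding bounded_pos by auto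
  then obtain Ci where Ci: "\<And>i. i \<in> Jo \<Longrightarrow> 0 < Ci i" "\<And>i x. i \<in> Jo \<Longrightarrow> x \<in> sphere x0 r \<Longrightarrow> \<bar>f i x\<bar> \<le> Ci i"
    by metis
  have bound: "\<bar>f i x\<bar> \<le> sum Ci Jo" if "i \<in> Jo" "x \<in> sphere x0 r" for i x
    using Ci(2)[OF that] member_le_sum[OF that(1), of Ci] Ci(1) Jo by (force simp: less_imp_le)
  have pos: "\<exists>x\<in>sphere x0 r. 0 \<le> (\<Sum>i\<in>Jo. \<alpha> i * f i x)" if \<alpha>: "\<And>i. i \<in> Jo \<Longrightarrow> 0 \<le> \<alpha> i" for \<alpha>
  proof -
    define \<beta> where "\<beta> = \<alpha> None"
    have \<beta>: "0 \<le> \<beta>" using \<alpha>[of None] by (simp add: \<beta>_def Jo_def)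
    \<comment> \<open>Chosen so that \<open>E \<bullet> hess h x\<close> is non-negative in the
      ball; \<open>h x0 \<le> h y\<close> for a point \<open>y\<close> of the sphere is then the
      required non-negative combination.\<close>
    define h where "h = (\<lambda>x. (\<Sum>j\<in>J. - \<alpha> (Some j) * \<phi> j x) + (- \<beta> * g x + - (\<beta> * \<kappa>) * (norm (x - x0))\<^sup>2))"
    have tdg: "twice_diff g x" if "x \<in> cball x0 r" for x
      using smooth_on_imp_twice_diff[OF g V(1)] that BV by blast
    have td\<phi>: "twice_diff (\<phi> j) x" if "j \<in> J" for j x
      using that by (intro twice_diff_real_polynomial_function \<phi>(1))
    have tdn: "twice_diff (\<lambda>x. (norm (x - x0))\<^sup>2) x" for x
      by (intro twice_diff_real_polynomial_function real_polynomial_function_norm_sq)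
    have td: "twice_diff h x" and hh: "hess h x = (\<Sum>j\<in>J. - \<alpha> (Some j) *\<^sub>R hess (\<phi> j) x) +
        (- \<beta> *\<^sub>R hess g x + - (\<beta> * \<kappa>) *\<^sub>R (2 *\<^sub>R mat 1))" if x: "x \<in> cball x0 r" for x
    proof -
      have st: "twice_diff (\<lambda>x. - \<alpha> (Some j) * \<phi> j x) x" if "j \<in> J" for j
        by (rule twice_diff_cmult(1)[OF td\<phi>[OF that]])
      have s1: "twice_diff (\<lambda>x. \<Sum>j\<in>J. - \<alpha> (Some j) * \<phi> j x) x"
        by (rule twice_diff_sum(1)[OF J(1)]) (rule st)
      have "hess (\<lambda>x. \<Sum>j\<in>J. - \<alpha> (Some j) * \<phi> j x) x = (\<Sum>j\<in>J. hess (\<lambda>x. - \<alpha> (Some j) * \<phi> j x) x)"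
        by (rule twice_diff_sum(2)[OF J(1)]) (rule st)
      also have "\<dots> = (\<Sum>j\<in>J. - \<alpha> (Some j) *\<^sub>R hess (\<phi> j) x)"
        by (intro sum.cong refl twice_diff_cmult(2) td\<phi>)
      finally have s2: "hess (\<lambda>x. \<Sum>j\<in>J. - \<alpha> (Some j) * \<phi> j x) x = (\<Sum>j\<in>J. - \<alpha> (Some j) *\<^sub>R hess (\<phi> j) x)" .
      note s = s1 s2
      note n = twice_diff_cmult[OF tdn, of "- (\<beta> * \<kappa>)" x]
      note gg = twice_diff_cmult[OF tdg[OF x], of "- \<beta>"]
      note a = twice_diff_add[OF gg(1) n(1)]
      show "twice_diff h x" unfolding h_def by (rule twice_diff_add(1)[OF s(1) a(1)])
      have "hess h x = hess (\<lambda>x. \<Sum>j\<in>J. - \<alpha> (Some j) * \<phi> j x) x + hess (\<lambda>x. - \<beta> * g x + - (\<beta> * \<kappa>) * (norm (x - x0))\<^sup>2) x"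
        unfolding h_def by (rule twice_diff_add(2)[OF s(1) a(1)])
      then show "hess h x = (\<Sum>j\<in>J. - \<alpha> (Some j) *\<^sub>R hess (\<phi> j) x) +
        (- \<beta> *\<^sub>R hess g x + - (\<beta> * \<kappa>) *\<^sub>R (2 *\<^sub>R mat 1))"
        by (simp only: s(2) a(2) gg(2) n(2) hess_norm_sq)
    qed
    have "\<exists>y\<in>sphere x0 r. h x0 \<le> h y"
    proof (rule weak_max_principle[OF Epsd EI _ td])
      show "continuous_on (cball x0 r) h" unfolding h_def
        by (intro continuous_intros contg cont\<phi>)
      fix x assume "x \<in> ball x0 r"
      then have x: "x \<in> cball x0 r" by simp
      have "\<beta> * (E \<bullet> hess g x) \<le> \<beta> * (- (2 * \<kappa> * (E \<bullet> mat 1)))"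
        using Lg[OF x] \<beta> by (intro mult_left_mono) auto
      then show "0 \<le> E \<bullet> hess h x"
        unfolding hh[OF x] inner_add_right inner_sum_right inner_scaleR_right
        using \<phi>(2) by simp
    qed (use r(1) in auto)
    then obtain y where y: "y \<in> sphere x0 r" "h x0 \<le> h y" by blast
    have nrm: "(norm (y - x0))\<^sup>2 = r\<^sup>2" using y(1) by (simp add: dist_norm norm_minus_commute)
    have "h x0 = (\<Sum>j\<in>J. - \<alpha> (Some j) * \<phi> j x0) - \<beta> * g x0" by (simp add: h_def)
    moreover have "h y = (\<Sum>j\<in>J. - \<alpha> (Some j) * \<phi> j y) - \<beta> * g y - \<beta> * \<epsilon>"
      by (simp add: h_def \<epsilon>_def nrm)
    moreover have "(\<Sum>j\<in>J. \<alpha> (Some j) * (\<phi> j x0 - \<phi> j y)) =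
        (\<Sum>j\<in>J. - \<alpha> (Some j) * \<phi> j y) - (\<Sum>j\<in>J. - \<alpha> (Some j) * \<phi> j x0)"
      by (simp add: right_diff_distrib sum_subtractf sum_negf)
    moreover have "\<beta> * (g x0 - \<epsilon> - g y) = \<beta> * g x0 - \<beta> * \<epsilon> - \<beta> * g y"
      by (simp add: right_diff_distrib)
    ultimately have "0 \<le> \<beta> * (g x0 - \<epsilon> - g y) + (\<Sum>j\<in>J. \<alpha> (Some j) * (\<phi> j x0 - \<phi> j y))"
      using y(2) by linarith
    also have "\<dots> = (\<Sum>i\<in>Jo. \<alpha> i * f i y)"
      using J(1) by (simp add: Jo_def f_def \<beta>_def sum.reindex)
    finally show ?thesis using y(1) by blast
  qed
  \<comment> \<open>The averaging error may consume half of the drop \<open>\<epsilon>\<close> and a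
    quarter of each slack; the selection error consumes another quarter.\<close>
  define e where "e = Min (insert (\<epsilon> / 2) ((\<lambda>j. snd (snd j) / 4) ` J))"
  have e: "0 < e" "e \<le> \<epsilon> / 2" "\<And>j. j \<in> J \<Longrightarrow> e \<le> snd (snd j) / 4"
  proof -
    have fin: "finite (insert (\<epsilon> / 2) ((\<lambda>j. snd (snd j) / 4) ` J))" using J(1) by simp
    show "0 < e" unfolding e_def using J(1,2) \<epsilon> by (subst Min_gr_iff[OF fin]) auto
    show "e \<le> \<epsilon> / 2" unfolding e_def by (rule Min_le[OF fin]) simp
    show "e \<le> snd (snd j) / 4" if "j \<in> J" for j
      unfolding e_def by (rule Min_le[OF fin]) (use that in blast)
  qed
  obtain N and x :: "nat \<Rightarrow> real^'n" where N: "0 < N" and x: "\<And>t. t < N \<Longrightarrow> x t \<in> sphere x0 r"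
    and av: "\<And>i. i \<in> Jo \<Longrightarrow> - e * N \<le> (\<Sum>t<N. f i (x t))"
    by (rule approachability[OF Jo bound pos e(1)]) (auto intro: that)
  have xX: "x t \<in> X" "x t \<in> V" if "t < N" for t using x[OF that] BX BV by auto
  define A where "A t = interior (slice K (x t))" for t
  define T where "T = {..<N}"
  have T: "finite T" "T \<noteq> {}" and cT: "card T = N" using N by (auto simp: T_def)
  have A: "open (A t) \<and> bounded (A t) \<and> A t \<noteq> {}" if "t \<in> T" for t
    using that interior_fibre_nonempty[OF xX(1)] compact_imp_bounded[OF compact_fibre[OF xX(1)]]
    by (auto simp: A_def T_def)
  \<comment> \<open>Each half-space of \<open>J\<close> contains the Minkowski mean: averaging the
    support bounds gives at most the value of \<open>\<phi>\<close> at \<open>x0\<close> plus two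
    quarters of the slack.\<close>
  have near: "\<exists>s. s \<in> S \<and> dist s z < d" if z: "z \<in> mean_set T A" for z
  proof -
    obtain y where y: "z = (\<Sum>t\<in>T. y t) /\<^sub>R N" "\<And>t. t \<in> T \<Longrightarrow> y t \<in> slice K (x t)"
      using z interior_subset unfolding mean_set_def A_def cT by blast
    have "norm (\<Sum>t\<in>T. y t) \<le> (\<Sum>t\<in>T. R)" by (rule sum_norm_le) (use y(2) R in blast)
    then have "norm z \<le> R" using N by (simp add: y(1) cT field_simps)
    moreover have "\<xi> \<bullet> z \<le> c" if j: "(\<xi>, c, \<delta>) \<in> J" for \<xi> c \<delta>
    proof -
      let ?j = "(\<xi>, c, \<delta>)"
      have "(\<Sum>t\<in>T. \<xi> \<bullet> y t) \<le> (\<Sum>t\<in>T. \<phi> ?j (x t) + \<delta> / 4)"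
        using \<phi>(4)[OF j] x y(2) by (intro sum_mono) (auto simp: T_def)
      also have "\<dots> \<le> N * (\<phi> ?j x0 + e + \<delta> / 4)"
        using av[of "Some ?j"] j by (simp add: Jo_def f_def T_def sum.distrib sum_subtractf algebra_simps)
      also have "\<dots> \<le> N * c"
      proof (rule mult_left_mono)
        have "\<phi> ?j x0 \<le> c - \<delta>" using \<phi>(3)[OF j] J(2)[OF j] by (auto simp: S_def)
        then show "\<phi> ?j x0 + e + \<delta> / 4 \<le> c" using e(3)[OF j] J(2)[OF j] by simp
      qed simp
      finally show ?thesis using N by (simp add: y(1) inner_sum_right field_simps)
    qed
    ultimately show ?thesis using J(3)[of z] by blast
  qed
  have lmA: "mean_set T A \<in> lmeasurable"
    using T A by (intro lmeasurable_open bounded_mean_set open_mean_set) auto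
  have gx: "(\<Sum>t\<in>T. g (x t)) \<le> N * (g x0 - \<epsilon> / 2)"
    using av[of None] mult_left_mono[OF e(2), of "real N"] 
    by (simp add: Jo_def f_def T_def sum_subtractf sum.distrib algebra_simps)
  \<comment> \<open>The lower bound from Brunn-Minkowski and the upper bound for sets near
    \<open>S\<close> are the same number, and the latter is strict.\<close>
  have "vol x0 * exp (\<epsilon> / 2) = exp (- (g x0 - \<epsilon> / 2))"
    using volpos[OF x0X] by (simp add: eq vol_def exp_diff exp_add)
  also have "\<dots> \<le> exp (- (\<Sum>t\<in>T. g (x t)) / N)"
    using gx N by (simp add: field_simps)
  also have "\<dots> = (\<Prod>t\<in>T. exp (- g (x t))) powr (1 / N)"
    using T by (simp add: exp_powr_real sum_negf flip: exp_sum)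
  also have "\<dots> \<le> (\<Prod>t\<in>T. measure lebesgue (A t)) powr (1 / N)"
  proof (intro powr_mono2 prod_mono prod_nonneg conjI)
    fix t assume t: "t \<in> T"
    have "- ln (vol (x t)) \<le> g (x t)" using t ge xX by (auto simp: vol_def T_def)
    then have "exp (- g (x t)) \<le> exp (ln (vol (x t)))" by simp
    also have "\<dots> = vol (x t)" using t xX volpos by (auto simp: T_def)
    also have "\<dots> = measure lebesgue (A t)"
      using t xX measure_interior_fibre by (simp add: A_def vol_def T_def)
    finally show "exp (- g (x t)) \<le> measure lebesgue (A t)" .
  qed auto
  also have "\<dots> \<le> measure lebesgue (mean_set T A)"
    using multiplicative_Brunn_Minkowski[OF T A] by (simp add: cT)
  also have "\<dots> < measure lebesgue S + vol x0 * (exp (\<epsilon> / 2) - 1)"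
    by (rule d(2)[OF lmA near])
  also have "\<dots> = vol x0 * exp (\<epsilon> / 2)" by (simp add: S_def vol_def algebra_simps)
  finally show False by simp
qed

end

text \<open>For large \<open>B\<close> the matrix \<open>B *\<^sub>R mat 1 + H\<close> is positive
  semidefinite, so \<open>E \<bullet> H < 0\<close> must be compensated by the identity. This
  excludes separating matrices without a second-order part, such as antisymmetric ones, since
  \<open>E\<close> itself is not assumed symmetric.\<close>

lemma inner_mat_1_pos:
  fixes E H :: "real^'n^'n"
  assumes Epsd: "\<And>P. P \<in> psd_mats \<Longrightarrow> 0 \<le> E \<bullet> P" and H: "H \<in> sym_mats" "E \<bullet> H < 0"
  shows "0 < E \<bullet> mat 1"
proof -
  obtain B where B: "0 < B" "\<And>v. norm (H *v v) \<le> B * norm v"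
    using linear_bounded_pos[OF matrix_vector_mul_linear] by blast
  have "B *\<^sub>R mat 1 + H \<in> psd_mats"
  proof -
    have "0 \<le> v \<bullet> ((B *\<^sub>R mat 1 + H) *v v)" for v
    proof -
      have "- (v \<bullet> (H *v v)) \<le> norm v * norm (H *v v)"
        using Cauchy_Schwarz_ineq2[of v "H *v v"] by linarith
      also have "\<dots> \<le> norm v * (B * norm v)" by (intro mult_left_mono B) auto
      also have "\<dots> = B * (v \<bullet> v)" by (simp add: dot_square_norm power2_eq_square)
      finally show ?thesis
        by (simp add: matrix_vector_mult_add_rdistrib scaleR_matrix_vector_assoc[symmetric] inner_add_right)
    qed
    moreover have "B *\<^sub>R mat 1 + H \<in> sym_mats"
      using H(1) by (simp add: sym_mats_def transpose_def vec_eq_iff mat_def)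
    ultimately show ?thesis by (simp add: psd_mats_def)
  qed
  from Epsd[OF this] have "0 < B * (E \<bullet> mat 1)" using H(2) by (simp add: inner_add_right)
  then show ?thesis using B(1) by (simp add: zero_less_mult_iff)
qed

lemma cylinder_eq: "cylinder X = {z. fstv z \<in> X}"
  unfolding cylinder_def by auto (metis join_fstv_sndv)

lemma convex_fibresI:
  fixes X :: "(real^'n) set" and K :: "(real^('n::finite + 'm::finite)) set"
  assumes X: "open X" and K: "closedin (top_of_set (cylinder X)) K" "bounded K"
    and int: "\<forall>x\<in>X. slice (interior K) x = interior (slice K x) \<and> interior (slice K x) \<noteq> {}"
    and sub: "subharmonic (star_psd F) U \<rho>" and U: "open U" and Keq: "K = {z \<in> U. \<rho> z \<le> 0}"
    and conn: "\<forall>x\<in>X. connected (slice K x)"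
  shows "convex_fibres X K"
proof
  obtain T where T: "closed T" "K = cylinder X \<inter> T" using K(1) closedin_closed by blast
  show "closed {z \<in> K. fstv z \<in> S}" if "closed S" "S \<subseteq> X" for S
  proof -
    have "{z \<in> K. fstv z \<in> S} = T \<inter> fstv -` S" using T(2) that(2) by (auto simp: cylinder_eq)
    moreover have "closed (T \<inter> fstv -` S)" using T(1) that(1) by (intro closed_Int closed_vimage continuous_intros)
    ultimately show ?thesis by simp
  qed
  show "convex (slice K x)" if x: "x \<in> X" for x
  proof (rule convex_slice[OF sub U Keq])
    have "slice K x = join x -` T" using T(2) x by (auto simp: slice_def cylinder_eq)
    then show "closed (slice K x)" using T(1) by (simp add: closed_vimage continuous_on_join')
    show "connected (slice K x)" using conn x by blast
  qed
qed (use assms in auto)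

text \<open>The hypothesis \<open>fibres_connected\<close> enters because \<open>U\<close> need only
  be a neighbourhood of \<open>K\<close>: subharmonicity controls only segments inside
  \<open>U\<close>, and fibres made of two disjoint convex pieces are compatible with the remaining
  hypotheses.\<close>

theorem theorem1p7:
  fixes X :: "(real^'n) set"
    and F :: "(real^'n^'n) set"
    and K :: "(real^('n::finite + 'm::finite)) set"
  assumes "open X"
    and "dirichlet_set F" and "convex F" and "cone F"
    and "closedin (top_of_set (cylinder X)) K" and "bounded K"
    and "\<forall>x\<in>X. slice (interior K) x = interior (slice K x) \<and> interior (slice K x) \<noteq> {}"
    and "\<exists>U \<rho>. open U \<and> K \<subseteq> U \<and> subharmonic (star_psd F) U \<rho> \<and> K = {z \<in> U. \<rho> z \<le> 0}"
    and fibres_connected: "\<forall>x\<in>X. connected (slice K x)"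
  shows "subharmonic F X (\<lambda>x. ereal (- ln (measure lebesgue (slice K x))))"
proof -
  obtain U \<rho> where U: "open U" and sub: "subharmonic (star_psd F) U \<rho>" and K: "K = {z \<in> U. \<rho> z \<le> 0}"
    using assms(8) by blast
  interpret convex_fibres X K
    by (rule convex_fibresI[OF assms(1,5,6,7) sub U K fibres_connected])
  have usc: "usc_on X (\<lambda>x. ereal (- ln (measure lebesgue (slice K x))))"
    unfolding usc_on_def
  proof
    fix a :: ereal
    show "openin (top_of_set X) {x \<in> X. ereal (- ln (measure lebesgue (slice K x))) < a}"
    proof (cases a)
      case (real b)
      have less: "ereal (- ln (measure lebesgue (slice K x))) < a \<longleftrightarrow> exp (- b) < measure lebesgue (slice K x)" if "x \<in> X" for x
      proof -
        have "- ln (measure lebesgue (slice K x)) < b \<longleftrightarrow> ln (exp (- b)) < ln (measure lebesgue (slice K x))" by auto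
        also have "\<dots> \<longleftrightarrow> exp (- b) < measure lebesgue (slice K x)"
          using measure_fibre_pos[OF that] by (intro ln_less_cancel_iff) auto
        finally show ?thesis by (simp add: real)
      qed
      have "\<exists>O'. open O' \<and> x \<in> O' \<and> O' \<subseteq> {x \<in> X. ereal (- ln (measure lebesgue (slice K x))) < a}"
        if x: "x \<in> {x \<in> X. ereal (- ln (measure lebesgue (slice K x))) < a}" for x
      proof -
        have xX: "x \<in> X" and "exp (- b) < measure lebesgue (slice K x)" using x less by auto
        then obtain O' where "open O'" "x \<in> O'" "O' \<subseteq> X" "\<And>x'. x' \<in> O' \<Longrightarrow> exp (- b) < measure lebesgue (slice K x')"
          by (rule measure_fibre_lower_semicontinuous) (rule that)
        then show ?thesis using less by (intro exI[of _ O']) auto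
      qed
      then show ?thesis
        using open_subopen[of "{x \<in> X. ereal (- ln (measure lebesgue (slice K x))) < a}"]
        by (intro open_subset) auto
    qed auto
  qed
  have "hess g x0 \<in> F"
    if x0: "x0 \<in> X" and test: "test_function X (\<lambda>x. ereal (- ln (measure lebesgue (slice K x)))) x0 V g" for x0 V g
  proof (rule ccontr)
    assume "hess g x0 \<notin> F"
    have V: "open V" "V \<subseteq> X" "x0 \<in> V" and g: "smooth_on V g"
      and ge: "\<And>x. x \<in> V \<Longrightarrow> - ln (measure lebesgue (slice K x)) \<le> g x"
      and eq: "g x0 = - ln (measure lebesgue (slice K x0))"
      using test by (auto simp: test_function_def)
    have F: "closed F" "F \<noteq> {}" and FP: "\<And>A P. A \<in> F \<Longrightarrow> P \<in> psd_mats \<Longrightarrow> A + P \<in> F"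
      using assms(2) by (auto simp: dirichlet_set_def)
    obtain E b where E: "E \<bullet> hess g x0 < b" "\<And>A. A \<in> F \<Longrightarrow> b < E \<bullet> A"
      using separating_hyperplane_closed_point[OF assms(3) F(1) \<open>hess g x0 \<notin> F\<close>] by blast
    have scale: "c *\<^sub>R A \<in> F" if "A \<in> F" "0 \<le> c" for c A using assms(4) that by (auto simp: cone_def)
    have 0: "0 \<in> F" using scale[of _ 0] F(2) by auto
    \<comment> \<open>A negative value at \<open>A\<close> could be rescaled within the cone to
      equal \<open>b\<close>, against the strict separation.\<close>
    have EF: "0 \<le> E \<bullet> A" if A: "A \<in> F" for A
    proof (rule ccontr)
      assume neg: "\<not> 0 \<le> E \<bullet> A"
      have "b < 0" using E(2)[OF 0] by simp
      then have "b < E \<bullet> ((b / (E \<bullet> A)) *\<^sub>R A)" using neg by (intro E(2) scale A) (simp add: divide_nonpos_neg)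
      then show False using neg by simp
    qed
    \<comment> \<open>The cone contains 0, so stability under adding positive semidefinite matrices
      puts all of these into \<open>F\<close>.\<close>
    have Epsd: "0 \<le> E \<bullet> P" if "P \<in> psd_mats" for P
      using EF[of P] FP[OF 0 that] by simp
    have neg: "E \<bullet> hess g x0 < 0" using E(1) E(2)[OF 0] by simp
    have "0 < E \<bullet> mat 1"
      by (rule inner_mat_1_pos[OF Epsd hess_symmetric[OF smooth_on_imp_twice_diff[OF g V(1,3)]] neg])
    from log_measure_fibre_test[OF sub U K EF Epsd this V g ge eq] neg show False by simp
  qed
  then show ?thesis using usc by (auto simp: subharmonic_def)
qed

end
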